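(* Let $l,m_1,m_2,n_1,n_2\in\mathbb{R}$ and consider the continuous piecewise quadratic differential system $$\dot x=-y+l\,x^2+m_jxy+n_jy^2,\qquad \dot y=x(1-y),\qquad \text{if } (-1)^jy<0,\quad j=1,2$$ (so $j=1$ on $\{y>0\}$ and $j=2$ on $\{y<0\}$). The origin is a center if and only if one of the following conditions holds: \begin{itemize} \item[$(\mathcal H_1^c)$] $m_1=m_2=0$; \item[$(\mathcal H_2^c)$] $m_1-m_2=l+n_2=l+n_1=0$; \item[$(\mathcal H_3^c)$] $2l+1=m_1-m_2=n_1+n_2-1=0$. \end{itemize}
   Context: The separation line is $\{y=0\}$. The origin is a center if some punctured neighborhood of it is filled with crossing periodic orbits surrounding the origin. Here a crossing periodic orbit is obtained by concatenating orbit arcs of the system in $\{y>0\}$ and of the system in $\{y<0\}$ at points of $\{y=0\}$ where both vector fields are transversal to this line and point to the same side. *)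

theory Defs
  imports "HOL-Analysis.Analysis"
begin

type_synonym plane_field = "real \<times> real \<Rightarrow> real \<times> real"

definition orbit_arc ::
  "plane_field \<Rightarrow> (real \<times> real) set \<Rightarrow> (real \<Rightarrow> real \<times> real) \<Rightarrow> real \<Rightarrow> real \<Rightarrow> bool"
where
  "orbit_arc F S \<gamma> a b \<longleftrightarrow>
     a < b \<and>
     (\<forall>t\<in>{a..b}. (\<gamma> has_vector_derivative F (\<gamma> t)) (at t within {a..b})) \<and>
     \<gamma> ` {a<..<b} \<subseteq> S"

text \<open>
  In the following definitions \<open>F\<close> governs \<open>{y > 0}\<close> and \<open>G\<close> governs \<open>{y < 0}\<close>.
  A field is transversal to the line \<open>{y = 0}\<close> at a point iff its second component does
  not vanish there, and the sign of that component is the side to which it points.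
\<close>

definition crossing_point :: "plane_field \<Rightarrow> plane_field \<Rightarrow> real \<times> real \<Rightarrow> bool" where
  "crossing_point F G p \<longleftrightarrow> snd p = 0 \<and> snd (F p) * snd (G p) > 0"

text \<open>
  The orbit is the point set \<open>\<Gamma>\<close>; the closed curve \<open>\<gamma>\<close> tracing it is cut into \<open>k\<close> arcs
  at the times \<open>\<tau> 0 < \<dots> < \<tau> k\<close>. The number of arcs is arbitrary, and the period
  \<open>\<tau> k - \<tau> 0\<close> need not be minimal.
\<close>

definition crossing_periodic_orbit ::
  "plane_field \<Rightarrow> plane_field \<Rightarrow> (real \<times> real) set \<Rightarrow> bool"
where
  "crossing_periodic_orbit F G \<Gamma> \<longleftrightarrow>
     (\<exists>\<gamma> (\<tau> :: nat \<Rightarrow> real) k. 0 < k \<and>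
        (\<forall>i<k. orbit_arc F {p. snd p > 0} \<gamma> (\<tau> i) (\<tau> (Suc i)) \<or>
               orbit_arc G {p. snd p < 0} \<gamma> (\<tau> i) (\<tau> (Suc i))) \<and>
        (\<forall>i\<le>k. crossing_point F G (\<gamma> (\<tau> i))) \<and>
        \<gamma> (\<tau> k) = \<gamma> (\<tau> 0) \<and>
        \<Gamma> = \<gamma> ` {\<tau> 0..\<tau> k})"

text \<open>
  A periodic orbit surrounds the origin iff the origin lies in a bounded component of its
  complement. The neighborhood \<open>U\<close> need not be open.
\<close>

definition center_at_origin :: "plane_field \<Rightarrow> plane_field \<Rightarrow> bool" where
  "center_at_origin F G \<longleftrightarrow>
     (\<exists>U. 0 \<in> interior U \<and>
        U - {0} = \<Union>{\<Gamma>. crossing_periodic_orbit F G \<Gamma> \<and> 0 \<in> inside \<Gamma> \<and> \<Gamma> \<subseteq> U})"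

definition quadratic_field :: "real \<Rightarrow> real \<Rightarrow> real \<Rightarrow> plane_field" where
  "quadratic_field l m n =
     (\<lambda>(x, y). (- y + l * x\<^sup>2 + m * x * y + n * y\<^sup>2, x * (1 - y)))"

end

theory Submission
  imports Defs
begin

text \<open>
  Close to the origin every orbit turns around it, so an orbit is a graph over the angle \<open>\<theta>\<close>, and
  \<open>\<rho> = 1 / r\<close> satisfies a scalar equation \<open>\<rho>' = - A(\<theta>) \<rho> / (\<rho> + B(\<theta>))\<close> whose Lipschitz constant in
  \<open>\<rho>\<close> is small for large \<open>\<rho>\<close>. Hence one contraction yields solutions on the whole circle.

  \<^bold>\<open>Sufficiency.\<close> It remains to match the two half-turns at \<open>\<theta> = \<plusminus>\<pi>\<close>. For \<open>m\<^sub>1 = m\<^sub>2 = 0\<close> and for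
  \<open>n\<^sub>1 = n\<^sub>2 = - l\<close> there are first integrals, which are separated in \<open>(x (1 - y)\<^sup>l, y)\<close> and in
  \<open>(x / (1 + l y), y)\<close>, respectively. For \<open>2 l + 1 = 0\<close> the half-planes are exchanged by a projective
  map that reverses orbits and fixes the line \<open>y = 0\<close>.

  \<^bold>\<open>Necessity.\<close> After reflection and time reversal the lower system is of the same type as the upper
  one. For each of the two one builds \<open>V = r\<^sup>2 + r\<^sup>3 v\<^sub>3(\<theta>) + r\<^sup>4 v\<^sub>4(\<theta>) + r\<^sup>5 v\<^sub>5(\<theta>)\<close> on the half-plane,
  with \<open>v\<^sub>k\<close> not periodic, so that the derivative along orbits is \<open>\<plusminus>\<kappa> r\<^sup>N + O(r\<^bsup>N+1\<^esup>)\<close> and both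
  functions agree on \<open>y = 0\<close>. The coefficient \<open>\<kappa>\<close> is a nonzero multiple of \<open>m\<^sub>1 - m\<^sub>2\<close> for \<open>N = 3\<close>, of
  \<open>m (2 l + n\<^sub>1 + n\<^sub>2)\<close> for \<open>N = 4\<close> and of \<open>m (l + n\<^sub>1) (2 l + 1)\<close> for \<open>N = 5\<close>. If it does not vanish,
  then \<open>V\<close> is strictly monotone along all orbits near the origin, which excludes a center.
\<close>

section \<open>Scalar differential equations\<close>

text \<open>Since \<open>L * (hi - lo) < 1\<close>, the Picard operator contracts the sup norm on
  all of \<open>{lo..hi}\<close>, so a single use of Banach's fixed point theorem covers the whole
  interval. The complete space consists of the bounded continuous functions on the line;
  \<open>clamp\<close> extends a function constantly beyond the interval.\<close>

lemma picard_short_interval: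
  fixes f :: "real \<Rightarrow> real \<Rightarrow> real" and lo hi L t0 x0 :: real
  assumes cont: "continuous_on ({lo..hi} \<times> UNIV) (\<lambda>(t, x). f t x)"
    and lip: "\<And>t x y. t \<in> {lo..hi} \<Longrightarrow> \<bar>f t x - f t y\<bar> \<le> L * \<bar>x - y\<bar>"
    and L: "0 \<le> L" "L * (hi - lo) < 1"
    and t0: "t0 \<in> {lo..hi}"
  obtains \<phi> where "\<phi> t0 = x0"
    and "\<And>t. t \<in> {lo..hi} \<Longrightarrow> (\<phi> has_real_derivative f t (\<phi> t)) (at t within {lo..hi})"
proof -
  have lohi: "lo \<le> hi"
    using t0 by simp
  have contf: "continuous_on {lo..hi} (\<lambda>s. f s (g s))" if "continuous_on {lo..hi} g" for g
  proof -
    have "continuous_on {lo..hi} (\<lambda>s. (s, g s))"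
      by (intro continuous_intros that)
    from continuous_on_compose2[OF cont this] show ?thesis by auto
  qed
  \<comment> \<open>Integration starts at \<open>lo\<close> because \<open>integral {t0..t}\<close>
    is 0 for \<open>t < t0\<close>. The difference \<open>J g t - J g t0\<close> is the oriented
    integral from \<open>t0\<close>.\<close>
  define J where "J g t = integral {lo..t} (\<lambda>s. f s (g s))" for g t
  have J_deriv: "(J g has_real_derivative f t (g t)) (at t within {lo..hi})"
    if "continuous_on {lo..hi} g" "t \<in> {lo..hi}" for g t
    unfolding J_def using integral_has_real_derivative[OF contf[OF that(1)] that(2)] .
  have "\<exists>h :: real \<Rightarrow>\<^sub>C real. \<forall>t. h t = x0 + (J (apply_bcontfun g) (clamp lo hi t) - J (apply_bcontfun g) t0)"
    for g :: "real \<Rightarrow>\<^sub>C real"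
  proof -
    have "continuous_on {lo..hi} (\<lambda>t. x0 + (J (apply_bcontfun g) t - J (apply_bcontfun g) t0))"
      by (intro continuous_intros DERIV_continuous_on[OF J_deriv]) auto
    then have "continuous_on (cbox lo hi) (\<lambda>t. x0 + (J (apply_bcontfun g) t - J (apply_bcontfun g) t0))"
      by simp
    from continuous_on_cbox_bcontfunE[OF this] show ?thesis by metis
  qed
  then obtain T :: "(real \<Rightarrow>\<^sub>C real) \<Rightarrow> (real \<Rightarrow>\<^sub>C real)" where
    T: "\<And>g t. T g t = x0 + (J (apply_bcontfun g) (clamp lo hi t) - J (apply_bcontfun g) t0)"
    by metis
  have clamp_mem: "clamp lo hi t \<in> {lo..hi}" for t
    using clamp_in_interval[of lo hi t] lohi by (simp del: clamp_in_interval)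
  have contr: "dist (T g) (T h) \<le> (L * (hi - lo)) * dist g h" for g h
  proof (rule dist_bound)
    fix t
    define d where "d s = J (apply_bcontfun g) s - J (apply_bcontfun h) s" for s
    have "norm (d (clamp lo hi t) - d t0) \<le> (L * dist g h) * norm (clamp lo hi t - t0)"
    proof (rule field_differentiable_bound)
      show "(d has_real_derivative f s (g s) - f s (h s)) (at s within {lo..hi})" if "s \<in> {lo..hi}" for s
        unfolding d_def by (intro DERIV_diff J_deriv that) auto
      show "norm (f s (g s) - f s (h s)) \<le> L * dist g h" if "s \<in> {lo..hi}" for s
      proof -
        have "\<bar>f s (g s) - f s (h s)\<bar> \<le> L * \<bar>g s - h s\<bar>"
          by (rule lip[OF that])
        also have "\<dots> \<le> L * dist g h"
          using dist_bounded[of g s h] L(1) by (intro mult_left_mono) (auto simp: dist_real_def)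
        finally show ?thesis by simp
      qed
    qed (use t0 clamp_mem in auto)
    also have "\<dots> \<le> (L * dist g h) * (hi - lo)"
      using clamp_mem[of t] t0 L(1) by (intro mult_left_mono) (auto simp: abs_le_iff)
    finally show "dist (T g t) (T h t) \<le> L * (hi - lo) * dist g h"
      by (simp add: T dist_real_def d_def algebra_simps)
  qed
  have "\<exists>!g. T g = g"
    by (rule banach_fix_type[of "L * (hi - lo)"]) (use L lohi contr in auto)
  then obtain g where g: "T g = g" by auto
  have g_eq: "g t = x0 + (J (apply_bcontfun g) t - J (apply_bcontfun g) t0)" if "t \<in> {lo..hi}" for t
    using T[of g t] that unfolding g by (simp del: clamp_cancel_cbox add: clamp_cancel_cbox[of t lo hi, simplified])
  show ?thesis
  proof (rule that)
    show "g t0 = x0"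
      using g_eq[OF t0] by simp
    show "(g has_real_derivative f t (g t)) (at t within {lo..hi})" if "t \<in> {lo..hi}" for t
    proof (rule has_field_derivative_transform_within[OF _ zero_less_one that])
      show "((\<lambda>t. x0 + (J (apply_bcontfun g) t - J (apply_bcontfun g) t0)) has_real_derivative f t (g t))
              (at t within {lo..hi})"
        by (rule derivative_eq_intros J_deriv that refl | simp)+
    qed (use g_eq in auto)
  qed
qed

text \<open>Separation of variables: \<open>\<tau>\<close> is the inverse of the travel time
  \<open>E\<close>, an integral of \<open>1 / \<Theta>\<close>, with time counted from
  \<open>E a\<close>.\<close>

lemma time_change:
  fixes \<Theta> :: "real \<Rightarrow> real"
  assumes ab: "a < b" and cont: "continuous_on {a..b} \<Theta>" and pos: "\<And>s. s \<in> {a..b} \<Longrightarrow> \<Theta> s > 0"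
  obtains T \<tau> where "0 < T" "\<tau> 0 = a" "\<tau> T = b" "\<tau> ` {0..T} = {a..b}" "\<tau> ` {0<..<T} = {a<..<b}"
    "\<And>t. t \<in> {0..T} \<Longrightarrow> (\<tau> has_real_derivative \<Theta> (\<tau> t)) (at t within {0..T})"
proof -
  \<comment> \<open>Freezing the argument outside \<open>{a..b}\<close> extends
    \<open>1 / \<Theta>\<close> continuously to \<open>{a-1..b+1}\<close>. Thus \<open>a\<close> and
    \<open>b\<close> become interior points, where the rule for the derivative of an inverse
    function applies.\<close>
  define cl where "cl s = max a (min b s)" for s
  have cl_mem: "cl s \<in> {a..b}" for s
    using ab by (auto simp: cl_def)
  have cl_id: "cl s = s" if "s \<in> {a..b}" for s
    using that by (auto simp: cl_def)
  define E where "E s = integral {a-1..s} (\<lambda>u. 1 / \<Theta> (cl u))" for s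
  have "continuous_on {a-1..b+1} (\<lambda>u. 1 / \<Theta> (cl u))"
  proof (intro continuous_intros continuous_on_compose2[OF cont, of _ cl])
    show "continuous_on {a-1..b+1} cl"
      unfolding cl_def by (intro continuous_intros)
  qed (use cl_mem pos in \<open>force simp: less_imp_neq[symmetric]\<close>)+
  from integral_has_real_derivative[OF this]
  have E_within: "(E has_real_derivative 1 / \<Theta> (cl s)) (at s within {a-1..b+1})" if "s \<in> {a-1..b+1}" for s
    unfolding E_def using that by blast
  have E_deriv: "(E has_real_derivative 1 / \<Theta> (cl s)) (at s)" if "a-1 < s" "s < b+1" for s
    using E_within[of s] that at_within_Icc_at[of "a-1" s "b+1"] by simp
  have E_mono: "E s < E u" if "a-1 \<le> s" "s < u" "u \<le> b+1" for s u
  proof (rule DERIV_pos_imp_increasing_open[OF that(2)])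
    show "\<exists>y. (E has_real_derivative y) (at v) \<and> 0 < y" if v: "s < v" "v < u" for v
      using E_deriv[of v] pos[OF cl_mem, of v] v that \<open>a-1 \<le> s\<close> \<open>u \<le> b+1\<close> by fastforce
    show "continuous_on {s..u} E"
      by (rule continuous_on_subset[OF DERIV_continuous_on[OF E_within]]) (use that in auto)
  qed
  define g where "g = inv_into {a-1..b+1} E"
  have inj: "inj_on E {a-1..b+1}"
    by (rule linorder_inj_onI) (use E_mono in fastforce)+
  have gE: "g (E s) = s" if "a-1 \<le> s" "s \<le> b+1" for s
    unfolding g_def using that inj by (intro inv_into_f_f) auto
  have surj: "\<exists>s. u \<le> s \<and> s \<le> v \<and> E s = z" if "E u \<le> z" "z \<le> E v" "a-1 \<le> u" "u \<le> v" "v \<le> b+1" for u v z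
    by (rule IVT') (use that in \<open>auto intro!: continuous_on_subset[OF DERIV_continuous_on[OF E_within]]\<close>)
  have Eg: "E (g z) = z" if "E (a-1) < z" "z < E (b+1)" for z
    using surj[of "a-1" z "b+1"] that ab gE by force
  define \<tau> where "\<tau> t = g (E a + t)" for t
  define T where "T = E b - E a"
  have \<tau>: "\<tau> (E s - E a) = s" if "s \<in> {a..b}" for s
    using gE[of s] that by (simp add: \<tau>_def)
  have repr: "\<exists>s\<in>{a..b}. t = E s - E a" if "t \<in> {0..T}" for t
    using surj[of a "E a + t" b] that ab by (force simp: T_def)
  have E_le: "E s \<le> E u" if "a-1 \<le> s" "s \<le> u" "u \<le> b+1" for s u
    using E_mono[of s u] that by (cases "s = u") auto
  show ?thesis
  proof (rule that[of T \<tau>])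
    show "0 < T"
      unfolding T_def using E_mono[of a b] ab by simp
    show "\<tau> 0 = a" "\<tau> T = b"
      using \<tau>[of a] \<tau>[of b] ab by (auto simp: T_def)
    show "\<tau> ` {0..T} = {a..b}"
    proof (intro equalityI subsetI)
      fix s assume "s \<in> \<tau> ` {0..T}"
      then obtain t where "t \<in> {0..T}" "s = \<tau> t" by auto
      with repr[of t] \<tau> show "s \<in> {a..b}" by auto
    next
      fix s assume s: "s \<in> {a..b}"
      then have "E s - E a \<in> {0..T}" using E_le[of a s] E_le[of s b] by (auto simp: T_def)
      then show "s \<in> \<tau> ` {0..T}" using \<tau>[OF s] by (intro image_eqI[of _ _ "E s - E a"]) auto
    qed
    show "\<tau> ` {0<..<T} = {a<..<b}"
    proof (intro equalityI subsetI)
      fix s assume "s \<in> \<tau> ` {0<..<T}"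
      then obtain t where t: "t \<in> {0<..<T}" "s = \<tau> t" by auto
      with repr[of t] obtain u where u: "u \<in> {a..b}" "t = E u - E a" by auto
      then have "s = u" "u \<noteq> a" "u \<noteq> b" using t \<tau>[of u] by (auto simp: T_def)
      then show "s \<in> {a<..<b}" using u by auto
    next
      fix s assume s: "s \<in> {a<..<b}"
      then have "E s - E a \<in> {0<..<T}" using E_mono[of a s] E_mono[of s b] by (auto simp: T_def)
      then show "s \<in> \<tau> ` {0<..<T}" using \<tau>[of s] s by (intro image_eqI[of _ _ "E s - E a"]) auto
    qed
    fix t assume "t \<in> {0..T}"
    with repr[of t] obtain s where s: "s \<in> {a..b}" "t = E s - E a" by blast
    have "(g has_real_derivative inverse (1 / \<Theta> (cl s))) (at (E s))"
    proof (rule DERIV_inverse_function[where f = E and a = "E (a-1)" and b = "E (b+1)"])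
      show "(E has_real_derivative 1 / \<Theta> (cl s)) (at (g (E s)))"
        using gE[of s] E_deriv[of s] s by auto
      show "1 / \<Theta> (cl s) \<noteq> 0" using pos[OF cl_mem, of s] by simp
      show "E (a-1) < E s" "E s < E (b+1)" using E_mono[of "a-1" s] E_mono[of s "b+1"] s by auto
      show "isCont g (E s)"
        by (rule isCont_inverse_function2[where a = "a - 1/2" and b = "b + 1/2"])
           (use s gE in \<open>auto intro!: DERIV_isCont[OF E_deriv]\<close>)
    qed (use Eg in auto)
    then have "(g has_real_derivative \<Theta> s) (at (E a + t))"
      using s cl_id[of s] by simp
    then have "(\<tau> has_real_derivative \<Theta> s * 1) (at t)"
      unfolding \<tau>_def by (rule DERIV_chain2) (rule derivative_eq_intros refl | simp)+
    then show "(\<tau> has_real_derivative \<Theta> (\<tau> t)) (at t within {0..T})"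
      using \<tau>[OF s(1)] s(2) has_field_derivative_at_within by force
  qed
qed

section \<open>The system in polar coordinates\<close>

text \<open>
  The components, on the unit circle, of the quadratic part of \<open>x' = - y + a x\<^sup>2 + b x y + f y\<^sup>2\<close>,
  \<open>y' = x + e x y\<close>, so that \<open>r' = r\<^sup>2 A(\<theta>)\<close> and \<open>\<theta>' = 1 + r B(\<theta>)\<close>.
\<close>

definition radial :: "real \<Rightarrow> real \<Rightarrow> real \<Rightarrow> real \<Rightarrow> real \<Rightarrow> real" where
  "radial a b f e \<theta> =
     cos \<theta> * (a * (cos \<theta>)\<^sup>2 + b * cos \<theta> * sin \<theta> + f * (sin \<theta>)\<^sup>2) + sin \<theta> * (e * cos \<theta> * sin \<theta>)"

definition angular :: "real \<Rightarrow> real \<Rightarrow> real \<Rightarrow> real \<Rightarrow> real \<Rightarrow> real" where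
  "angular a b f e \<theta> =
     cos \<theta> * (e * cos \<theta> * sin \<theta>) - sin \<theta> * (a * (cos \<theta>)\<^sup>2 + b * cos \<theta> * sin \<theta> + f * (sin \<theta>)\<^sup>2)"

text \<open>The equation of an orbit with radius \<open>1 / \<rho>\<close>, obtained by dividing the
  radial by the angular speed. The last coefficient is \<open>-1\<close> because
  \<open>y' = x - x y\<close>. Positivity of the denominator means that the angle increases with
  time.\<close>

definition polar_orbit :: "real \<Rightarrow> real \<Rightarrow> real \<Rightarrow> (real \<Rightarrow> real) \<Rightarrow> real set \<Rightarrow> bool" where
  "polar_orbit l m n \<rho> S \<longleftrightarrow>
     (\<forall>\<theta>\<in>S. 0 < \<rho> \<theta> \<and> 0 < \<rho> \<theta> + angular l m n (-1) \<theta> \<and>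
        (\<rho> has_real_derivative - radial l m n (-1) \<theta> * \<rho> \<theta> / (\<rho> \<theta> + angular l m n (-1) \<theta>)) (at \<theta> within S))"

definition polar_point :: "(real \<Rightarrow> real) \<Rightarrow> real \<Rightarrow> real \<times> real" where
  "polar_point \<rho> \<theta> = (cos \<theta> / \<rho> \<theta>, sin \<theta> / \<rho> \<theta>)"

lemma abs_mult_le_right:
  fixes k t :: real
  assumes "\<bar>t\<bar> \<le> 1"
  shows "\<bar>t * k\<bar> \<le> \<bar>k\<bar>"
  using mult_right_mono[OF assms, of "\<bar>k\<bar>"] by (simp add: abs_mult)

lemma abs_trig_quadratic_le:
  fixes a b f \<theta> :: real
  shows "\<bar>a * (cos \<theta>)\<^sup>2 + b * cos \<theta> * sin \<theta> + f * (sin \<theta>)\<^sup>2\<bar> \<le> \<bar>a\<bar> + \<bar>b\<bar> + \<bar>f\<bar>"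
proof -
  have "\<bar>cos \<theta> * sin \<theta>\<bar> \<le> 1" by (simp add: abs_mult mult_le_one)
  then have "\<bar>(cos \<theta>)\<^sup>2 * a\<bar> \<le> \<bar>a\<bar>" "\<bar>(cos \<theta> * sin \<theta>) * b\<bar> \<le> \<bar>b\<bar>" "\<bar>(sin \<theta>)\<^sup>2 * f\<bar> \<le> \<bar>f\<bar>"
    by (intro abs_mult_le_right; simp add: abs_square_le_1)+
  then have "\<bar>(cos \<theta>)\<^sup>2 * a + (cos \<theta> * sin \<theta>) * b + (sin \<theta>)\<^sup>2 * f\<bar> \<le> \<bar>a\<bar> + \<bar>b\<bar> + \<bar>f\<bar>"
    by (intro order_trans[OF abs_triangle_ineq] add_mono)
  then show ?thesis by (simp add: ac_simps)
qed

lemma abs_radial_le: "\<bar>radial a b f e \<theta>\<bar> \<le> \<bar>a\<bar> + \<bar>b\<bar> + \<bar>f\<bar> + \<bar>e\<bar>"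
  and abs_angular_le: "\<bar>angular a b f e \<theta>\<bar> \<le> \<bar>a\<bar> + \<bar>b\<bar> + \<bar>f\<bar> + \<bar>e\<bar>"
proof -
  have "\<bar>(cos \<theta> * sin \<theta>) * e\<bar> \<le> \<bar>e\<bar>"
    by (intro abs_mult_le_right) (simp add: abs_mult mult_le_one)
  then have e: "\<bar>e * cos \<theta> * sin \<theta>\<bar> \<le> \<bar>e\<bar>" by (simp add: ac_simps)
  note q = abs_trig_quadratic_le[of a \<theta> b f]
  show "\<bar>radial a b f e \<theta>\<bar> \<le> \<bar>a\<bar> + \<bar>b\<bar> + \<bar>f\<bar> + \<bar>e\<bar>"
    unfolding radial_def
    by (rule order_trans[OF abs_triangle_ineq]) (intro add_mono[of _ "\<bar>a\<bar> + \<bar>b\<bar> + \<bar>f\<bar>"]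
        order_trans[OF abs_mult_le_right[OF abs_cos_le_one] q] order_trans[OF abs_mult_le_right[OF abs_sin_le_one] e])
  have "\<bar>angular a b f e \<theta>\<bar> \<le> \<bar>e\<bar> + (\<bar>a\<bar> + \<bar>b\<bar> + \<bar>f\<bar>)"
    unfolding angular_def
    by (rule order_trans[OF abs_triangle_ineq4]) (intro add_mono[of _ "\<bar>e\<bar>"]
        order_trans[OF abs_mult_le_right[OF abs_sin_le_one] q] order_trans[OF abs_mult_le_right[OF abs_cos_le_one] e])
  then show "\<bar>angular a b f e \<theta>\<bar> \<le> \<bar>a\<bar> + \<bar>b\<bar> + \<bar>f\<bar> + \<bar>e\<bar>" by simp
qed

lemma continuous_on_radial [continuous_intros]:
  "continuous_on S (g :: 'a::t2_space \<Rightarrow> real) \<Longrightarrow> continuous_on S (\<lambda>t. radial a b f e (g t))"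
  unfolding radial_def by (intro continuous_intros)

lemma continuous_on_angular [continuous_intros]:
  "continuous_on S (g :: 'a::t2_space \<Rightarrow> real) \<Longrightarrow> continuous_on S (\<lambda>t. angular a b f e (g t))"
  unfolding angular_def by (intro continuous_intros)

lemma polar_orbit_exists:
  fixes l m n C :: real
  assumes C0: "\<bar>l\<bar> + \<bar>m\<bar> + \<bar>n\<bar> + 1 \<le> C" and \<rho>0: "30 * C \<le> \<rho>0" and \<theta>0: "\<theta>0 \<in> {-pi..pi}"
  obtains \<rho> where "\<rho> \<theta>0 = \<rho>0" "\<And>\<theta>. \<theta> \<in> {-pi..pi} \<Longrightarrow> \<rho>0 - 16 * C \<le> \<rho> \<theta>"
    "polar_orbit l m n \<rho> {-pi..pi}"
proof -
  let ?A = "radial l m n (-1)" and ?B = "angular l m n (-1)"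
  have C: "1 \<le> C" using C0 by linarith
  have A: "\<bar>?A \<theta>\<bar> \<le> C" and B: "\<bar>?B \<theta>\<bar> \<le> C" for \<theta>
    using abs_radial_le[of l m n "-1" \<theta>] abs_angular_le[of l m n "-1" \<theta>] C0 by simp_all
  \<comment> \<open>Truncation at \<open>12 * C\<close> keeps the denominator above
    \<open>11 * C\<close>. This yields the Lipschitz constant
    \<open>C^2 / (11 * C)^2 = 1/121\<close>, and the full circle has length
    \<open>2 * pi < 8\<close>, far below 121.\<close>
  define M where "M x = max x (12 * C)" for x
  have M: "12 * C \<le> M x" for x by (simp add: M_def)
  have den: "11 * C \<le> M x + ?B \<theta>" for x \<theta>
    using M[of x] B[of \<theta>] by linarith
  have den_pos: "0 < M x + ?B \<theta>" for x \<theta>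
    using den[of x \<theta>] C by linarith
  define F where "F \<theta> x = - ?A \<theta> * M x / (M x + ?B \<theta>)" for \<theta> x
  have F_bound: "\<bar>F \<theta> x\<bar> \<le> 2 * C" for \<theta> x
  proof -
    have "\<bar>M x / (M x + ?B \<theta>)\<bar> \<le> 2"
      using den_pos[of x \<theta>] M[of x] B[of \<theta>] C by (simp add: abs_le_iff divide_simps)
    then have "\<bar>?A \<theta>\<bar> * \<bar>M x / (M x + ?B \<theta>)\<bar> \<le> C * 2"
      using A[of \<theta>] C by (intro mult_mono) auto
    then show ?thesis by (simp add: F_def abs_mult abs_divide)
  qed
  have F_lip: "\<bar>F \<theta> x - F \<theta> y\<bar> \<le> 1/121 * \<bar>x - y\<bar>" for \<theta> x y
  proof -
    have p: "M x + ?B \<theta> \<noteq> 0" "M y + ?B \<theta> \<noteq> 0"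
      using den_pos[of x \<theta>] den_pos[of y \<theta>] by auto
    have "F \<theta> x - F \<theta> y = - (?A \<theta> * ?B \<theta>) * (M x - M y) / ((M x + ?B \<theta>) * (M y + ?B \<theta>))"
    proof -
      have "x / (x + b) - y / (y + b) = b * (x - y) / ((x + b) * (y + b))"
        if "x + b \<noteq> 0" "y + b \<noteq> 0" for x y b :: real
        using that by (simp add: divide_simps) (simp add: algebra_simps)
      note e = this[OF p]
      have "F \<theta> x - F \<theta> y = - ?A \<theta> * (M x / (M x + ?B \<theta>) - M y / (M y + ?B \<theta>))"
        by (simp add: F_def right_diff_distrib)
      then show ?thesis unfolding e by simp
    qed
    then have "\<bar>F \<theta> x - F \<theta> y\<bar> = \<bar>?A \<theta>\<bar> * \<bar>?B \<theta>\<bar> * \<bar>M x - M y\<bar> / ((M x + ?B \<theta>) * (M y + ?B \<theta>))"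
      using den_pos[of x \<theta>] den_pos[of y \<theta>] by (simp add: abs_mult abs_divide)
    also have "\<dots> \<le> C * C * \<bar>x - y\<bar> / ((11 * C) * (11 * C))"
    proof (rule frac_le)
      show "\<bar>?A \<theta>\<bar> * \<bar>?B \<theta>\<bar> * \<bar>M x - M y\<bar> \<le> C * C * \<bar>x - y\<bar>"
        using A[of \<theta>] B[of \<theta>] C by (intro mult_mono) (auto simp: M_def)
      show "11 * C * (11 * C) \<le> (M x + ?B \<theta>) * (M y + ?B \<theta>)"
        using den[of x \<theta>] den[of y \<theta>] C by (intro mult_mono) auto
    qed (use C in auto)
    also have "\<dots> = 1/121 * \<bar>x - y\<bar>" using C by simp
    finally show ?thesis .
  qed
  have F_cont: "continuous_on ({-pi..pi} \<times> UNIV) (\<lambda>(t, x). F t x)"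
    unfolding F_def M_def case_prod_beta
    using den_pos[unfolded M_def, THEN less_imp_neq, THEN not_sym]
    by (intro continuous_intros) auto
  have "1/121 * (pi - (-pi)) < 1" using pi_less_4 by simp
  from picard_short_interval[OF F_cont F_lip _ this \<theta>0, of \<rho>0]
  obtain \<rho> where \<rho>: "\<rho> \<theta>0 = \<rho>0"
    and der: "\<And>t. t \<in> {-pi..pi} \<Longrightarrow> (\<rho> has_real_derivative F t (\<rho> t)) (at t within {-pi..pi})"
    by auto
  \<comment> \<open>With slope at most \<open>2 * C\<close> over a length below 8 the solution moves
    by at most \<open>16 * C\<close>. Starting from at least \<open>30 * C\<close> it stays above
    \<open>12 * C\<close>, so the truncation is never active and \<open>F\<close> is the original
    right-hand side.\<close>
  have lower: "\<rho>0 - 16 * C \<le> \<rho> \<theta>" if "\<theta> \<in> {-pi..pi}" for \<theta>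
  proof -
    have "norm (\<rho> \<theta> - \<rho> \<theta>0) \<le> 2 * C * norm (\<theta> - \<theta>0)"
      by (rule field_differentiable_bound[OF _ der]) (use that \<theta>0 F_bound in auto)
    also have "\<dots> \<le> 2 * C * 8"
      using that \<theta>0 C pi_less_4 by (intro mult_left_mono) (auto simp: abs_le_iff)
    finally show ?thesis using \<rho> by (simp add: abs_le_iff)
  qed
  have large: "M (\<rho> \<theta>) = \<rho> \<theta>" if "\<theta> \<in> {-pi..pi}" for \<theta>
    using lower[OF that] \<rho>0 C by (simp add: M_def)
  show ?thesis
  proof (rule that[of \<rho>, OF \<rho> lower])
    show "polar_orbit l m n \<rho> {-pi..pi}"
      unfolding polar_orbit_def
    proof (intro ballI conjI)
      fix \<theta> assume \<theta>: "\<theta> \<in> {-pi..pi}"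
      show "0 < \<rho> \<theta>" using lower[OF \<theta>] \<rho>0 C by linarith
      show "0 < \<rho> \<theta> + ?B \<theta>" using den_pos[of "\<rho> \<theta>" \<theta>] large[OF \<theta>] by simp
      show "(\<rho> has_real_derivative - ?A \<theta> * \<rho> \<theta> / (\<rho> \<theta> + ?B \<theta>)) (at \<theta> within {-pi..pi})"
        using der[OF \<theta>] large[OF \<theta>] by (simp add: F_def)
    qed
  qed
qed

lemma polar_orbit_subset: "polar_orbit l m n \<rho> S \<Longrightarrow> T \<subseteq> S \<Longrightarrow> polar_orbit l m n \<rho> T"
  by (auto simp: polar_orbit_def intro: DERIV_subset)

lemma polar_orbit_continuous: "polar_orbit l m n \<rho> S \<Longrightarrow> continuous_on S \<rho>"
  unfolding polar_orbit_def
  by (rule DERIV_continuous_on[where D = "\<lambda>\<theta>. - radial l m n (-1) \<theta> * \<rho> \<theta> / (\<rho> \<theta> + angular l m n (-1) \<theta>)"]) blast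

lemma radial_angular_components:
  "cos \<theta> * radial a b f e \<theta> - sin \<theta> * angular a b f e \<theta> =
     a * (cos \<theta>)\<^sup>2 + b * cos \<theta> * sin \<theta> + f * (sin \<theta>)\<^sup>2"
  "sin \<theta> * radial a b f e \<theta> + cos \<theta> * angular a b f e \<theta> = e * cos \<theta> * sin \<theta>"
proof -
  have *: "c * (c * X + s * Y) - s * (c * Y - s * X) = X" "s * (c * X + s * Y) + c * (c * Y - s * X) = Y"
    if "s\<^sup>2 + c\<^sup>2 = 1" for c s X Y :: real
    using that by algebra+
  show "cos \<theta> * radial a b f e \<theta> - sin \<theta> * angular a b f e \<theta> =
      a * (cos \<theta>)\<^sup>2 + b * cos \<theta> * sin \<theta> + f * (sin \<theta>)\<^sup>2"
    "sin \<theta> * radial a b f e \<theta> + cos \<theta> * angular a b f e \<theta> = e * cos \<theta> * sin \<theta>"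
    unfolding radial_def angular_def by (intro *; simp)+
qed

text \<open>The scalar factor is \<open>dt / d\<theta>\<close>, the reciprocal of the angular speed
  \<open>1 + r B(\<theta>)\<close> at \<open>r = 1 / \<rho>\<close>. Rotating the radial and angular
  components back gives the Cartesian field.\<close>

lemma polar_point_has_vector_derivative:
  assumes "polar_orbit l m n \<rho> S" "\<theta> \<in> S"
  shows "(polar_point \<rho> has_vector_derivative
           (\<rho> \<theta> / (\<rho> \<theta> + angular l m n (-1) \<theta>)) *\<^sub>R quadratic_field l m n (polar_point \<rho> \<theta>)) (at \<theta> within S)"
proof -
  define A B c s r where "A = radial l m n (-1) \<theta>" "B = angular l m n (-1) \<theta>"
    "c = cos \<theta>" "s = sin \<theta>" "r = \<rho> \<theta>"
  note abbr = this[symmetric]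
  have pos: "r \<noteq> 0" "r + B \<noteq> 0"
    and der: "(\<rho> has_real_derivative - A * r / (r + B)) (at \<theta> within S)"
    using assms by (force simp: polar_orbit_def abbr)+
  have comp: "l * c\<^sup>2 + m * c * s + n * s\<^sup>2 = c * A - s * B" "- c * s = s * A + c * B"
    using radial_angular_components[of \<theta> l m n "-1"] by (simp_all add: abbr)
  have "fst (quadratic_field l m n (polar_point \<rho> \<theta>)) = - s / r + (l * c\<^sup>2 + m * c * s + n * s\<^sup>2) / r\<^sup>2"
    "snd (quadratic_field l m n (polar_point \<rho> \<theta>)) = c / r + (- c * s) / r\<^sup>2"
    using pos by (simp_all add: quadratic_field_def polar_point_def abbr field_simps power2_eq_square)
  then have F: "fst (quadratic_field l m n (polar_point \<rho> \<theta>)) = - s / r + (c * A - s * B) / r\<^sup>2"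
    "snd (quadratic_field l m n (polar_point \<rho> \<theta>)) = c / r + (s * A + c * B) / r\<^sup>2"
    unfolding comp by simp_all
  have dx: "((\<lambda>t. cos t / \<rho> t) has_real_derivative
      (r / (r + B)) * fst (quadratic_field l m n (polar_point \<rho> \<theta>))) (at \<theta> within S)"
  proof -
    have "((\<lambda>t. cos t / \<rho> t) has_real_derivative (- s * r - c * (- A * r / (r + B))) / (r * r)) (at \<theta> within S)"
      using DERIV_divide[OF has_field_derivative_at_within[OF DERIV_cos] der] pos by (simp add: abbr)
    also have "(- s * r - c * (- A * r / (r + B))) / (r * r) = r / (r + B) * fst (quadratic_field l m n (polar_point \<rho> \<theta>))"
      unfolding F using pos by (simp add: divide_simps) (simp add: algebra_simps power2_eq_square)
    finally show ?thesis .
  qed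
  have dy: "((\<lambda>t. sin t / \<rho> t) has_real_derivative
      (r / (r + B)) * snd (quadratic_field l m n (polar_point \<rho> \<theta>))) (at \<theta> within S)"
  proof -
    have "((\<lambda>t. sin t / \<rho> t) has_real_derivative (c * r - s * (- A * r / (r + B))) / (r * r)) (at \<theta> within S)"
      using DERIV_divide[OF has_field_derivative_at_within[OF DERIV_sin] der] pos by (simp add: abbr)
    also have "(c * r - s * (- A * r / (r + B))) / (r * r) = r / (r + B) * snd (quadratic_field l m n (polar_point \<rho> \<theta>))"
      unfolding F using pos by (simp add: divide_simps) (simp add: algebra_simps power2_eq_square)
    finally show ?thesis .
  qed
  have "((\<lambda>t. (cos t / \<rho> t, sin t / \<rho> t)) has_vector_derivative
      (r / (r + B)) *\<^sub>R quadratic_field l m n (polar_point \<rho> \<theta>)) (at \<theta> within S)"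
    using has_vector_derivative_Pair[OF dx[unfolded has_real_derivative_iff_has_vector_derivative]
        dy[unfolded has_real_derivative_iff_has_vector_derivative]]
    by (simp add: scaleR_prod_def)
  then show ?thesis
    by (simp add: abbr flip: polar_point_def)
qed

section \<open>Crossing periodic orbits from polar solutions\<close>

lemma polar_arc:
  assumes orb: "polar_orbit l m n \<rho> {u..v}" and uv: "u < v"
    and S: "polar_point \<rho> ` {u<..<v} \<subseteq> S"
  obtains T \<gamma> where "orbit_arc (quadratic_field l m n) S \<gamma> 0 T"
    "\<gamma> 0 = polar_point \<rho> u" "\<gamma> T = polar_point \<rho> v" "\<gamma> ` {0..T} = polar_point \<rho> ` {u..v}"
proof -
  \<comment> \<open>The angular speed \<open>1 + r B(\<theta>)\<close> at
    \<open>r = 1 / \<rho>\<close>; running through the angles with this speed cancels the factor in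
    \<open>polar_point_has_vector_derivative\<close>.\<close>
  define \<Theta> where "\<Theta> \<theta> = (\<rho> \<theta> + angular l m n (-1) \<theta>) / \<rho> \<theta>" for \<theta>
  have pos: "0 < \<rho> \<theta>" "0 < \<rho> \<theta> + angular l m n (-1) \<theta>" if "\<theta> \<in> {u..v}" for \<theta>
    using orb that by (auto simp: polar_orbit_def)
  have "continuous_on {u..v} \<Theta>"
    unfolding \<Theta>_def using polar_orbit_continuous[OF orb] pos(1)
    by (intro continuous_intros) force+
  then obtain T \<tau> where T: "0 < T" "\<tau> 0 = u" "\<tau> T = v" "\<tau> ` {0..T} = {u..v}" "\<tau> ` {0<..<T} = {u<..<v}"
    and der: "\<And>t. t \<in> {0..T} \<Longrightarrow> (\<tau> has_real_derivative \<Theta> (\<tau> t)) (at t within {0..T})"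
    by (rule time_change[OF uv]) (use pos in \<open>auto simp: \<Theta>_def\<close>)
  show ?thesis
  proof (rule that)
    show "orbit_arc (quadratic_field l m n) S (polar_point \<rho> \<circ> \<tau>) 0 T"
      unfolding orbit_arc_def
    proof (intro conjI ballI T(1))
      show "(polar_point \<rho> \<circ> \<tau>) ` {0<..<T} \<subseteq> S"
        using S T(5) by (metis image_comp)
      fix t assume t: "t \<in> {0..T}"
      then have mem: "\<tau> t \<in> {u..v}" using T(4) by auto
      define D where "D = (\<rho> (\<tau> t) / (\<rho> (\<tau> t) + angular l m n (-1) (\<tau> t))) *\<^sub>R quadratic_field l m n (polar_point \<rho> (\<tau> t))"
      have "(polar_point \<rho> has_vector_derivative D) (at (\<tau> t) within \<tau> ` {0..T})"
        using polar_point_has_vector_derivative[OF orb mem] unfolding T(4) D_def .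
      from vector_diff_chain_within[OF der[OF t, unfolded has_real_derivative_iff_has_vector_derivative] this]
      have "(polar_point \<rho> \<circ> \<tau> has_vector_derivative \<Theta> (\<tau> t) *\<^sub>R D) (at t within {0..T})" .
      moreover have "\<Theta> (\<tau> t) *\<^sub>R D = quadratic_field l m n (polar_point \<rho> (\<tau> t))"
        using pos[OF mem] by (simp add: D_def \<Theta>_def)
      ultimately show "(polar_point \<rho> \<circ> \<tau> has_vector_derivative
          quadratic_field l m n ((polar_point \<rho> \<circ> \<tau>) t)) (at t within {0..T})"
        by simp
    qed
    show "(polar_point \<rho> \<circ> \<tau>) ` {0..T} = polar_point \<rho> ` {u..v}"
      using T(4) by (metis image_comp)
  qed (use T in auto)
qed

lemma orbit_arc_cong:
  assumes "orbit_arc F S \<gamma> a b" "\<And>t. t \<in> {a..b} \<Longrightarrow> \<gamma>' t = \<gamma> t"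
  shows "orbit_arc F S \<gamma>' a b"
proof -
  have "(\<gamma>' has_vector_derivative F (\<gamma>' t)) (at t within {a..b})" if t: "t \<in> {a..b}" for t
    by (rule has_vector_derivative_transform_within[OF _ zero_less_one t, of \<gamma>])
      (use assms t in \<open>auto simp: orbit_arc_def\<close>)
  moreover have "\<gamma>' ` {a<..<b} = \<gamma> ` {a<..<b}"
    using assms(2) by (intro image_cong) auto
  ultimately show ?thesis using assms(1) by (auto simp: orbit_arc_def)
qed

lemma orbit_arc_shift:
  assumes "orbit_arc F S \<gamma> a b"
  shows "orbit_arc F S (\<lambda>t. \<gamma> (t - d)) (a + d) (b + d)"
  unfolding orbit_arc_def
proof (intro conjI ballI)
  show "a + d < b + d" using assms by (simp add: orbit_arc_def)
  have im: "(\<lambda>t. t - d) ` {a + d..b + d} = {a..b}" "(\<lambda>t. t - d) ` {a + d<..<b + d} = {a<..<b}"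
    by (auto intro!: image_eqI[of x _ "x + d" for x])
  show "(\<lambda>t. \<gamma> (t - d)) ` {a + d<..<b + d} \<subseteq> S"
    using assms im(2) unfolding orbit_arc_def by (metis image_image)
  fix t assume "t \<in> {a + d..b + d}"
  then have "(\<gamma> has_vector_derivative F (\<gamma> (t - d))) (at (t - d) within (\<lambda>t. t - d) ` {a + d..b + d})"
    using assms im(1) by (simp add: orbit_arc_def)
  moreover have "((\<lambda>t. t - d) has_vector_derivative 1) (at t within {a + d..b + d})"
    by (auto intro!: derivative_eq_intros)
  ultimately show "((\<lambda>t. \<gamma> (t - d)) has_vector_derivative F (\<gamma> (t - d))) (at t within {a + d..b + d})"
    using vector_diff_chain_within[of "\<lambda>t. t - d" 1 t "{a + d..b + d}" \<gamma>] by (simp add: o_def)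
qed

section \<open>The polar angle up to reflection, and gluing along the separation line\<close>

text \<open>With values in \<open>{0..pi}\<close> on both half-planes, this is the angle modulo
  reflection in \<open>y = 0\<close>. It has no branch cut, so it is continuous on the whole
  punctured plane, and one interval of angles serves both half-planes.\<close>

definition polar_angle :: "real \<times> real \<Rightarrow> real" where
  "polar_angle p = arccos (fst p / norm p)"

lemma polar_cosine_bounds:
  fixes p :: "real \<times> real"
  assumes "p \<noteq> 0"
  shows "-1 \<le> fst p / norm p" "fst p / norm p \<le> 1"
proof -
  have "\<bar>fst p\<bar> \<le> norm p" by (metis norm_fst_le prod.collapse real_norm_def)
  then show "-1 \<le> fst p / norm p" "fst p / norm p \<le> 1"
    using assms by (auto simp: divide_simps abs_le_iff)
qed

lemma polar_angle:
  assumes "p \<noteq> 0"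
  shows "polar_angle p \<in> {0..pi}" "fst p = norm p * cos (polar_angle p)" "\<bar>snd p\<bar> = norm p * sin (polar_angle p)"
proof -
  have n: "norm p > 0" using assms by simp
  note b = polar_cosine_bounds[OF assms]
  show "polar_angle p \<in> {0..pi}" unfolding polar_angle_def using arccos_bounded[OF b] by simp
  show "fst p = norm p * cos (polar_angle p)" unfolding polar_angle_def using b n by simp
  have "norm p ^ 2 = (fst p)^2 + (snd p)^2" by (simp add: norm_prod_def)
  then have "(fst p / norm p)^2 + (snd p / norm p)^2 = (norm p)^2 / (norm p)^2"
    by (simp only: power_divide add_divide_distrib)
  then have "(fst p / norm p)^2 + (snd p / norm p)^2 = 1" using n by simp
  then have "1 - (fst p / norm p)^2 = (snd p / norm p)^2" by simp
  then have "sin (polar_angle p) = \<bar>snd p\<bar> / norm p"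
    unfolding polar_angle_def using b by (simp add: sin_arccos real_sqrt_abs)
  then show "\<bar>snd p\<bar> = norm p * sin (polar_angle p)" using n by simp
qed

lemma continuous_on_polar_angle: "continuous_on (- {0}) polar_angle"
  unfolding polar_angle_def using polar_cosine_bounds by (intro continuous_intros ballI) auto

lemma polar_angle_axis:
  assumes "p \<noteq> 0" "snd p = 0"
  shows "polar_angle p = 0 \<or> polar_angle p = pi"
proof -
  have "norm p = \<bar>fst p\<bar>" using assms(2) by (simp add: norm_prod_def)
  then show ?thesis
    using assms by (cases "fst p > 0") (auto simp: polar_angle_def prod_eq_iff)
qed

text \<open>The two half-planes are closed in the punctured plane and meet only where the angle is 0
  or \<open>pi\<close>, so the pasting lemma asks for agreement at these two angles.\<close>

lemma continuous_on_polar_glue: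
  fixes g h :: "real \<Rightarrow> real \<Rightarrow> real"
  assumes g: "continuous_on (UNIV \<times> {0..pi}) (\<lambda>(r, \<theta>). g r \<theta>)"
    and h: "continuous_on (UNIV \<times> {0..pi}) (\<lambda>(r, \<theta>). h r \<theta>)"
    and eq: "\<And>r. g r 0 = h r 0" "\<And>r. g r pi = h r pi"
  shows "continuous_on (- {0}) (\<lambda>p. if 0 \<le> snd p then g (norm p) (polar_angle p) else h (norm p) (polar_angle p))"
proof -
  let ?P = "{p :: real \<times> real. p \<noteq> 0 \<and> 0 \<le> snd p}" and ?N = "{p :: real \<times> real. p \<noteq> 0 \<and> snd p \<le> 0}"
  have cl: "closed {p :: real \<times> real. 0 \<le> snd p}" "closed {p :: real \<times> real. snd p \<le> 0}"
    by (intro closed_Collect_le continuous_intros)+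
  have pair: "continuous_on S (\<lambda>p. (norm p, polar_angle p))" if "S \<subseteq> - {0}" for S
    by (intro continuous_intros continuous_on_subset[OF continuous_on_polar_angle that])
  have "continuous_on (?P \<union> ?N) (\<lambda>p. if 0 \<le> snd p then g (norm p) (polar_angle p) else h (norm p) (polar_angle p))"
  proof (rule continuous_on_cases_local)
    show "closedin (top_of_set (?P \<union> ?N)) ?P"
      unfolding closedin_closed by (intro exI[of _ "{p. 0 \<le> snd p}"]) (use cl in auto)
    show "closedin (top_of_set (?P \<union> ?N)) ?N"
      unfolding closedin_closed by (intro exI[of _ "{p. snd p \<le> 0}"]) (use cl in auto)
    show "continuous_on ?P (\<lambda>p. g (norm p) (polar_angle p))"
      using continuous_on_compose2[OF g pair[of ?P]] polar_angle(1) by force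
    show "continuous_on ?N (\<lambda>p. h (norm p) (polar_angle p))"
      using continuous_on_compose2[OF h pair[of ?N]] polar_angle(1) by force
    show "g (norm p) (polar_angle p) = h (norm p) (polar_angle p)"
      if "p \<in> ?P \<and> \<not> 0 \<le> snd p \<or> p \<in> ?N \<and> 0 \<le> snd p" for p
    proof -
      have "p \<noteq> 0" "snd p = 0" using that by auto
      then show ?thesis using polar_angle_axis[of p] eq by auto
    qed
  qed
  moreover have "?P \<union> ?N = - {0}" by auto
  ultimately show ?thesis by simp
qed

lemma norm_polar_point: "\<rho> \<theta> > 0 \<Longrightarrow> norm (polar_point \<rho> \<theta>) = 1 / \<rho> \<theta>"
proof -
  assume "\<rho> \<theta> > 0"
  have "(cos \<theta> / \<rho> \<theta>)\<^sup>2 + (sin \<theta> / \<rho> \<theta>)\<^sup>2 = (1 / \<rho> \<theta>)\<^sup>2"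
    by (simp only: power_divide add_divide_distrib[symmetric] sin_cos_squared_add2 power_one)
  then show ?thesis
    unfolding polar_point_def norm_Pair real_norm_def power2_abs using \<open>\<rho> \<theta> > 0\<close> by simp
qed

section \<open>Closed polar curves as crossing periodic orbits around the origin\<close>

definition closed_polar_pair ::
  "real \<Rightarrow> real \<Rightarrow> real \<Rightarrow> real \<Rightarrow> real \<Rightarrow> (real \<Rightarrow> real) \<Rightarrow> (real \<Rightarrow> real) \<Rightarrow> bool" where
  "closed_polar_pair l m\<^sub>1 n\<^sub>1 m\<^sub>2 n\<^sub>2 \<rho>\<^sub>1 \<rho>\<^sub>2 \<longleftrightarrow>
     polar_orbit l m\<^sub>1 n\<^sub>1 \<rho>\<^sub>1 {0..pi} \<and> polar_orbit l m\<^sub>2 n\<^sub>2 \<rho>\<^sub>2 {-pi..0} \<and>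
     \<rho>\<^sub>1 0 = \<rho>\<^sub>2 0 \<and> \<rho>\<^sub>1 pi = \<rho>\<^sub>2 (-pi)"

text \<open>The function \<open>g\<close>, the norm times the value of \<open>\<rho>\<close> in the
  direction of the point, is a gauge for the curve: it is 0 at the origin and takes the value 1 only
  on the curve. Hence \<open>g < 1\<close> on the component of the origin in the complement, and the
  positive lower bound \<open>\<delta>\<close> of \<open>R\<close> makes that component
  bounded.\<close>

lemma origin_inside_polar_curve:
  assumes c1: "continuous_on {0..pi} \<rho>\<^sub>1" and c2: "continuous_on {-pi..0} \<rho>\<^sub>2"
    and p1: "\<And>\<theta>. \<theta> \<in> {0..pi} \<Longrightarrow> 0 < \<rho>\<^sub>1 \<theta>" and p2: "\<And>\<theta>. \<theta> \<in> {-pi..0} \<Longrightarrow> 0 < \<rho>\<^sub>2 \<theta>"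
    and eq: "\<rho>\<^sub>1 0 = \<rho>\<^sub>2 0" "\<rho>\<^sub>1 pi = \<rho>\<^sub>2 (-pi)"
  shows "0 \<in> inside (polar_point \<rho>\<^sub>1 ` {0..pi} \<union> polar_point \<rho>\<^sub>2 ` {-pi..0})" (is "0 \<in> inside ?\<Gamma>")
proof -
  define R where "R p = (if 0 \<le> snd p then \<rho>\<^sub>1 (polar_angle p) else \<rho>\<^sub>2 (- polar_angle p))" for p
  define g where "g p = norm p * R p" for p
  note ang = polar_angle(1)
  have R_cont: "continuous_on (- {0}) R"
    unfolding R_def
  proof (rule continuous_on_polar_glue)
    show "continuous_on (UNIV \<times> {0..pi}) (\<lambda>(r :: real, \<theta>). \<rho>\<^sub>1 \<theta>)"
      unfolding case_prod_beta by (intro continuous_on_compose2[OF c1] continuous_intros) auto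
    show "continuous_on (UNIV \<times> {0..pi}) (\<lambda>(r :: real, \<theta>). \<rho>\<^sub>2 (- \<theta>))"
      unfolding case_prod_beta by (intro continuous_on_compose2[OF c2] continuous_intros) auto
  qed (use eq in auto)
  obtain \<delta> where \<delta>: "0 < \<delta>" "\<And>p. p \<noteq> 0 \<Longrightarrow> \<delta> \<le> R p" and
    K: "\<exists>K. \<forall>p. p \<noteq> 0 \<longrightarrow> R p \<le> K"
  proof -
    obtain t1 where t1: "t1 \<in> {0..pi}" "\<And>t. t \<in> {0..pi} \<Longrightarrow> \<rho>\<^sub>1 t1 \<le> \<rho>\<^sub>1 t"
      using continuous_attains_inf[OF compact_Icc _ c1] by force
    obtain t2 where t2: "t2 \<in> {-pi..0}" "\<And>t. t \<in> {-pi..0} \<Longrightarrow> \<rho>\<^sub>2 t2 \<le> \<rho>\<^sub>2 t"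
      using continuous_attains_inf[OF compact_Icc _ c2] by force
    obtain s1 where s1: "s1 \<in> {0..pi}" "\<And>t. t \<in> {0..pi} \<Longrightarrow> \<rho>\<^sub>1 t \<le> \<rho>\<^sub>1 s1"
      using continuous_attains_sup[OF compact_Icc _ c1] by force
    obtain s2 where s2: "s2 \<in> {-pi..0}" "\<And>t. t \<in> {-pi..0} \<Longrightarrow> \<rho>\<^sub>2 t \<le> \<rho>\<^sub>2 s2"
      using continuous_attains_sup[OF compact_Icc _ c2] by force
    show ?thesis
    proof (rule that)
      show "0 < min (\<rho>\<^sub>1 t1) (\<rho>\<^sub>2 t2)" using p1[OF t1(1)] p2[OF t2(1)] by simp
      show "min (\<rho>\<^sub>1 t1) (\<rho>\<^sub>2 t2) \<le> R p" if "p \<noteq> 0" for p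
        using ang[OF that] t1(2)[of "polar_angle p"] t2(2)[of "- polar_angle p"] by (auto simp: R_def)
      have "R p \<le> max (\<rho>\<^sub>1 s1) (\<rho>\<^sub>2 s2)" if "p \<noteq> 0" for p
        using ang[OF that] s1(2)[of "polar_angle p"] s2(2)[of "- polar_angle p"] by (auto simp: R_def)
      then show "\<exists>K. \<forall>p. p \<noteq> 0 \<longrightarrow> R p \<le> K" by blast
    qed
  qed
  have g_cont: "continuous_on UNIV g"
  proof -
    have "isCont g p" for p
    proof (cases "p = 0")
      case True
      obtain K where K: "\<And>p. p \<noteq> 0 \<Longrightarrow> R p \<le> K" using K by blast
      \<comment> \<open>\<open>R\<close> depends only on the direction and in general has no limit
        at the origin; its boundedness suffices because of the factor \<open>norm p\<close>.\<close>
      have "(g \<longlongrightarrow> 0) (at 0)"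
      proof (rule Lim_null_comparison)
        have "norm (g p) \<le> norm p * K" if "p \<noteq> 0" for p
          using \<delta> K[OF that] \<delta>(2)[OF that] by (simp add: g_def abs_mult mult_left_mono)
        then show "\<forall>\<^sub>F p in at 0. norm (g p) \<le> norm p * K"
          by (auto simp: eventually_at_filter)
        show "((\<lambda>p. norm p * K) \<longlongrightarrow> 0) (at (0 :: real \<times> real))"
          by (auto intro!: tendsto_eq_intros)
      qed
      then show ?thesis using True by (simp add: isCont_def g_def)
    next
      case False
      have "continuous_on (- {0}) g"
        unfolding g_def by (intro continuous_intros R_cont)
      then show ?thesis using False by (simp add: continuous_on_eq_continuous_at open_Compl)
    qed
    then show ?thesis by (simp add: continuous_on_eq_continuous_at)
  qed
  have on_curve: "p \<in> ?\<Gamma>" if "g p = 1" for p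
  proof -
    have p: "p \<noteq> 0" using that by (auto simp: g_def)
    have R: "norm p = 1 / R p" "R p \<noteq> 0"
      using that \<delta> \<delta>(2)[OF p] by (auto simp: g_def field_simps)
    note pol = polar_angle[OF p]
    show ?thesis
    proof (cases "0 \<le> snd p")
      case True
      then have "p = polar_point \<rho>\<^sub>1 (polar_angle p)"
        using pol R by (simp add: prod_eq_iff polar_point_def R_def)
      then show ?thesis using pol(1) by blast
    next
      case False
      then have "p = polar_point \<rho>\<^sub>2 (- polar_angle p)"
        using pol R by (simp add: prod_eq_iff polar_point_def R_def)
      then show ?thesis using pol(1) by (intro UnI2 image_eqI[of _ _ "- polar_angle p"]) auto
    qed
  qed
  have "polar_point \<rho>\<^sub>1 \<theta> \<noteq> 0" if "\<theta> \<in> {0..pi}" for \<theta>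
    using norm_polar_point[of \<rho>\<^sub>1, OF p1[OF that]] p1[OF that] by auto
  moreover have "polar_point \<rho>\<^sub>2 \<theta> \<noteq> 0" if "\<theta> \<in> {-pi..0}" for \<theta>
    using norm_polar_point[of \<rho>\<^sub>2, OF p2[OF that]] p2[OF that] by auto
  ultimately have "0 \<notin> ?\<Gamma>" by (metis Un_iff imageE)
  moreover have "connected_component_set (- ?\<Gamma>) 0 \<subseteq> cball 0 (1 / \<delta>)"
  proof
    fix q assume q: "q \<in> connected_component_set (- ?\<Gamma>) 0"
    have "g q < 1"
    proof (rule ccontr)
      assume "\<not> g q < 1"
      have "connected (g ` connected_component_set (- ?\<Gamma>) 0)"
        by (intro connected_continuous_image continuous_on_subset[OF g_cont]) auto
      moreover have "g 0 \<in> g ` connected_component_set (- ?\<Gamma>) 0" "g q \<in> g ` connected_component_set (- ?\<Gamma>) 0"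
        using q \<open>0 \<notin> ?\<Gamma>\<close> by (auto simp: connected_component_refl_eq)
      moreover have "g 0 \<le> 1" "1 \<le> g q" using \<open>\<not> g q < 1\<close> by (auto simp: g_def)
      ultimately have "1 \<in> g ` connected_component_set (- ?\<Gamma>) 0"
        by (meson connectedD_interval)
      then show False using on_curve connected_component_subset by fastforce
    qed
    have "norm q * \<delta> \<le> 1"
    proof (cases "q = 0")
      case False
      then have "norm q * \<delta> \<le> norm q * R q" using \<delta> by (intro mult_left_mono) auto
      then show ?thesis using \<open>g q < 1\<close> by (simp add: g_def)
    qed simp
    then show "q \<in> cball 0 (1 / \<delta>)" using \<delta>(1) by (simp add: field_simps)
  qed
  ultimately show ?thesis
    unfolding inside_def using bounded_subset[OF bounded_cball] by auto
qed

lemma closed_polar_pair_crossing_periodic_orbit: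
  assumes "closed_polar_pair l m\<^sub>1 n\<^sub>1 m\<^sub>2 n\<^sub>2 \<rho>\<^sub>1 \<rho>\<^sub>2"
  shows "crossing_periodic_orbit (quadratic_field l m\<^sub>1 n\<^sub>1) (quadratic_field l m\<^sub>2 n\<^sub>2)
           (polar_point \<rho>\<^sub>1 ` {0..pi} \<union> polar_point \<rho>\<^sub>2 ` {-pi..0})"
proof -
  let ?F = "quadratic_field l m\<^sub>1 n\<^sub>1" and ?G = "quadratic_field l m\<^sub>2 n\<^sub>2"
  have o1: "polar_orbit l m\<^sub>1 n\<^sub>1 \<rho>\<^sub>1 {0..pi}" and o2: "polar_orbit l m\<^sub>2 n\<^sub>2 \<rho>\<^sub>2 {-pi..0}"
    and eq: "\<rho>\<^sub>1 0 = \<rho>\<^sub>2 0" "\<rho>\<^sub>1 pi = \<rho>\<^sub>2 (-pi)"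
    using assms by (auto simp: closed_polar_pair_def)
  have pos1: "0 < \<rho>\<^sub>1 \<theta>" if "\<theta> \<in> {0..pi}" for \<theta> using o1 that by (auto simp: polar_orbit_def)
  have pos2: "0 < \<rho>\<^sub>2 \<theta>" if "\<theta> \<in> {-pi..0}" for \<theta> using o2 that by (auto simp: polar_orbit_def)
  have "polar_point \<rho>\<^sub>1 ` {0<..<pi} \<subseteq> {p. snd p > 0}"
    using pos1 sin_gt_zero by (auto simp: polar_point_def)
  from polar_arc[OF o1 pi_gt_zero this] obtain T1 \<gamma>1 where
    a1: "orbit_arc ?F {p. snd p > 0} \<gamma>1 0 T1" and e1: "\<gamma>1 0 = polar_point \<rho>\<^sub>1 0" "\<gamma>1 T1 = polar_point \<rho>\<^sub>1 pi"
    and i1: "\<gamma>1 ` {0..T1} = polar_point \<rho>\<^sub>1 ` {0..pi}" by metis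
  have "sin \<theta> < 0" if "-pi < \<theta>" "\<theta> < 0" for \<theta>
    using sin_gt_zero[of "-\<theta>"] that by simp
  then have "polar_point \<rho>\<^sub>2 ` {-pi<..<0} \<subseteq> {p. snd p < 0}"
    using pos2 by (auto simp: polar_point_def divide_neg_pos)
  from polar_arc[OF o2 _ this] obtain T2 \<gamma>2 where
    a2: "orbit_arc ?G {p. snd p < 0} \<gamma>2 0 T2" and e2: "\<gamma>2 0 = polar_point \<rho>\<^sub>2 (-pi)" "\<gamma>2 T2 = polar_point \<rho>\<^sub>2 0"
    and i2: "\<gamma>2 ` {0..T2} = polar_point \<rho>\<^sub>2 ` {-pi..0}"
    using pi_gt_zero by (metis neg_less_0_iff_less)
  have T: "0 < T1" "0 < T2" using a1 a2 by (auto simp: orbit_arc_def)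
  define \<gamma> where "\<gamma> t = (if t \<le> T1 then \<gamma>1 t else \<gamma>2 (t - T1))" for t
  have join: "\<gamma>1 T1 = \<gamma>2 0" using e1 e2 eq by (simp add: polar_point_def)
  have \<gamma>2: "\<gamma> t = \<gamma>2 (t - T1)" if "T1 \<le> t" for t
    using that join by (cases "t = T1") (auto simp: \<gamma>_def)
  have ends: "\<gamma> 0 = (1 / \<rho>\<^sub>1 0, 0)" "\<gamma> T1 = (- 1 / \<rho>\<^sub>1 pi, 0)" "\<gamma> (T1 + T2) = (1 / \<rho>\<^sub>1 0, 0)"
    using T e1 e2 eq \<gamma>2[of "T1 + T2"] by (auto simp: \<gamma>_def polar_point_def)
  \<comment> \<open>Two arcs: the upper half-turn from angle 0 to \<open>pi\<close> during
    \<open>{0..T1}\<close>, then the lower one from \<open>-pi\<close> to 0, shifted by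
    \<open>T1\<close>.\<close>
  define \<tau> where "\<tau> = (\<lambda>i :: nat. if i = 0 then 0 else if i = 1 then T1 else T1 + T2)"
  \<comment> \<open>On \<open>y = 0\<close> both fields have second component \<open>x\<close>, so
    the product is \<open>x^2\<close>.\<close>
  have cross: "crossing_point ?F ?G (x, 0)" if "x \<noteq> 0" for x
    using that by (auto simp: crossing_point_def quadratic_field_def zero_less_mult_iff)
  show ?thesis
    unfolding crossing_periodic_orbit_def
  proof (intro exI[of _ \<gamma>] exI[of _ \<tau>] exI[of _ "2 :: nat"] conjI)
    have "orbit_arc ?F {p. snd p > 0} \<gamma> 0 T1"
      by (rule orbit_arc_cong[OF a1]) (simp add: \<gamma>_def)
    moreover have "orbit_arc ?G {p. snd p < 0} \<gamma> T1 (T1 + T2)"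
      using orbit_arc_cong[OF orbit_arc_shift[OF a2, of T1], of \<gamma>] \<gamma>2 by (simp add: add.commute)
    ultimately show "\<forall>i<2. orbit_arc ?F {p. snd p > 0} \<gamma> (\<tau> i) (\<tau> (Suc i)) \<or>
        orbit_arc ?G {p. snd p < 0} \<gamma> (\<tau> i) (\<tau> (Suc i))"
      by (auto simp: \<tau>_def less_2_cases_iff)
    show "\<forall>i\<le>2. crossing_point ?F ?G (\<gamma> (\<tau> i))"
      using ends cross pos1[of 0] pos1[of pi] by (auto simp: \<tau>_def)
    show "\<gamma> (\<tau> 2) = \<gamma> (\<tau> 0)" using ends by (simp add: \<tau>_def)
    have "{0..T1 + T2} = {0..T1} \<union> {T1..T1 + T2}" using T by auto
    moreover have "\<gamma> ` {0..T1} = \<gamma>1 ` {0..T1}" by (intro image_cong) (auto simp: \<gamma>_def)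
    moreover have "\<gamma> ` {T1..T1 + T2} = \<gamma>2 ` {0..T2}"
    proof -
      have "\<gamma> ` {T1..T1 + T2} = (\<lambda>t. \<gamma>2 (t - T1)) ` {T1..T1 + T2}"
        using \<gamma>2 by (intro image_cong) auto
      also have "\<dots> = \<gamma>2 ` ((\<lambda>t. t - T1) ` {T1..T1 + T2})" by (simp only: image_image)
      also have "(\<lambda>t. t - T1) ` {T1..T1 + T2} = {0..T2}"
        by (auto intro!: image_eqI[of x _ "x + T1" for x])
      finally show ?thesis .
    qed
    ultimately show "polar_point \<rho>\<^sub>1 ` {0..pi} \<union> polar_point \<rho>\<^sub>2 ` {-pi..0} = \<gamma> ` {\<tau> 0..\<tau> 2}"
      using i1 i2 by (simp add: \<tau>_def image_Un)
  qed simp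
qed

lemma center_at_origin_of_closed_polar_pairs:
  assumes upper: "\<And>\<rho>0 \<theta>0. K \<le> \<rho>0 \<Longrightarrow> \<theta>0 \<in> {0..pi} \<Longrightarrow>
      \<exists>\<rho>\<^sub>1 \<rho>\<^sub>2. closed_polar_pair l m\<^sub>1 n\<^sub>1 m\<^sub>2 n\<^sub>2 \<rho>\<^sub>1 \<rho>\<^sub>2 \<and> \<rho>\<^sub>1 \<theta>0 = \<rho>0"
    and lower: "\<And>\<rho>0 \<theta>0. K \<le> \<rho>0 \<Longrightarrow> \<theta>0 \<in> {-pi..0} \<Longrightarrow>
      \<exists>\<rho>\<^sub>1 \<rho>\<^sub>2. closed_polar_pair l m\<^sub>1 n\<^sub>1 m\<^sub>2 n\<^sub>2 \<rho>\<^sub>1 \<rho>\<^sub>2 \<and> \<rho>\<^sub>2 \<theta>0 = \<rho>0"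
  shows "center_at_origin (quadratic_field l m\<^sub>1 n\<^sub>1) (quadratic_field l m\<^sub>2 n\<^sub>2)"
proof -
  let ?F = "quadratic_field l m\<^sub>1 n\<^sub>1" and ?G = "quadratic_field l m\<^sub>2 n\<^sub>2"
  define good where "good = {\<Gamma>. crossing_periodic_orbit ?F ?G \<Gamma> \<and> 0 \<in> inside \<Gamma>}"
  have pair_good: "polar_point \<rho>\<^sub>1 ` {0..pi} \<union> polar_point \<rho>\<^sub>2 ` {-pi..0} \<in> good"
    if "closed_polar_pair l m\<^sub>1 n\<^sub>1 m\<^sub>2 n\<^sub>2 \<rho>\<^sub>1 \<rho>\<^sub>2" for \<rho>\<^sub>1 \<rho>\<^sub>2
  proof -
    have "0 \<in> inside (polar_point \<rho>\<^sub>1 ` {0..pi} \<union> polar_point \<rho>\<^sub>2 ` {-pi..0})"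
      using that unfolding closed_polar_pair_def
      by (intro origin_inside_polar_curve polar_orbit_continuous) (auto simp: polar_orbit_def)
    then show ?thesis
      using closed_polar_pair_crossing_periodic_orbit[OF that] by (simp add: good_def)
  qed
  have near: "p \<in> \<Union>good" if p: "p \<noteq> 0" "norm p < 1 / max K 1" for p
  proof -
    have "K \<le> 1 / norm p"
    proof -
      have "norm p * max K 1 < 1" using p(2) by (subst (asm) pos_less_divide_eq) auto
      then have "max K 1 \<le> 1 / norm p" using p(1) by (subst pos_le_divide_eq) (auto simp: mult.commute)
      then show ?thesis by simp
    qed
    define \<theta> where "\<theta> = polar_angle p"
    note pol = polar_angle[OF p(1), folded \<theta>_def]
    show ?thesis
    proof (cases "0 \<le> snd p")
      case True
      obtain \<rho>\<^sub>1 \<rho>\<^sub>2 where pair: "closed_polar_pair l m\<^sub>1 n\<^sub>1 m\<^sub>2 n\<^sub>2 \<rho>\<^sub>1 \<rho>\<^sub>2" and "\<rho>\<^sub>1 \<theta> = 1 / norm p"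
        using upper[OF \<open>K \<le> 1 / norm p\<close>, of \<theta>] pol(1) by auto
      then have "polar_point \<rho>\<^sub>1 \<theta> = (norm p * cos \<theta>, norm p * sin \<theta>)"
        by (simp add: polar_point_def)
      also have "\<dots> = (fst p, snd p)"
        using pol(2,3) True by (simp only: abs_of_nonneg)
      finally have "p = polar_point \<rho>\<^sub>1 \<theta>" by simp
      then show ?thesis using pair_good[OF pair] pol(1) by blast
    next
      case False
      obtain \<rho>\<^sub>1 \<rho>\<^sub>2 where pair: "closed_polar_pair l m\<^sub>1 n\<^sub>1 m\<^sub>2 n\<^sub>2 \<rho>\<^sub>1 \<rho>\<^sub>2" and "\<rho>\<^sub>2 (- \<theta>) = 1 / norm p"
        using lower[OF \<open>K \<le> 1 / norm p\<close>, of "- \<theta>"] pol(1) by auto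
      then have "polar_point \<rho>\<^sub>2 (- \<theta>) = (norm p * cos \<theta>, - (norm p * sin \<theta>))"
        by (simp add: polar_point_def)
      also have "\<dots> = (fst p, - \<bar>snd p\<bar>)"
        by (simp only: pol(2,3)[symmetric])
      also have "\<dots> = p" using False by simp
      finally have "p = polar_point \<rho>\<^sub>2 (- \<theta>)" by simp
      moreover have "- \<theta> \<in> {-pi..0}" using pol(1) by simp
      ultimately show ?thesis using pair_good[OF pair] by blast
    qed
  qed
  \<comment> \<open>With all admissible orbits put into \<open>U\<close>, the requirement that each
    orbit lie in \<open>U\<close> holds automatically, and it remains to see that \<open>U\<close>
    contains a ball.\<close>
  define U where "U = insert 0 (\<Union>good)"
  have "ball 0 (1 / max K 1) \<subseteq> U"
  proof
    fix p :: "real \<times> real" assume "p \<in> ball 0 (1 / max K 1)"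
    then have "norm p < 1 / max K 1" by (simp only: mem_ball dist_0_norm)
    then show "p \<in> U" using near[of p] unfolding U_def by blast
  qed
  moreover have "(0 :: real) < 1 / max K 1" by (intro divide_pos_pos) auto
  ultimately have "0 \<in> interior U"
    unfolding mem_interior by blast
  moreover have "0 \<notin> \<Gamma>" if "\<Gamma> \<in> good" for \<Gamma>
    using that inside_no_overlap[of \<Gamma>] unfolding good_def by blast
  then have "U - {0} = \<Union>good"
    unfolding U_def by blast
  then have "U - {0} = \<Union>{\<Gamma>. crossing_periodic_orbit ?F ?G \<Gamma> \<and> 0 \<in> inside \<Gamma> \<and> \<Gamma> \<subseteq> U}"
    unfolding good_def U_def by blast
  ultimately show ?thesis
    unfolding center_at_origin_def by blast
qed

section \<open>Sufficiency\<close>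

lemma polar_first_integral:
  assumes orb: "polar_orbit l m n \<rho> {u..v}" and uv: "u \<le> v"
    and I: "\<And>\<theta>. \<theta> \<in> {u..v} \<Longrightarrow> (I has_derivative DI (polar_point \<rho> \<theta>)) (at (polar_point \<rho> \<theta>))"
    and zero: "\<And>\<theta>. \<theta> \<in> {u..v} \<Longrightarrow> DI (polar_point \<rho> \<theta>) (quadratic_field l m n (polar_point \<rho> \<theta>)) = (0 :: real)"
  shows "I (polar_point \<rho> u) = I (polar_point \<rho> v)"
proof -
  have "((I \<circ> polar_point \<rho>) has_derivative (\<lambda>h. 0)) (at \<theta> within {u..v})" if \<theta>: "\<theta> \<in> {u..v}" for \<theta>
  proof -
    define k where "k = \<rho> \<theta> / (\<rho> \<theta> + angular l m n (-1) \<theta>)"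
    have "((I \<circ> polar_point \<rho>) has_vector_derivative DI (polar_point \<rho> \<theta>) (k *\<^sub>R quadratic_field l m n (polar_point \<rho> \<theta>)))
        (at \<theta> within {u..v})"
      unfolding k_def
      by (rule vector_derivative_diff_chain_within[OF polar_point_has_vector_derivative[OF orb \<theta>]
            has_derivative_at_withinI[OF I[OF \<theta>]]])
    moreover have "DI (polar_point \<rho> \<theta>) (k *\<^sub>R quadratic_field l m n (polar_point \<rho> \<theta>)) = 0"
      using zero[OF \<theta>] linear_cmul[OF has_derivative_linear[OF I[OF \<theta>]], of k] by simp
    ultimately show ?thesis by (simp add: has_vector_derivative_def)
  qed
  from has_derivative_zero_unique[OF _ this] uv show ?thesis by simp
qed

text \<open>Two half-turns through the same point of the positive x-axis, forward above and backward
  below, reach the negative x-axis with the same value of the integral, because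
  \<open>I\<^sub>1\<close> and \<open>I\<^sub>2\<close> agree on the axis. Injectivity there
  identifies the two end points, so the orbit closes.\<close>

lemma center_of_first_integrals:
  fixes I\<^sub>1 I\<^sub>2 :: "real \<times> real \<Rightarrow> real"
  assumes \<delta>: "0 < \<delta>"
    and I1: "\<And>p. norm p < \<delta> \<Longrightarrow> (I\<^sub>1 has_derivative DI\<^sub>1 p) (at p)"
      "\<And>p. norm p < \<delta> \<Longrightarrow> DI\<^sub>1 p (quadratic_field l m\<^sub>1 n\<^sub>1 p) = 0"
    and I2: "\<And>p. norm p < \<delta> \<Longrightarrow> (I\<^sub>2 has_derivative DI\<^sub>2 p) (at p)"
      "\<And>p. norm p < \<delta> \<Longrightarrow> DI\<^sub>2 p (quadratic_field l m\<^sub>2 n\<^sub>2 p) = 0"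
    and agree: "\<And>x. \<bar>x\<bar> < \<delta> \<Longrightarrow> I\<^sub>1 (x, 0) = I\<^sub>2 (x, 0)"
    and inj: "inj_on (\<lambda>x. I\<^sub>1 (x, 0)) {-\<delta><..<0}"
  shows "center_at_origin (quadratic_field l m\<^sub>1 n\<^sub>1) (quadratic_field l m\<^sub>2 n\<^sub>2)"
proof -
  define C where "C = \<bar>l\<bar> + \<bar>m\<^sub>1\<bar> + \<bar>n\<^sub>1\<bar> + \<bar>m\<^sub>2\<bar> + \<bar>n\<^sub>2\<bar> + 1"
  have C: "\<bar>l\<bar> + \<bar>m\<^sub>1\<bar> + \<bar>n\<^sub>1\<bar> + 1 \<le> C" "\<bar>l\<bar> + \<bar>m\<^sub>2\<bar> + \<bar>n\<^sub>2\<bar> + 1 \<le> C" by (auto simp: C_def)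
  have pair: "closed_polar_pair l m\<^sub>1 n\<^sub>1 m\<^sub>2 n\<^sub>2 \<rho>\<^sub>1 \<rho>\<^sub>2"
    if o1: "polar_orbit l m\<^sub>1 n\<^sub>1 \<rho>\<^sub>1 {-pi..pi}" and o2: "polar_orbit l m\<^sub>2 n\<^sub>2 \<rho>\<^sub>2 {-pi..pi}"
      and large: "\<And>\<theta>. \<theta> \<in> {-pi..pi} \<Longrightarrow> 1 / \<delta> < \<rho>\<^sub>1 \<theta>" "\<And>\<theta>. \<theta> \<in> {-pi..pi} \<Longrightarrow> 1 / \<delta> < \<rho>\<^sub>2 \<theta>"
      and eq: "\<rho>\<^sub>1 0 = \<rho>\<^sub>2 0" for \<rho>\<^sub>1 \<rho>\<^sub>2
  proof -
    have o1': "polar_orbit l m\<^sub>1 n\<^sub>1 \<rho>\<^sub>1 {0..pi}" and o2': "polar_orbit l m\<^sub>2 n\<^sub>2 \<rho>\<^sub>2 {-pi..0}"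
      by (rule polar_orbit_subset[OF o1] polar_orbit_subset[OF o2]; auto)+
    have inv: "0 < r \<and> 1 / r < \<delta>" if "1 / \<delta> < r" for r
    proof -
      have "0 < 1 / \<delta>" using \<delta> by simp
      then have "0 < r" using that by linarith
      then show ?thesis using that \<delta> by (simp add: field_simps)
    qed
    have small1: "norm (polar_point \<rho>\<^sub>1 \<theta>) < \<delta>" if "\<theta> \<in> {-pi..pi}" for \<theta>
      using inv[OF large(1)[OF that]] by (simp add: norm_polar_point)
    have small2: "norm (polar_point \<rho>\<^sub>2 \<theta>) < \<delta>" if "\<theta> \<in> {-pi..pi}" for \<theta>
      using inv[OF large(2)[OF that]] by (simp add: norm_polar_point)
    have "I\<^sub>1 (polar_point \<rho>\<^sub>1 0) = I\<^sub>1 (polar_point \<rho>\<^sub>1 pi)"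
      by (rule polar_first_integral[OF o1' _ I1(1)[OF small1] I1(2)[OF small1]]) auto
    moreover have "I\<^sub>2 (polar_point \<rho>\<^sub>2 (-pi)) = I\<^sub>2 (polar_point \<rho>\<^sub>2 0)"
      by (rule polar_first_integral[OF o2' _ I2(1)[OF small2] I2(2)[OF small2]]) auto
    moreover have r: "0 < \<rho>\<^sub>1 pi \<and> 1 / \<rho>\<^sub>1 pi < \<delta>" "0 < \<rho>\<^sub>2 (-pi) \<and> 1 / \<rho>\<^sub>2 (-pi) < \<delta>" "0 < \<rho>\<^sub>2 0 \<and> 1 / \<rho>\<^sub>2 0 < \<delta>"
      by (intro inv large; simp)+
    ultimately have "I\<^sub>1 (- 1 / \<rho>\<^sub>1 pi, 0) = I\<^sub>1 (- 1 / \<rho>\<^sub>2 (-pi), 0)"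
      using agree[of "1 / \<rho>\<^sub>2 0"] agree[of "- 1 / \<rho>\<^sub>2 (-pi)"] eq by (simp add: polar_point_def)
    then have "- 1 / \<rho>\<^sub>1 pi = - 1 / \<rho>\<^sub>2 (-pi)"
      by (rule inj_onD[OF inj]) (use r in auto)
    then have "\<rho>\<^sub>1 pi = \<rho>\<^sub>2 (-pi)" using r by (simp add: field_simps)
    then show ?thesis using o1' o2' eq by (simp add: closed_polar_pair_def)
  qed
  show ?thesis
  \<comment> \<open>One half-turn is started at the given angle, the other from its value at angle
    0. Each lowers \<open>\<rho>\<close> by at most \<open>16 * C\<close>: after the first at least
    \<open>30 * C\<close> is left to start the second, and both stay above
    \<open>1 / \<delta>\<close>, that is, inside the ball of radius \<open>\<delta>\<close>.\<close>
  proof (rule center_at_origin_of_closed_polar_pairs[of "62 * C + 2 / \<delta>"])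
    fix \<rho>0 \<theta>0 assume \<rho>0: "62 * C + 2 / \<delta> \<le> \<rho>0"
    have d: "0 < 1 / \<delta>" "1 / \<delta> < 2 / \<delta>" using \<delta> by (simp_all add: divide_strict_right_mono)
    have "1 \<le> C" by (simp add: C_def)
    show "\<exists>\<rho>\<^sub>1 \<rho>\<^sub>2. closed_polar_pair l m\<^sub>1 n\<^sub>1 m\<^sub>2 n\<^sub>2 \<rho>\<^sub>1 \<rho>\<^sub>2 \<and> \<rho>\<^sub>1 \<theta>0 = \<rho>0"
      if "\<theta>0 \<in> {0..pi}"
    proof -
      have "30 * C \<le> \<rho>0" "\<theta>0 \<in> {-pi..pi}" using \<rho>0 d \<open>1 \<le> C\<close> that by auto
      from polar_orbit_exists[OF C(1) this] obtain \<rho>\<^sub>1 where 1: "\<rho>\<^sub>1 \<theta>0 = \<rho>0"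
        "\<And>\<theta>. \<theta> \<in> {-pi..pi} \<Longrightarrow> \<rho>0 - 16 * C \<le> \<rho>\<^sub>1 \<theta>" "polar_orbit l m\<^sub>1 n\<^sub>1 \<rho>\<^sub>1 {-pi..pi}" by metis
      have "30 * C \<le> \<rho>\<^sub>1 0" "0 \<in> {-pi..pi}" using \<rho>0 d \<open>1 \<le> C\<close> 1(2)[of 0] by auto
      from polar_orbit_exists[OF C(2) this] obtain \<rho>\<^sub>2 where 2: "\<rho>\<^sub>2 0 = \<rho>\<^sub>1 0"
        "\<And>\<theta>. \<theta> \<in> {-pi..pi} \<Longrightarrow> \<rho>\<^sub>1 0 - 16 * C \<le> \<rho>\<^sub>2 \<theta>" "polar_orbit l m\<^sub>2 n\<^sub>2 \<rho>\<^sub>2 {-pi..pi}" by metis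
      have "1 / \<delta> < \<rho>\<^sub>1 \<theta>" "1 / \<delta> < \<rho>\<^sub>2 \<theta>" if "\<theta> \<in> {-pi..pi}" for \<theta>
        using 1(2)[OF that] 2(2)[OF that] 1(2)[of 0] d \<rho>0 \<open>1 \<le> C\<close> by simp_all
      from pair[OF 1(3) 2(3) this 2(1)[symmetric]] 1(1) show ?thesis by blast
    qed
    show "\<exists>\<rho>\<^sub>1 \<rho>\<^sub>2. closed_polar_pair l m\<^sub>1 n\<^sub>1 m\<^sub>2 n\<^sub>2 \<rho>\<^sub>1 \<rho>\<^sub>2 \<and> \<rho>\<^sub>2 \<theta>0 = \<rho>0"
      if "\<theta>0 \<in> {-pi..0}"
    proof -
      have "30 * C \<le> \<rho>0" "\<theta>0 \<in> {-pi..pi}" using \<rho>0 d \<open>1 \<le> C\<close> that by auto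
      from polar_orbit_exists[OF C(2) this] obtain \<rho>\<^sub>2 where 2: "\<rho>\<^sub>2 \<theta>0 = \<rho>0"
        "\<And>\<theta>. \<theta> \<in> {-pi..pi} \<Longrightarrow> \<rho>0 - 16 * C \<le> \<rho>\<^sub>2 \<theta>" "polar_orbit l m\<^sub>2 n\<^sub>2 \<rho>\<^sub>2 {-pi..pi}" by metis
      have "30 * C \<le> \<rho>\<^sub>2 0" "0 \<in> {-pi..pi}" using \<rho>0 d \<open>1 \<le> C\<close> 2(2)[of 0] by auto
      from polar_orbit_exists[OF C(1) this] obtain \<rho>\<^sub>1 where 1: "\<rho>\<^sub>1 0 = \<rho>\<^sub>2 0"
        "\<And>\<theta>. \<theta> \<in> {-pi..pi} \<Longrightarrow> \<rho>\<^sub>2 0 - 16 * C \<le> \<rho>\<^sub>1 \<theta>" "polar_orbit l m\<^sub>1 n\<^sub>1 \<rho>\<^sub>1 {-pi..pi}" by metis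
      have "1 / \<delta> < \<rho>\<^sub>1 \<theta>" "1 / \<delta> < \<rho>\<^sub>2 \<theta>" if "\<theta> \<in> {-pi..pi}" for \<theta>
        using 1(2)[OF that] 2(2)[OF that] 2(2)[of 0] d \<rho>0 \<open>1 \<le> C\<close> by simp_all
      from pair[OF 1(3) 2(3) this 1(1)] 2(1) show ?thesis by blast
    qed
  qed
qed

lemma antiderivative_exists:
  fixes g :: "real \<Rightarrow> real"
  assumes "continuous_on {a..b} g" "a < 0" "0 < b"
  obtains \<Phi> where "\<Phi> 0 = 0" "\<And>t. a < t \<Longrightarrow> t < b \<Longrightarrow> (\<Phi> has_real_derivative g t) (at t)"
proof -
  let ?J = "\<lambda>t. integral {a..t} g"
  show ?thesis
  proof (rule that[of "\<lambda>t. ?J t - ?J 0"])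
  show "?J 0 - ?J 0 = 0" by simp
  show "((\<lambda>t. ?J t - ?J 0) has_real_derivative g t) (at t)" if "a < t" "t < b" for t
    using integral_has_real_derivative[OF assms(1), of t] that at_within_Icc_at[of a t b]
    by (auto intro!: derivative_eq_intros)
  qed
qed

text \<open>For \<open>m = 0\<close> the orbits satisfy an equation linear in \<open>x^2\<close>,
  namely \<open>d(x^2)/dy = 2 (- y + l x^2 + n y^2) / (1 - y)\<close>, with integrating factor
  \<open>(1 - y) powr (2 * l)\<close>. The resulting integral is \<open>x^2 / 2\<close> on
  \<open>y = 0\<close> whatever \<open>n\<close> is, so different \<open>n\<^sub>1\<close> and
  \<open>n\<^sub>2\<close> still match.\<close>

lemma center_no_xy_term:
  "center_at_origin (quadratic_field l 0 n\<^sub>1) (quadratic_field l 0 n\<^sub>2)"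
proof -
  define g where "g n t = (t - n * t\<^sup>2) * (1 - t) powr (2 * l - 1)" for n t :: real
  have "\<exists>\<Phi>. \<Phi> 0 = 0 \<and> (\<forall>t. \<bar>t\<bar> < 1/2 \<longrightarrow> (\<Phi> has_real_derivative g n t) (at t))" for n
  proof -
    have "continuous_on {-1/2..1/2} (g n)"
      unfolding g_def by (intro continuous_intros) auto
    then obtain \<Phi> where "\<Phi> 0 = 0" "\<And>t. -1/2 < t \<Longrightarrow> t < 1/2 \<Longrightarrow> (\<Phi> has_real_derivative g n t) (at t)"
      by (rule antiderivative_exists) auto
    then show ?thesis by (intro exI[of _ \<Phi>]) (auto simp: abs_less_iff)
  qed
  then obtain \<Phi> where \<Phi>: "\<And>n. \<Phi> n 0 = 0"
    "\<And>n t. \<bar>t\<bar> < 1/2 \<Longrightarrow> (\<Phi> n has_real_derivative g n t) (at t)"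
    by metis
  define Q where "Q t = (1 - t) powr (2 * l)" for t :: real
  define I where "I n p = (fst p)\<^sup>2 / 2 * Q (snd p) + \<Phi> n (snd p)" for n p
  define DI where "DI n p h = fst p * fst h * Q (snd p)
      + (fst p)\<^sup>2 / 2 * (snd h * (- (2 * l) * (1 - snd p) powr (2 * l - 1))) + snd h * g n (snd p)"
    for n p and h :: "real \<times> real"
  have small: "\<bar>snd p\<bar> < 1/2" if "norm p < 1/2" for p :: "real \<times> real"
    using that norm_snd_le[of "snd p" "fst p"] by auto
  have der: "(I n has_derivative DI n p) (at p)" if "norm p < 1/2" for n p
  proof -
    have "(Q has_real_derivative - (2 * l) * (1 - snd p) powr (2 * l - 1)) (at (snd p))"
      unfolding Q_def using small[OF that]
      by (auto intro!: derivative_eq_intros simp: abs_less_iff)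
    from DERIV_compose_FDERIV[OF this has_derivative_snd[OF has_derivative_ident]]
      DERIV_compose_FDERIV[OF \<Phi>(2)[OF small[OF that]] has_derivative_snd[OF has_derivative_ident]]
    show ?thesis
      unfolding I_def DI_def
      by - (rule derivative_eq_intros refl | assumption | simp add: fun_eq_iff)+
  qed
  have zero: "DI n p (quadratic_field l 0 n p) = 0" if p: "norm p < 1/2" for n p
  proof -
    obtain x y where xy: "p = (x, y)" by (cases p)
    define q where "q = (1 - y) powr (2 * l - 1)"
    have Qy: "Q y = q * (1 - y)"
      using small[OF p] powr_add[of "1 - y" "2 * l - 1" 1] by (simp add: Q_def q_def xy)
    show ?thesis
      unfolding xy DI_def quadratic_field_def g_def prod.case fst_conv snd_conv q_def[symmetric] Qy
      by (simp add: field_simps power2_eq_square)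
  qed
  have I0: "I n (x, 0) = x\<^sup>2 / 2" for n x
    by (simp add: I_def Q_def \<Phi>)
  show ?thesis
    by (intro center_of_first_integrals[where \<delta> = "1/2" and I\<^sub>1 = "I n\<^sub>1" and I\<^sub>2 = "I n\<^sub>2" and DI\<^sub>1 = "DI n\<^sub>1" and DI\<^sub>2 = "DI n\<^sub>2"]
        der zero) (auto simp: I0 inj_on_def power2_eq_iff)
qed

text \<open>With \<open>w = x / (1 + l y)\<close> the system becomes
  \<open>w' = - y (1 - m w - \<kappa> w^2)\<close>, \<open>y' = w (1 + l y) (1 - y)\<close>. The
  variables separate, and \<open>\<Psi>\<close> and \<open>\<Phi>\<close> are the antiderivatives of
  the two sides. Upper and lower system coincide here, so one integral serves both.\<close>

lemma center_darboux:
  "center_at_origin (quadratic_field l m (- l)) (quadratic_field l m (- l))"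
proof -
  define \<kappa> where "\<kappa> = l\<^sup>2 + l"
  \<comment> \<open>So small that \<open>\<bar>l\<bar> * \<delta> + \<bar>m\<bar> * \<delta> +
    \<bar>\<kappa>\<bar> * \<delta> \<le> 1/4\<close>. Then \<open>1 + l * y\<close> is at least 1/2
    for \<open>\<bar>y\<bar> \<le> \<delta>\<close>, which bounds \<open>w\<close> by
    \<open>2 * \<delta>\<close>, and on that range \<open>1 - m * w - \<kappa> * w^2\<close> is at
    least 1/2 as well.\<close>
  define \<delta> where "\<delta> = 1 / (4 * (1 + \<bar>l\<bar> + \<bar>m\<bar> + \<bar>\<kappa>\<bar>))"
  have \<delta>: "0 < \<delta>" "\<delta> \<le> 1/4" by (auto simp: \<delta>_def field_simps)
  have \<delta>_sum: "\<bar>l\<bar> * \<delta> + \<bar>m\<bar> * \<delta> + \<bar>\<kappa>\<bar> * \<delta> \<le> 1/4"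
  proof -
    have "4 * (1 + \<bar>l\<bar> + \<bar>m\<bar> + \<bar>\<kappa>\<bar>) * \<delta> = 1" unfolding \<delta>_def by (simp add: add_nonneg_eq_0_iff)
    then show ?thesis using \<delta>(1) by (simp add: algebra_simps)
  qed
  have \<delta>_mult: "\<bar>l\<bar> * \<delta> \<le> 1/4" "\<bar>m\<bar> * \<delta> + \<bar>\<kappa>\<bar> * \<delta> \<le> 1/4"
    using \<delta>_sum \<delta>(1) mult_nonneg_nonneg[of "\<bar>l\<bar>" \<delta>] mult_nonneg_nonneg[of "\<bar>m\<bar>" \<delta>] mult_nonneg_nonneg[of "\<bar>\<kappa>\<bar>" \<delta>]
    by linarith+
  have dy: "1/2 \<le> 1 + l * y" if "\<bar>y\<bar> \<le> \<delta>" for y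
  proof -
    have "\<bar>l * y\<bar> \<le> \<bar>l\<bar> * \<delta>" using that by (simp add: abs_mult mult_left_mono)
    then show ?thesis using \<delta>_mult(1) by linarith
  qed
  have dw: "1/2 \<le> 1 - m * w - \<kappa> * w\<^sup>2" if "\<bar>w\<bar> \<le> 2 * \<delta>" for w
  proof -
    have "\<bar>m * w\<bar> \<le> \<bar>m\<bar> * (2 * \<delta>)" using that by (simp add: abs_mult mult_left_mono)
    moreover have "w\<^sup>2 \<le> 2 * \<delta>"
    proof -
      have "w\<^sup>2 = \<bar>w\<bar> * \<bar>w\<bar>" by (simp add: power2_eq_square)
      also have "\<dots> \<le> (2 * \<delta>) * 1" using that \<delta> by (intro mult_mono) auto
      finally show ?thesis by simp
    qed
    then have "\<bar>\<kappa> * w\<^sup>2\<bar> \<le> \<bar>\<kappa>\<bar> * (2 * \<delta>)" by (simp add: abs_mult mult_left_mono)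
    ultimately show ?thesis using \<delta>_mult(2) by linarith
  qed
  define g where "g t = t / ((1 - t) * (1 + l * t))" for t
  define h where "h w = w / (1 - m * w - \<kappa> * w\<^sup>2)" for w
  have "continuous_on {-\<delta>..\<delta>} g"
    unfolding g_def using \<delta> dy by (intro continuous_intros) (fastforce simp: abs_le_iff)
  then obtain \<Phi> where \<Phi>: "\<Phi> 0 = 0" "\<And>t. -\<delta> < t \<Longrightarrow> t < \<delta> \<Longrightarrow> (\<Phi> has_real_derivative g t) (at t)"
    by (rule antiderivative_exists) (use \<delta> in auto)
  have "continuous_on {-(2*\<delta>)..2*\<delta>} h"
    unfolding h_def using dw by (intro continuous_intros) (fastforce simp: abs_le_iff)
  then obtain \<Psi> where \<Psi>: "\<Psi> 0 = 0" "\<And>t. -(2*\<delta>) < t \<Longrightarrow> t < 2*\<delta> \<Longrightarrow> (\<Psi> has_real_derivative h t) (at t)"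
    by (rule antiderivative_exists) (use \<delta> in auto)
  define I where "I p = \<Psi> (fst p / (1 + l * snd p)) + \<Phi> (snd p)" for p
  define DI where "DI p k = ((fst k * (1 + l * snd p) - fst p * (l * snd k)) / (1 + l * snd p)\<^sup>2) * h (fst p / (1 + l * snd p))
      + snd k * g (snd p)" for p and k :: "real \<times> real"
  have small: "\<bar>fst p\<bar> < \<delta>" "\<bar>snd p\<bar> < \<delta>" if "norm p < \<delta>" for p :: "real \<times> real"
    using that norm_snd_le[of "snd p" "fst p"] norm_fst_le[of "fst p" "snd p"] by auto
  have w_small: "\<bar>fst p / (1 + l * snd p)\<bar> < 2 * \<delta>" if "norm p < \<delta>" for p :: "real \<times> real"
  proof -
    have d: "1/2 \<le> 1 + l * snd p" using dy small[OF that] by simp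
    have "2 * \<delta> * (1/2) \<le> 2 * \<delta> * (1 + l * snd p)"
      using d \<delta> by (intro mult_left_mono) auto
    then have "\<bar>fst p\<bar> < 2 * \<delta> * (1 + l * snd p)"
      using small(1)[OF that] by linarith
    then show ?thesis using d by (simp add: abs_divide pos_divide_less_eq)
  qed
  have der: "(I has_derivative DI p) (at p)" if p: "norm p < \<delta>" for p
  proof -
    have d: "1 + l * snd p \<noteq> 0" using dy[of "snd p"] small[OF p] by auto
    have w: "((\<lambda>p. fst p / (1 + l * snd p)) has_derivative
        (\<lambda>k. (fst k * (1 + l * snd p) - fst p * (l * snd k)) / (1 + l * snd p)\<^sup>2)) (at p)"
      by (rule derivative_eq_intros refl d | simp add: power2_eq_square fun_eq_iff)+
    have b: "- (2 * \<delta>) < fst p / (1 + l * snd p)" "fst p / (1 + l * snd p) < 2 * \<delta>" "- \<delta> < snd p" "snd p < \<delta>"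
      using w_small[OF p] small(2)[OF p] unfolding abs_less_iff by linarith+
    from has_derivative_add[OF DERIV_compose_FDERIV[OF \<Psi>(2)[OF b(1,2)] w]
        DERIV_compose_FDERIV[OF \<Phi>(2)[OF b(3,4)] has_derivative_snd[OF has_derivative_ident]]]
    show ?thesis
      unfolding I_def DI_def .
  qed
  have zero: "DI p (quadratic_field l m (- l) p) = 0" if p: "norm p < \<delta>" for p
  proof -
    obtain x y where xy: "p = (x, y)" by (cases p)
    define d where "d = 1 + l * y"
    define w where "w = x / d"
    have d: "d \<noteq> 0" using dy[of y] small[OF p] by (auto simp: xy d_def)
    then have x: "x = w * d" by (simp add: w_def)
    have y: "1 - y \<noteq> 0" using small[OF p] \<delta> by (auto simp: xy)
    have "\<bar>w\<bar> < 2 * \<delta>"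
      using w_small[OF p] unfolding w_def d_def xy fst_conv snd_conv .
    then have D: "1 - m * w - \<kappa> * w\<^sup>2 \<noteq> 0"
      using dw[of w] by linarith
    have "(- y + l * x\<^sup>2 + m * x * y + - l * y\<^sup>2) * d - x * (l * (x * (1 - y)))
        = - y * (1 - m * w - \<kappa> * w\<^sup>2) * d\<^sup>2"
      unfolding x \<kappa>_def d_def by algebra
    then have "DI p (quadratic_field l m (- l) p)
        = (- y * (1 - m * w - \<kappa> * w\<^sup>2) * d\<^sup>2) / d\<^sup>2 * h w + x * (1 - y) * g y"
      by (simp add: DI_def quadratic_field_def xy d_def[symmetric] w_def[symmetric])
    also have "\<dots> = - y * w + x * (1 - y) * (y / ((1 - y) * d))"
      using d D by (simp add: h_def g_def d_def[symmetric])
    also have "\<dots> = 0" using d y by (simp add: x)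
    finally show ?thesis .
  qed
  \<comment> \<open>On the axis \<open>I\<close> reduces to \<open>\<Psi>\<close>, whose derivative
    \<open>h w\<close> has the sign of \<open>w\<close>.\<close>
  have "inj_on (\<lambda>x. I (x, 0)) {-\<delta><..<0}"
  proof (rule linorder_inj_onI)
    have lt: "I (u, 0) > I (v, 0)" if "u \<in> {-\<delta><..<0}" "v \<in> {-\<delta><..<0}" "u < v" for u v
    proof -
      have "\<Psi> u > \<Psi> v"
      proof (rule DERIV_neg_imp_decreasing[OF \<open>u < v\<close>])
        fix t assume t: "u \<le> t" "t \<le> v"
        have "h t < 0" unfolding h_def using t that dw[of t] by (intro divide_neg_pos) auto
        moreover have "(\<Psi> has_real_derivative h t) (at t)" using t that \<delta> by (intro \<Psi>) auto
        ultimately show "\<exists>y. (\<Psi> has_real_derivative y) (at t) \<and> y < 0" by blast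
      qed
      then show ?thesis by (simp add: I_def)
    qed
    show "I (u, 0) \<noteq> I (v, 0)" if "u < v" "u \<in> {-\<delta><..<0}" "v \<in> {-\<delta><..<0}" for u v
      using lt[of u v] that by simp
  qed auto
  then show ?thesis
    by (intro center_of_first_integrals[where \<delta> = \<delta> and I\<^sub>1 = I and I\<^sub>2 = I and DI\<^sub>1 = DI and DI\<^sub>2 = DI] der zero \<delta>(1)) auto
qed

section \<open>Centers from a projective symmetry\<close>

text \<open>
  The projective map \<open>(x, y) \<mapsto> (x / (1 - y), - y / (1 - y))\<close> exchanges the two half-planes and
  reverses orbits; in the coordinates \<open>\<rho> = 1 / r\<close> and \<open>\<theta>\<close> it is \<open>(\<rho>, \<theta>) \<mapsto> (\<rho> - sin \<theta>, - \<theta>)\<close>.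
\<close>

lemma polar_orbit_projective_reflection:
  assumes orb: "polar_orbit (-1/2) m n \<rho> {0..pi}" and large: "\<And>\<theta>. \<theta> \<in> {0..pi} \<Longrightarrow> 1 < \<rho> \<theta>"
  shows "polar_orbit (-1/2) m (1 - n) (\<lambda>\<theta>. \<rho> (- \<theta>) + sin \<theta>) {-pi..0}"
  unfolding polar_orbit_def
proof (intro ballI conjI)
  fix \<theta> assume \<theta>: "\<theta> \<in> {-pi..0}"
  then have \<theta>': "- \<theta> \<in> {0..pi}" by auto
  define c s r A\<^sub>1 B\<^sub>1 A\<^sub>2 B\<^sub>2 where "c = cos \<theta>" "s = sin \<theta>" "r = \<rho> (- \<theta>)"
    "A\<^sub>1 = radial (-1/2) m n (-1) (- \<theta>)" "B\<^sub>1 = angular (-1/2) m n (-1) (- \<theta>)"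
    "A\<^sub>2 = radial (-1/2) m (1 - n) (-1) \<theta>" "B\<^sub>2 = angular (-1/2) m (1 - n) (-1) \<theta>"
  note abbr = this
  have cs: "c\<^sup>2 + s\<^sup>2 = 1" by (simp add: abbr)
  have vals: "A\<^sub>1 = c * (-1/2 * c\<^sup>2 - m * c * s + n * s\<^sup>2) - s * (c * s)"
    "B\<^sub>1 = c * (c * s) + s * (-1/2 * c\<^sup>2 - m * c * s + n * s\<^sup>2)"
    "A\<^sub>2 = c * (-1/2 * c\<^sup>2 + m * c * s + (1 - n) * s\<^sup>2) - s * (c * s)"
    "B\<^sub>2 = - (c * (c * s)) - s * (-1/2 * c\<^sup>2 + m * c * s + (1 - n) * s\<^sup>2)"
    by (simp_all add: abbr radial_def angular_def)
  \<comment> \<open>These three identities turn the upper equation for \<open>\<rho>\<close> into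
    the lower one for \<open>\<rho> (- \<theta>) + sin \<theta>\<close>. All of them depend on
    \<open>l = -1/2\<close> and on \<open>n\<^sub>1 + n\<^sub>2 = 1\<close>.\<close>
  have B: "B\<^sub>1 = B\<^sub>2 + s" and A: "A\<^sub>1 + c = - A\<^sub>2" and AB: "c * B\<^sub>1 = - A\<^sub>2 * s"
    unfolding vals by (use cs in algebra, use cs in algebra, simp add: algebra_simps power2_eq_square)
  have pos: "1 < r" "0 < r + B\<^sub>1"
    and der: "(\<rho> has_real_derivative - A\<^sub>1 * r / (r + B\<^sub>1)) (at (- \<theta>) within {0..pi})"
    using orb large[OF \<theta>'] \<theta>' by (auto simp: polar_orbit_def abbr)
  show "0 < \<rho> (- \<theta>) + sin \<theta>"
    using pos(1) sin_ge_minus_one[of \<theta>] unfolding abbr by linarith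
  show "0 < \<rho> (- \<theta>) + sin \<theta> + angular (- 1 / 2) m (1 - n) (- 1) \<theta>"
    using pos(2) B by (simp add: abbr)
  have im: "uminus ` {-pi..0} = {0..pi}" by simp
  have "(\<rho> \<circ> uminus has_real_derivative - A\<^sub>1 * r / (r + B\<^sub>1) * - 1) (at \<theta> within {-pi..0})"
    by (rule DERIV_image_chain) (use der im in \<open>auto intro!: derivative_eq_intros\<close>)
  then have "((\<lambda>\<theta>. \<rho> (- \<theta>) + sin \<theta>) has_real_derivative A\<^sub>1 * r / (r + B\<^sub>1) + c) (at \<theta> within {-pi..0})"
    unfolding o_def abbr by (auto intro!: derivative_eq_intros)
  moreover have "A\<^sub>1 * r / (r + B\<^sub>1) + c = - A\<^sub>2 * (r + s) / (r + s + B\<^sub>2)"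
  proof -
    have "A\<^sub>1 * r + c * (r + B\<^sub>1) = - A\<^sub>2 * (r + s)" using A AB by algebra
    then show ?thesis using pos(2) B by (simp add: field_simps)
  qed
  ultimately show "((\<lambda>\<theta>. \<rho> (- \<theta>) + sin \<theta>) has_real_derivative
      - radial (-1/2) m (1 - n) (-1) \<theta> * (\<rho> (- \<theta>) + sin \<theta>)
        / (\<rho> (- \<theta>) + sin \<theta> + angular (-1/2) m (1 - n) (-1) \<theta>)) (at \<theta> within {-pi..0})"
    by (simp add: abbr)
qed

text \<open>An upper half-turn and its mirror image always close up, because the shift
  \<open>sin \<theta>\<close> vanishes at the angles 0, \<open>pi\<close> and
  \<open>-pi\<close>.\<close>

lemma center_projective_reflection:
  "center_at_origin (quadratic_field (-1/2) m n) (quadratic_field (-1/2) m (1 - n))"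
proof -
  define C where "C = \<bar>-1/2\<bar> + \<bar>m\<bar> + \<bar>n\<bar> + 1"
  have C: "1 \<le> C" by (simp add: C_def)
  have pair: "\<exists>\<rho>. \<rho> \<theta>0 = \<rho>0 \<and> closed_polar_pair (-1/2) m n m (1 - n) \<rho> (\<lambda>\<theta>. \<rho> (- \<theta>) + sin \<theta>)"
    if "30 * C \<le> \<rho>0" "\<theta>0 \<in> {0..pi}" for \<rho>0 \<theta>0
  proof -
    have "\<bar>-1/2\<bar> + \<bar>m\<bar> + \<bar>n\<bar> + 1 \<le> C" "\<theta>0 \<in> {-pi..pi}" using that by (auto simp: C_def)
    from polar_orbit_exists[OF this(1) that(1) this(2)]
    obtain \<rho> where \<rho>: "\<rho> \<theta>0 = \<rho>0" "\<And>\<theta>. \<theta> \<in> {-pi..pi} \<Longrightarrow> \<rho>0 - 16 * C \<le> \<rho> \<theta>"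
      "polar_orbit (-1/2) m n \<rho> {-pi..pi}" by metis
    then have o: "polar_orbit (-1/2) m n \<rho> {0..pi}"
      by (auto intro: polar_orbit_subset)
    have "1 < \<rho> \<theta>" if "\<theta> \<in> {0..pi}" for \<theta>
    proof -
      have "\<rho>0 - 16 * C \<le> \<rho> \<theta>" using \<rho>(2)[of \<theta>] that by simp
      then show ?thesis using \<open>30 * C \<le> \<rho>0\<close> C by linarith
    qed
    from polar_orbit_projective_reflection[OF o this] o \<rho>(1)
    show ?thesis by (auto simp: closed_polar_pair_def)
  qed
  show ?thesis
  \<comment> \<open>The additional 1 absorbs the shift \<open>sin \<theta>0\<close> when the
    prescribed point lies in the lower half-plane and is carried to the upper one.\<close>
  proof (rule center_at_origin_of_closed_polar_pairs[of "30 * C + 1"])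
    fix \<rho>0 \<theta>0 assume \<rho>0: "30 * C + 1 \<le> \<rho>0"
    show "\<exists>\<rho>\<^sub>1 \<rho>\<^sub>2. closed_polar_pair (- 1 / 2) m n m (1 - n) \<rho>\<^sub>1 \<rho>\<^sub>2 \<and> \<rho>\<^sub>1 \<theta>0 = \<rho>0"
      if "\<theta>0 \<in> {0..pi}"
      using pair[OF _ that, of \<rho>0] \<rho>0 by auto
    show "\<exists>\<rho>\<^sub>1 \<rho>\<^sub>2. closed_polar_pair (- 1 / 2) m n m (1 - n) \<rho>\<^sub>1 \<rho>\<^sub>2 \<and> \<rho>\<^sub>2 \<theta>0 = \<rho>0"
      if "\<theta>0 \<in> {-pi..0}"
    proof -
      have "30 * C \<le> \<rho>0 - sin \<theta>0" using \<rho>0 sin_le_one[of \<theta>0] by linarith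
      from pair[OF this, of "- \<theta>0"] that obtain \<rho> where \<rho>: "\<rho> (- \<theta>0) = \<rho>0 - sin \<theta>0"
        "closed_polar_pair (-1/2) m n m (1 - n) \<rho> (\<lambda>\<theta>. \<rho> (- \<theta>) + sin \<theta>)" by auto
      show ?thesis
        by (intro exI[of _ \<rho>] exI[of _ "\<lambda>\<theta>. \<rho> (- \<theta>) + sin \<theta>"]) (use \<rho> in auto)
    qed
  qed
qed

section \<open>Monotone functions exclude a center\<close>

lemma strictly_increasing_finite_exceptions:
  fixes f :: "real \<Rightarrow> real"
  assumes "finite S" "a < b" "continuous_on {a..b} f"
    and "\<And>t. t \<in> {a<..<b} - S \<Longrightarrow> \<exists>D > 0. (f has_real_derivative D) (at t)"
  shows "f a < f b"
  using assms
proof (induction S arbitrary: a b rule: finite_induct)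
  case empty
  then show ?case by (intro DERIV_pos_imp_increasing_open[of a b f]) auto
next
  case (insert c S)
  show ?case
  proof (cases "c \<in> {a<..<b}")
    case True
    then have "f a < f c" "f c < f b"
      by (intro insert.IH continuous_on_subset[OF insert.prems(2)] insert.prems(3); force)+
    then show ?thesis by simp
  next
    case False
    then show ?thesis by (intro insert.IH insert.prems) auto
  qed
qed

text \<open>If \<open>r\<close> reached \<open>R\<close>, there would be a first such time
  \<open>v\<close>, by compactness. Up to \<open>v\<close> the intermediate value theorem keeps
  \<open>r \<le> R\<close>, so \<open>\<phi>\<close> has dropped strictly below its initial value,
  which the barrier on \<open>r = R\<close> forbids.\<close>

lemma decreasing_trap:
  fixes r \<phi> :: "real \<Rightarrow> real"
  assumes ab: "a \<le> b" and cont: "continuous_on {a..b} r" and start: "r a < R"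
    and dec: "\<And>s t. a \<le> s \<Longrightarrow> s < t \<Longrightarrow> t \<le> b \<Longrightarrow> (\<And>u. u \<in> {s..t} \<Longrightarrow> r u \<le> R) \<Longrightarrow> \<phi> t < \<phi> s"
    and barrier: "\<And>t. t \<in> {a..b} \<Longrightarrow> r t = R \<Longrightarrow> \<phi> a \<le> \<phi> t"
    and t: "t \<in> {a..b}"
  shows "r t < R"
proof (rule ccontr)
  assume "\<not> r t < R"
  then obtain u where u: "a \<le> u" "u \<le> t" "r u = R"
    using IVT'[of r a R t] start t continuous_on_subset[OF cont, of "{a..t}"] by auto
  define S where "S = {a..b} \<inter> r -` {R}"
  have "closed S" unfolding S_def by (intro continuous_closed_preimage cont) auto
  moreover have "bounded S" unfolding S_def by (rule bounded_subset[OF bounded_closed_interval[of a b]]) auto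
  ultimately have "compact S" by (simp add: compact_eq_bounded_closed)
  moreover have "u \<in> S" using u t by (auto simp: S_def)
  ultimately obtain v where v: "v \<in> S" "\<And>w. w \<in> S \<Longrightarrow> v \<le> w"
    using compact_attains_inf[of S] by auto
  have "r w \<le> R" if w: "w \<in> {a..v}" for w
  proof (rule ccontr)
    assume "\<not> r w \<le> R"
    then obtain z where z: "a \<le> z" "z \<le> w" "r z = R"
      using IVT'[of r a R w] start w v(1) continuous_on_subset[OF cont, of "{a..w}"] by (auto simp: S_def)
    then have "v \<le> z" using v w by (auto simp: S_def)
    then have "w = v" using z w by auto
    then show False using \<open>\<not> r w \<le> R\<close> v(1) by (auto simp: S_def)
  qed
  moreover have "a < v" using v(1) start by (cases "a = v") (auto simp: S_def)
  ultimately have "\<phi> v < \<phi> a" using v(1) by (intro dec) (auto simp: S_def)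
  then show False using barrier[of v] v(1) by (auto simp: S_def)
qed

text \<open>The trap is used twice: from \<open>t0\<close> to \<open>b\<close>, and then, since the
  loop returns to its initial values, from \<open>a\<close> over the whole period. Now
  \<open>\<phi>\<close> decreases strictly along the entire loop, contrary to
  \<open>\<phi> a = \<phi> b\<close>.\<close>

lemma no_decreasing_loop:
  fixes r \<phi> :: "real \<Rightarrow> real"
  assumes ab: "a < b" and t0: "t0 \<in> {a..b}" and cont: "continuous_on {a..b} r"
    and loop: "r a = r b" "\<phi> a = \<phi> b"
    and dec: "\<And>s t. a \<le> s \<Longrightarrow> s < t \<Longrightarrow> t \<le> b \<Longrightarrow> (\<And>u. u \<in> {s..t} \<Longrightarrow> r u \<le> R) \<Longrightarrow> \<phi> t < \<phi> s"
    and barrier: "\<And>t. t \<in> {a..b} \<Longrightarrow> r t = R \<Longrightarrow> c \<le> \<phi> t"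
    and start: "r t0 < R" "\<phi> t0 \<le> c"
  shows False
proof -
  have 1: "r t < R" if "t \<in> {t0..b}" for t
    by (rule decreasing_trap[of t0 b r R \<phi>])
      (use t0 that start in \<open>auto intro!: dec continuous_on_subset[OF cont] order_trans[OF start(2) barrier]\<close>)
  then have "r a < R" using loop t0 by simp
  have "\<phi> a \<le> c"
  proof (cases "t0 = b")
    case False
    then have "\<phi> b < \<phi> t0" using t0 by (intro dec) (use 1 in \<open>auto intro: less_imp_le\<close>)
    then show ?thesis using loop start by simp
  qed (use loop start in simp)
  have "r t < R" if "t \<in> {a..b}" for t
    by (rule decreasing_trap[of a b r R \<phi>])
      (use ab that \<open>r a < R\<close> in \<open>auto intro!: dec cont order_trans[OF \<open>\<phi> a \<le> c\<close> barrier]\<close>)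
  then have "\<phi> b < \<phi> a" using ab by (intro dec) (auto intro: less_imp_le)
  then show False using loop by simp
qed

text \<open>Time reversal reduces this to \<open>no_decreasing_loop\<close>.\<close>

lemma no_increasing_loop:
  fixes r \<phi> :: "real \<Rightarrow> real"
  assumes ab: "a < b" and t0: "t0 \<in> {a..b}" and cont: "continuous_on {a..b} r"
    and loop: "r a = r b" "\<phi> a = \<phi> b"
    and inc: "\<And>s t. a \<le> s \<Longrightarrow> s < t \<Longrightarrow> t \<le> b \<Longrightarrow> (\<And>u. u \<in> {s..t} \<Longrightarrow> r u \<le> R) \<Longrightarrow> \<phi> s < \<phi> t"
    and barrier: "\<And>t. t \<in> {a..b} \<Longrightarrow> r t = R \<Longrightarrow> c \<le> \<phi> t"
    and start: "r t0 < R" "\<phi> t0 \<le> c"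
  shows False
proof (rule no_decreasing_loop[of "-b" "-a" "-t0" "r \<circ> uminus" "\<phi> \<circ> uminus" R c])
  show "continuous_on {-b..-a} (r \<circ> uminus)"
    using cont by (intro continuous_on_compose continuous_intros) simp
  show "(\<phi> \<circ> uminus) t < (\<phi> \<circ> uminus) s"
    if "-b \<le> s" "s < t" "t \<le> -a" and le: "\<And>u. u \<in> {s..t} \<Longrightarrow> (r \<circ> uminus) u \<le> R" for s t
  proof -
    have "r u \<le> R" if "u \<in> {-t..-s}" for u using le[of "-u"] that by auto
    then show ?thesis using inc[of "-t" "-s"] that by auto
  qed
qed (use assms in auto)

section \<open>Crossing periodic orbits under a monotone function\<close>

lemma orbit_arc_continuous: "orbit_arc F S \<gamma> a b \<Longrightarrow> continuous_on {a..b} \<gamma>"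
  unfolding orbit_arc_def by (intro continuous_on_vector_derivative) blast

lemma orbit_arc_interior:
  assumes "orbit_arc F S \<gamma> a b" "a < t" "t < b"
  shows "(\<gamma> has_vector_derivative F (\<gamma> t)) (at t)" "\<gamma> t \<in> S"
proof -
  have "(\<gamma> has_vector_derivative F (\<gamma> t)) (at t within {a..b})"
    using assms by (simp add: orbit_arc_def)
  then show "(\<gamma> has_vector_derivative F (\<gamma> t)) (at t)"
    using at_within_Icc_at[OF assms(2,3)] by simp
  show "\<gamma> t \<in> S" using assms by (auto simp: orbit_arc_def)
qed

text \<open>Induction on the number of arcs. It turns the arcs into one continuous curve that is
  differentiable except at finitely many cutting times.\<close>

lemma crossing_orbit_partition:
  fixes \<tau> :: "nat \<Rightarrow> real"
  assumes arcs: "\<And>i. i < k \<Longrightarrow> orbit_arc F A \<gamma> (\<tau> i) (\<tau> (Suc i)) \<or> orbit_arc G B \<gamma> (\<tau> i) (\<tau> (Suc i))"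
    and j: "j \<le> k"
  shows "\<tau> 0 \<le> \<tau> j" "continuous_on {\<tau> 0..\<tau> j} \<gamma>" "{\<tau> 0..\<tau> j} \<subseteq> \<tau> ` {..j} \<union> (\<Union>i<j. {\<tau> i<..<\<tau> (Suc i)})"
  using j
proof (induction j)
  case (Suc j)
  {
    case 1
    then show ?case using Suc arcs[of j] by (auto simp: orbit_arc_def)
  next
    case 2
    have lt: "\<tau> j < \<tau> (Suc j)" using arcs[of j] 2 by (auto simp: orbit_arc_def)
    have "continuous_on {\<tau> j..\<tau> (Suc j)} \<gamma>"
      using arcs[of j] 2 orbit_arc_continuous by auto
    moreover have "{\<tau> 0..\<tau> (Suc j)} = {\<tau> 0..\<tau> j} \<union> {\<tau> j..\<tau> (Suc j)}" using lt Suc 2 by auto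
    ultimately show ?case using Suc 2 by (auto intro!: continuous_on_closed_Un)
  next
    case 3
    have "{\<tau> 0..\<tau> (Suc j)} \<subseteq> {\<tau> 0..\<tau> j} \<union> {\<tau> j<..<\<tau> (Suc j)} \<union> {\<tau> (Suc j)}" by auto
    also have "\<dots> \<subseteq> (\<tau> ` {..j} \<union> (\<Union>i<j. {\<tau> i<..<\<tau> (Suc i)})) \<union> {\<tau> j<..<\<tau> (Suc j)} \<union> {\<tau> (Suc j)}"
      using Suc.IH(3)[OF Suc_leD[OF 3]] by (intro Un_mono) auto
    also have "\<dots> = \<tau> ` {..Suc j} \<union> (\<Union>i<Suc j. {\<tau> i<..<\<tau> (Suc i)})"
      by (simp add: lessThan_Suc atMost_Suc Un_ac)
    finally show ?case .
  }
qed auto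

text \<open>\<open>V\<close> is comparable to the squared radius, so its values on the circle of
  radius \<open>\<epsilon> / 2\<close> form a barrier for an orbit that passes close to the origin.
  The orbit is trapped where \<open>V\<close> is strictly monotone and cannot close. The sign of
  \<open>\<kappa>\<close> is the direction of monotonicity, common to both half-planes.\<close>

lemma not_center_of_monotone_function:
  fixes V :: "real \<times> real \<Rightarrow> real"
  assumes \<epsilon>: "0 < \<epsilon>" and cont: "continuous_on (- {0}) V"
    and bounds: "\<And>p. 0 < norm p \<Longrightarrow> norm p < \<epsilon> \<Longrightarrow> (norm p)\<^sup>2 / 2 \<le> V p \<and> V p \<le> 2 * (norm p)\<^sup>2"
    and upper: "\<And>\<gamma> t. (\<gamma> has_vector_derivative F (\<gamma> t)) (at t) \<Longrightarrow> 0 < snd (\<gamma> t) \<Longrightarrow> norm (\<gamma> t) < \<epsilon> \<Longrightarrow>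
      \<exists>D. ((\<lambda>t. V (\<gamma> t)) has_real_derivative D) (at t) \<and> 0 < \<kappa> * D"
    and lower: "\<And>\<gamma> t. (\<gamma> has_vector_derivative G (\<gamma> t)) (at t) \<Longrightarrow> snd (\<gamma> t) < 0 \<Longrightarrow> norm (\<gamma> t) < \<epsilon> \<Longrightarrow>
      \<exists>D. ((\<lambda>t. V (\<gamma> t)) has_real_derivative D) (at t) \<and> 0 < \<kappa> * D"
  shows "\<not> center_at_origin F G"
proof
  assume "center_at_origin F G"
  then obtain U where U: "0 \<in> interior U"
    "U - {0} = \<Union>{\<Gamma>. crossing_periodic_orbit F G \<Gamma> \<and> 0 \<in> inside \<Gamma> \<and> \<Gamma> \<subseteq> U}"
    unfolding center_at_origin_def by blast
  then obtain e where e: "0 < e" "ball 0 e \<subseteq> U" unfolding mem_interior by blast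
  \<comment> \<open>The 8 gives \<open>V (x, 0) \<le> 2 * x^2 \<le> \<epsilon>^2 / 32\<close>, which
    is below the lower bound \<open>\<epsilon>^2 / 8\<close> of \<open>V\<close> on the circle of
    radius \<open>\<epsilon> / 2\<close>.\<close>
  define x where "x = min e \<epsilon> / 8"
  have x: "0 < x" "x < e" "8 * x \<le> \<epsilon>" using e \<epsilon> by (auto simp: x_def)
  have "(x, 0) \<in> U - {0}" using e(2) x by (auto simp: zero_prod_def dist_norm)
  then obtain \<Gamma> where \<Gamma>: "crossing_periodic_orbit F G \<Gamma>" "0 \<in> inside \<Gamma>" "(x, 0) \<in> \<Gamma>"
    unfolding U(2) by blast
  then obtain \<gamma> \<tau> and k :: nat where k: "0 < k"
    and arcs: "\<And>i. i < k \<Longrightarrow> orbit_arc F {p. snd p > 0} \<gamma> (\<tau> i) (\<tau> (Suc i)) \<or> orbit_arc G {p. snd p < 0} \<gamma> (\<tau> i) (\<tau> (Suc i))"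
    and loop: "\<gamma> (\<tau> k) = \<gamma> (\<tau> 0)" and \<Gamma>_eq: "\<Gamma> = \<gamma> ` {\<tau> 0..\<tau> k}"
    unfolding crossing_periodic_orbit_def by blast
  note part = crossing_orbit_partition[of k F "{p. snd p > 0}" \<gamma> \<tau> G "{p. snd p < 0}" k, OF arcs order_refl]
  have "0 \<notin> \<Gamma>" using \<Gamma>(2) inside_no_overlap by fastforce
  then have nz: "\<gamma> t \<noteq> 0" if "t \<in> {\<tau> 0..\<tau> k}" for t using that \<Gamma>_eq by (metis imageI)
  obtain t0 where t0: "t0 \<in> {\<tau> 0..\<tau> k}" "\<gamma> t0 = (x, 0)" using \<Gamma>(3) \<Gamma>_eq by auto
  have "\<tau> 0 < \<tau> 1" using arcs[OF k] by (auto simp: orbit_arc_def)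
  \<comment> \<open>The partition lemma is applied to the last \<open>k - 1\<close> arcs, with the
    cutting times shifted by one.\<close>
  moreover have "\<tau> 1 \<le> \<tau> k"
    using crossing_orbit_partition(1)[of "k - 1" F "{p. snd p > 0}" \<gamma> "\<lambda>i. \<tau> (Suc i)" G "{p. snd p < 0}" "k - 1"] arcs k
    by simp
  ultimately have lt: "\<tau> 0 < \<tau> k" by simp
  define \<phi> where "\<phi> t = V (\<gamma> t)" for t
  have cont_\<phi>: "continuous_on {\<tau> 0..\<tau> k} \<phi>"
    unfolding \<phi>_def using nz by (intro continuous_on_compose2[OF cont part(2)]) auto
  have cont_r: "continuous_on {\<tau> 0..\<tau> k} (\<lambda>t. norm (\<gamma> t))"
    by (intro continuous_intros part(2))
  have deriv: "\<exists>D. (\<phi> has_real_derivative D) (at t) \<and> 0 < \<kappa> * D"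
    if t: "t \<in> {\<tau> 0..\<tau> k} - \<tau> ` {..k}" "norm (\<gamma> t) < \<epsilon>" for t
  proof -
    obtain i where i: "i < k" "\<tau> i < t" "t < \<tau> (Suc i)" using part(3) t(1) by auto
    show ?thesis
      using arcs[OF i(1)] orbit_arc_interior[OF _ i(2,3)] upper[of \<gamma> t] lower[of \<gamma> t] t(2) unfolding \<phi>_def by blast
  qed
  have mono: "\<kappa> * \<phi> s < \<kappa> * \<phi> t"
    if st: "\<tau> 0 \<le> s" "s < t" "t \<le> \<tau> k" and le: "\<And>u. u \<in> {s..t} \<Longrightarrow> norm (\<gamma> u) \<le> \<epsilon> / 2" for s t
  proof (rule strictly_increasing_finite_exceptions[where S = "\<tau> ` {..k}" and f = "\<lambda>t. \<kappa> * \<phi> t"])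
    show "continuous_on {s..t} (\<lambda>t. \<kappa> * \<phi> t)"
      using st by (intro continuous_intros continuous_on_subset[OF cont_\<phi>]) auto
    fix u assume u: "u \<in> {s<..<t} - \<tau> ` {..k}"
    then have "norm (\<gamma> u) < \<epsilon>" using le[of u] \<epsilon> by auto
    then obtain D where "(\<phi> has_real_derivative D) (at u)" "0 < \<kappa> * D"
      using deriv[of u] u st by auto
    then show "\<exists>D>0. ((\<lambda>t. \<kappa> * \<phi> t) has_real_derivative D) (at u)"
      using DERIV_cmult by blast
  qed (use st in auto)
  have barrier: "\<epsilon>\<^sup>2 / 8 \<le> \<phi> t" if "t \<in> {\<tau> 0..\<tau> k}" "norm (\<gamma> t) = \<epsilon> / 2" for t
    using bounds[of "\<gamma> t"] that \<epsilon> by (auto simp: \<phi>_def power_divide)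
  have start: "norm (\<gamma> t0) < \<epsilon> / 2" "\<phi> t0 \<le> \<epsilon>\<^sup>2 / 8"
  proof -
    have n: "norm (\<gamma> t0) = x" using t0 x by simp
    then show "norm (\<gamma> t0) < \<epsilon> / 2" using x by simp
    have "\<phi> t0 \<le> 2 * x\<^sup>2" using bounds[of "\<gamma> t0"] n x by (simp add: \<phi>_def)
    also have "\<dots> \<le> 2 * (\<epsilon> / 8)\<^sup>2" using x by (intro mult_left_mono power_mono) auto
    also have "\<dots> \<le> \<epsilon>\<^sup>2 / 8" by (simp add: power_divide)
    finally show "\<phi> t0 \<le> \<epsilon>\<^sup>2 / 8" .
  qed
  have loops: "norm (\<gamma> (\<tau> 0)) = norm (\<gamma> (\<tau> k))" "\<phi> (\<tau> 0) = \<phi> (\<tau> k)" by (simp_all add: loop \<phi>_def)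
  consider "0 < \<kappa>" | "\<kappa> < 0" | "\<kappa> = 0" by linarith
  then show False
  proof cases
    case 1
    show False
      by (rule no_increasing_loop[OF lt t0(1) cont_r loops _ barrier start]) (use mono 1 in auto)
  next
    case 2
    show False
      by (rule no_decreasing_loop[OF lt t0(1) cont_r loops _ barrier start]) (use mono 2 in auto)
  next
    \<comment> \<open>For \<open>\<kappa> = 0\<close> the fact \<open>mono\<close> reads
      \<open>0 < 0\<close>, so the premise on increase holds vacuously.\<close>
    case 3
    show False
      by (rule no_increasing_loop[OF lt t0(1) cont_r loops _ barrier start]) (use mono 3 in auto)
  qed
qed

section \<open>Lyapunov functions\<close>

text \<open>The degree 4 equation for a formal first integral: the rotation derivative of a quartic
  cancels, up to the mean, the derivative along \<open>(X, Y)\<close> of the cubic \<open>2 * b / 3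
  * x^3 - 2 * a * x^2 * y - 2 / 3 * (f + e + 2 * a) * y^3\<close>. Comparing coefficients gives the
  \<open>k1\<close> to \<open>k4\<close>. Since \<open>(x^2 + y^2)^2\<close> has rotation derivative
  0, the coefficient of \<open>x^4\<close> is free; it is taken to be 0, so that the quartic
  vanishes on \<open>y = 0\<close>.\<close>

lemma lyapunov_quartic_identity:
  fixes a b f e x y :: real
  defines "K \<equiv> - b * (a + f) / 4"
  defines "k1 \<equiv> - 7/4 * a * b + 1/4 * b * f" and "k2 \<equiv> 2 * a^2 + a * e - b^2" and "k3 \<equiv> - 1/4 * a * b - 1/4 * b * f"
    and "k4 \<equiv> a^2 + a * f + 3/2 * a * e - 1/2 * b^2 + 1/2 * f * e + 1/2 * e^2"
  defines "X \<equiv> a * x^2 + b * x * y + f * y^2" and "Y \<equiv> e * x * y"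
  shows "- y * (3 * k1 * x^2 * y + 2 * k2 * x * y^2 + k3 * y^3) + x * (k1 * x^3 + 2 * k2 * x^2 * y + 3 * k3 * x * y^2 + 4 * k4 * y^3)
    = - (X * (2 * b * x^2 - 4 * a * x * y) + Y * (- 2 * a * x^2 - 2 * (f + e + 2 * a) * y^2)) - K * (x^2 + y^2)^2"
  unfolding assms
  by (simp add: field_simps eval_nat_numeral)

text \<open>In odd degree the rotation derivative is invertible, so comparing coefficients
  determines \<open>j0\<close> to \<open>j5\<close>. The last summand is
  \<open>K * (2 * v3 + B)\<close> in homogeneous form: it is what remains in degree 5 when
  \<open>K * \<theta>\<close> is added to the quartic and \<open>2 * K * \<theta> * v3\<close> to
  the quintic.\<close>

lemma lyapunov_quintic_identity:
  fixes a b f e x y :: real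
  defines "K \<equiv> - b * (a + f) / 4"
  defines "k1 \<equiv> - 7/4 * a * b + 1/4 * b * f" and "k2 \<equiv> 2 * a^2 + a * e - b^2" and "k3 \<equiv> - 1/4 * a * b - 1/4 * b * f"
    and "k4 \<equiv> a^2 + a * f + 3/2 * a * e - 1/2 * b^2 + 1/2 * f * e + 1/2 * e^2"
  defines "j0 \<equiv> 14/45 * a^2 * b + 8/15 * a * b * f - 2/45 * a * b * e - 4/15 * b^3 + 16/45 * b * f^2 + 4/45 * b * f * e"
    and "j1 \<equiv> 1/3 * a * b^2 + 1/3 * b^2 * f"
    and "j2 \<equiv> 25/9 * a^2 * b + 1/3 * a * b * f + 8/9 * a * b * e - 2/3 * b^3 + 8/9 * b * f^2 + 2/9 * b * f * e"
    and "j3 \<equiv> - 4/3 * a^3 - 2 * a^2 * e + 26/9 * a * b^2 - 2/3 * a * e^2 + 2/9 * b^2 * f + 2/3 * b^2 * e"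
    and "j4 \<equiv> 2/3 * a^2 * b + a * b * f + 1/3 * a * b * e + 1/3 * b * f^2 + 1/3 * b * f * e"
    and "j5 \<equiv> - 8/15 * a^3 - 4/5 * a^2 * f - 8/5 * a^2 * e + 52/45 * a * b^2 - 6/5 * a * f * e - 22/15 * a * e^2 + 22/45 * b^2 * f + 2/3 * b^2 * e - 2/5 * f * e^2 - 2/5 * e^3"
  defines "X \<equiv> a * x^2 + b * x * y + f * y^2" and "Y \<equiv> e * x * y"
  shows "- y * (5 * j0 * x^4 + 4 * j1 * x^3 * y + 3 * j2 * x^2 * y^2 + 2 * j3 * x * y^3 + j4 * y^4)
      + x * (j1 * x^4 + 2 * j2 * x^3 * y + 3 * j3 * x^2 * y^2 + 4 * j4 * x * y^3 + 5 * j5 * y^4)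
    = - (X * (3 * k1 * x^2 * y + 2 * k2 * x * y^2 + k3 * y^3) + Y * (k1 * x^3 + 2 * k2 * x^2 * y + 3 * k3 * x * y^2 + 4 * k4 * y^3))
      - K * (x^2 + y^2) * (2 * (2 * b / 3 * x^3 - 2 * a * x^2 * y - 2 / 3 * (f + e + 2 * a) * y^3) + (x * Y - y * X))"
  unfolding assms
  by (simp add: field_simps eval_nat_numeral)

text \<open>The scalar product of gradient and field, computed in the orthonormal frame of radial
  and angular directions.\<close>

lemma polar_derivative_eq:
  fixes c s P Q X Y :: real
  assumes "c\<^sup>2 + s\<^sup>2 = 1"
  shows "(c * P + s * Q) * (c * X + s * Y) + (- s * P + c * Q) * (c * Y - s * X) = X * P + Y * Q"
  using assms by algebra

text \<open>
  The restrictions to the unit circle of the homogeneous terms of degree 3, 4, 5 of a formal first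
  integral \<open>r\<^sup>2 + \<dots>\<close> of \<open>x' = - y + a x\<^sup>2 + b x y + f y\<^sup>2\<close>, \<open>y' = x + e x y\<close>. \<open>K\<close> is the mean over
  the circle of the right-hand side in degree 4; it obstructs a periodic solution and is compensated
  by a further term \<open>K \<theta>\<close>.
\<close>

lemma lyapunov_expansion:
  fixes a b f e :: real
  defines "A \<equiv> radial a b f e" and "B \<equiv> angular a b f e" and "K \<equiv> - b * (a + f) / 4"
  obtains v3 v4 v5 :: "real \<Rightarrow> real" where
    "\<And>\<theta>. (v3 has_real_derivative - 2 * A \<theta>) (at \<theta>)"
    "\<And>\<theta>. (v4 has_real_derivative - (3 * v3 \<theta> * A \<theta> - 2 * A \<theta> * B \<theta>) - K) (at \<theta>)"
    "\<And>\<theta>. (v5 has_real_derivative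
        - (4 * v4 \<theta> * A \<theta> + (- (3 * v3 \<theta> * A \<theta> - 2 * A \<theta> * B \<theta>) - K) * B \<theta>) - K * (2 * v3 \<theta> + B \<theta>)) (at \<theta>)"
    "v3 0 = 2 * b / 3" "v3 pi = - 2 * b / 3" "v4 0 = 0" "v4 pi = 0"
    "v5 0 = 14/45 * a^2 * b + 8/15 * a * b * f - 2/45 * a * b * e - 4/15 * b^3 + 16/45 * b * f^2 + 4/45 * b * f * e"
    "v5 pi = - (14/45 * a^2 * b + 8/15 * a * b * f - 2/45 * a * b * e - 4/15 * b^3 + 16/45 * b * f^2 + 4/45 * b * f * e)"
proof -
  define k1 where "k1 = - 7/4 * a * b + 1/4 * b * f"
  define k2 where "k2 = 2 * a^2 + a * e - b^2"
  define k3 where "k3 = - 1/4 * a * b - 1/4 * b * f"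
  define k4 where "k4 = a^2 + a * f + 3/2 * a * e - 1/2 * b^2 + 1/2 * f * e + 1/2 * e^2"
  define j0 where "j0 = 14/45 * a^2 * b + 8/15 * a * b * f - 2/45 * a * b * e - 4/15 * b^3 + 16/45 * b * f^2 + 4/45 * b * f * e"
  define j1 where "j1 = 1/3 * a * b^2 + 1/3 * b^2 * f"
  define j2 where "j2 = 25/9 * a^2 * b + 1/3 * a * b * f + 8/9 * a * b * e - 2/3 * b^3 + 8/9 * b * f^2 + 2/9 * b * f * e"
  define j3 where "j3 = - 4/3 * a^3 - 2 * a^2 * e + 26/9 * a * b^2 - 2/3 * a * e^2 + 2/9 * b^2 * f + 2/3 * b^2 * e"
  define j4 where "j4 = 2/3 * a^2 * b + a * b * f + 1/3 * a * b * e + 1/3 * b * f^2 + 1/3 * b * f * e"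
  define j5 where "j5 = - 8/15 * a^3 - 4/5 * a^2 * f - 8/5 * a^2 * e + 52/45 * a * b^2 - 6/5 * a * f * e - 22/15 * a * e^2 + 22/45 * b^2 * f + 2/3 * b^2 * e - 2/5 * f * e^2 - 2/5 * e^3"
  define v3 where "v3 \<theta> = 2 * b / 3 * (cos \<theta>)^3 - 2 * a * (cos \<theta>)^2 * sin \<theta> - 2 / 3 * (f + e + 2 * a) * (sin \<theta>)^3" for \<theta>
  define v4 where "v4 \<theta> = k1 * (cos \<theta>)^3 * sin \<theta> + k2 * (cos \<theta>)^2 * (sin \<theta>)^2 + k3 * cos \<theta> * (sin \<theta>)^3
    + k4 * (sin \<theta>)^4" for \<theta>
  define v5 where "v5 \<theta> = j0 * (cos \<theta>)^5 + j1 * (cos \<theta>)^4 * sin \<theta> + j2 * (cos \<theta>)^3 * (sin \<theta>)^2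
    + j3 * (cos \<theta>)^2 * (sin \<theta>)^3 + j4 * cos \<theta> * (sin \<theta>)^4 + j5 * (sin \<theta>)^5" for \<theta>
  define v3x v3y where "v3x \<theta> = 2 * b * (cos \<theta>)^2 - 4 * a * cos \<theta> * sin \<theta>"
    and "v3y \<theta> = - 2 * a * (cos \<theta>)^2 - 2 * (f + e + 2 * a) * (sin \<theta>)^2" for \<theta>
  define v4x v4y where "v4x \<theta> = 3 * k1 * (cos \<theta>)^2 * sin \<theta> + 2 * k2 * cos \<theta> * (sin \<theta>)^2 + k3 * (sin \<theta>)^3"
    and "v4y \<theta> = k1 * (cos \<theta>)^3 + 2 * k2 * (cos \<theta>)^2 * sin \<theta> + 3 * k3 * cos \<theta> * (sin \<theta>)^2 + 4 * k4 * (sin \<theta>)^3" for \<theta>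
  define v5x v5y where "v5x \<theta> = 5 * j0 * (cos \<theta>)^4 + 4 * j1 * (cos \<theta>)^3 * sin \<theta> + 3 * j2 * (cos \<theta>)^2 * (sin \<theta>)^2
      + 2 * j3 * cos \<theta> * (sin \<theta>)^3 + j4 * (sin \<theta>)^4"
    and "v5y \<theta> = j1 * (cos \<theta>)^4 + 2 * j2 * (cos \<theta>)^3 * sin \<theta> + 3 * j3 * (cos \<theta>)^2 * (sin \<theta>)^2
      + 4 * j4 * cos \<theta> * (sin \<theta>)^3 + 5 * j5 * (sin \<theta>)^4" for \<theta>
  define X where "X \<theta> = a * (cos \<theta>)^2 + b * cos \<theta> * sin \<theta> + f * (sin \<theta>)^2" for \<theta>
  define Y where "Y \<theta> = e * cos \<theta> * sin \<theta>" for \<theta>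
  have AB: "A \<theta> = cos \<theta> * X \<theta> + sin \<theta> * Y \<theta>" "B \<theta> = cos \<theta> * Y \<theta> - sin \<theta> * X \<theta>" for \<theta>
    by (simp_all add: A_def B_def radial_def angular_def X_def Y_def)
  \<comment> \<open>Euler's relation: the radial part of the gradient of a homogeneous polynomial is
    its degree times its value. The angular part is the derivative in \<open>\<theta>\<close>, which
    is the content of \<open>d3\<close>, \<open>d4\<close>, \<open>d5\<close>.\<close>
  have euler: "3 * v3 \<theta> = cos \<theta> * v3x \<theta> + sin \<theta> * v3y \<theta>" "4 * v4 \<theta> = cos \<theta> * v4x \<theta> + sin \<theta> * v4y \<theta>" for \<theta>
    unfolding v3_def v3x_def v3y_def v4_def v4x_def v4y_def by (simp_all add: field_simps eval_nat_numeral)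
  have d3: "(v3 has_real_derivative - sin \<theta> * v3x \<theta> + cos \<theta> * v3y \<theta>) (at \<theta>)" for \<theta>
    unfolding v3_def v3x_def v3y_def
    by (rule derivative_eq_intros refl)+ (simp add: field_simps eval_nat_numeral)
  have d4: "(v4 has_real_derivative - sin \<theta> * v4x \<theta> + cos \<theta> * v4y \<theta>) (at \<theta>)" for \<theta>
    unfolding v4_def v4x_def v4y_def
    by (rule derivative_eq_intros refl)+ (simp add: field_simps eval_nat_numeral)
  have d5: "(v5 has_real_derivative - sin \<theta> * v5x \<theta> + cos \<theta> * v5y \<theta>) (at \<theta>)" for \<theta>
    unfolding v5_def v5x_def v5y_def
    by (rule derivative_eq_intros refl)+ (simp add: field_simps eval_nat_numeral)
  have w3: "- sin \<theta> * v3x \<theta> + cos \<theta> * v3y \<theta> = - 2 * A \<theta>" for \<theta>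
    unfolding AB X_def Y_def v3x_def v3y_def by (simp add: field_simps eval_nat_numeral)
  have polar: "(cos \<theta> * P + sin \<theta> * Q) * A \<theta> + (- sin \<theta> * P + cos \<theta> * Q) * B \<theta> = X \<theta> * P + Y \<theta> * Q" for \<theta> P Q
    unfolding AB by (rule polar_derivative_eq) simp
  have w4: "- sin \<theta> * v4x \<theta> + cos \<theta> * v4y \<theta> = - (3 * v3 \<theta> * A \<theta> - 2 * A \<theta> * B \<theta>) - K" for \<theta>
  proof -
    have "- sin \<theta> * v4x \<theta> + cos \<theta> * v4y \<theta> = - (X \<theta> * v3x \<theta> + Y \<theta> * v3y \<theta>) - K * ((cos \<theta>)^2 + (sin \<theta>)^2)^2"
      unfolding v4x_def v4y_def X_def Y_def v3x_def v3y_def K_def k1_def k2_def k3_def k4_def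
      by (rule lyapunov_quartic_identity)
    also have "X \<theta> * v3x \<theta> + Y \<theta> * v3y \<theta> = 3 * v3 \<theta> * A \<theta> + (- 2 * A \<theta>) * B \<theta>"
      unfolding w3[symmetric] euler by (rule polar[symmetric])
    finally show ?thesis by simp
  qed
  have w5: "- sin \<theta> * v5x \<theta> + cos \<theta> * v5y \<theta>
      = - (4 * v4 \<theta> * A \<theta> + (- (3 * v3 \<theta> * A \<theta> - 2 * A \<theta> * B \<theta>) - K) * B \<theta>) - K * (2 * v3 \<theta> + B \<theta>)" for \<theta>
  proof -
    have "- sin \<theta> * v5x \<theta> + cos \<theta> * v5y \<theta>
        = - (X \<theta> * v4x \<theta> + Y \<theta> * v4y \<theta>) - K * ((cos \<theta>)^2 + (sin \<theta>)^2) * (2 * v3 \<theta> + (cos \<theta> * Y \<theta> - sin \<theta> * X \<theta>))"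
      unfolding v5x_def v5y_def v4x_def v4y_def X_def Y_def v3_def K_def k1_def k2_def k3_def k4_def
        j0_def j1_def j2_def j3_def j4_def j5_def
      by (rule lyapunov_quintic_identity)
    also have "X \<theta> * v4x \<theta> + Y \<theta> * v4y \<theta> = 4 * v4 \<theta> * A \<theta> + (- sin \<theta> * v4x \<theta> + cos \<theta> * v4y \<theta>) * B \<theta>"
      unfolding euler by (rule polar[symmetric])
    finally show ?thesis unfolding w4 AB(2)[symmetric] by simp
  qed
  show ?thesis
  proof (rule that[of v3 v4 v5])
    show "(v3 has_real_derivative - 2 * A \<theta>) (at \<theta>)" for \<theta>
      using d3[of \<theta>] unfolding w3 .
    show "(v4 has_real_derivative - (3 * v3 \<theta> * A \<theta> - 2 * A \<theta> * B \<theta>) - K) (at \<theta>)" for \<theta>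
      using d4[of \<theta>] unfolding w4 .
    show "(v5 has_real_derivative
        - (4 * v4 \<theta> * A \<theta> + (- (3 * v3 \<theta> * A \<theta> - 2 * A \<theta> * B \<theta>) - K) * B \<theta>) - K * (2 * v3 \<theta> + B \<theta>)) (at \<theta>)" for \<theta>
      using d5[of \<theta>] unfolding w5 .
  qed (simp_all add: v3_def v4_def v5_def j0_def)
qed

section \<open>Polar coordinates along orbits\<close>

text \<open>Off the line \<open>y = 0\<close> the argument of \<open>arccos\<close> lies strictly
  between -1 and 1. The factor \<open>sgn (y t)\<close> appears because below the line
  \<open>arccos\<close> yields minus the usual angle.\<close>

lemma arccos_ratio_deriv:
  fixes x y :: "real \<Rightarrow> real"
  assumes x: "(x has_real_derivative x') (at t)" and y: "(y has_real_derivative y') (at t)" and nz: "y t \<noteq> 0"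
  defines "r \<equiv> \<lambda>t. sqrt ((x t)\<^sup>2 + (y t)\<^sup>2)"
  shows "(r has_real_derivative (x t * x' + y t * y') / r t) (at t)"
    "((\<lambda>t. arccos (x t / r t)) has_real_derivative sgn (y t) * (x t * y' - y t * x') / (r t)\<^sup>2) (at t)"
proof -
  have pos: "0 < (x t)\<^sup>2 + (y t)\<^sup>2" using nz by (simp add: sum_power2_gt_zero_iff)
  then have r: "0 < r t" "(r t)\<^sup>2 = (x t)\<^sup>2 + (y t)\<^sup>2" by (simp_all add: r_def)
  have "((\<lambda>t. (x t)\<^sup>2 + (y t)\<^sup>2) has_real_derivative 2 * (x t * x' + y t * y')) (at t)"
    by (rule derivative_eq_intros x y refl)+ simp
  from DERIV_chain2[OF DERIV_real_sqrt[OF pos] this]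
  have "(r has_real_derivative inverse (r t) / 2 * (2 * (x t * x' + y t * y'))) (at t)"
    unfolding r_def .
  then show dr: "(r has_real_derivative (x t * x' + y t * y') / r t) (at t)"
    by (rule DERIV_cong) (use r(1) in \<open>simp add: field_simps\<close>)
  have sq: "1 - (x t / r t)\<^sup>2 = (y t / r t)\<^sup>2"
  proof -
    have "(x t / r t)\<^sup>2 + (y t / r t)\<^sup>2 = (r t)\<^sup>2 / (r t)\<^sup>2"
      by (simp only: power_divide r(2) add_divide_distrib)
    also have "\<dots> = 1" using r(1) by simp
    finally show ?thesis by simp
  qed
  have "0 < (y t / r t)\<^sup>2" using nz r(1) by simp
  then have "(x t / r t)\<^sup>2 < 1" using sq by linarith
  then have b: "- 1 < x t / r t" "x t / r t < 1"
    unfolding abs_square_less_1 abs_less_iff by linarith+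
  have "((\<lambda>t. x t / r t) has_real_derivative (x' * r t - x t * ((x t * x' + y t * y') / r t)) / (r t * r t)) (at t)"
    using DERIV_divide[OF x dr] r(1) by simp
  from DERIV_chain2[OF DERIV_arccos[OF b] this]
  have d: "((\<lambda>t. arccos (x t / r t)) has_real_derivative
      inverse (- sqrt (1 - (x t / r t)\<^sup>2)) * ((x' * r t - x t * ((x t * x' + y t * y') / r t)) / (r t * r t))) (at t)" .
  have sqrt_eq: "sqrt (1 - (x t / r t)\<^sup>2) = sgn (y t) * y t / r t"
    unfolding sq real_sqrt_abs using r(1) by (cases "0 < y t") (simp_all add: abs_divide sgn_if)
  have num: "x' * r t - x t * ((x t * x' + y t * y') / r t) = - y t * (x t * y' - y t * x') / r t"
  proof -
    have "x' * r t - x t * ((x t * x' + y t * y') / r t) = (x' * (r t)\<^sup>2 - x t * (x t * x' + y t * y')) / r t"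
      using r(1) by (simp add: field_simps power2_eq_square)
    also have "x' * (r t)\<^sup>2 - x t * (x t * x' + y t * y') = - y t * (x t * y' - y t * x')"
      unfolding r(2) by algebra
    finally show ?thesis .
  qed
  have "inverse (- sqrt (1 - (x t / r t)\<^sup>2)) * ((x' * r t - x t * ((x t * x' + y t * y') / r t)) / (r t * r t))
      = sgn (y t) * (x t * y' - y t * x') / (r t)\<^sup>2"
    unfolding sqrt_eq num using nz r(1)
    by (cases "0 < y t") (simp_all add: field_simps power2_eq_square sgn_if)
  then show "((\<lambda>t. arccos (x t / r t)) has_real_derivative sgn (y t) * (x t * y' - y t * x') / (r t)\<^sup>2) (at t)"
    using d by simp
qed

text \<open>
  In the lower half-plane \<open>\<theta>\<close> is the angle after reflection in the line \<open>y = 0\<close>; reflection together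
  with time reversal changes the signs of \<open>l\<close>, \<open>n\<close> and of the \<open>x y\<close> term of \<open>y'\<close>.
\<close>

lemma polar_coordinates_along_orbit:
  fixes \<gamma> :: "real \<Rightarrow> real \<times> real"
  assumes \<gamma>: "(\<gamma> has_vector_derivative quadratic_field l m n (\<gamma> t)) (at t)" and nz: "snd (\<gamma> t) \<noteq> 0"
  defines "\<sigma> \<equiv> sgn (snd (\<gamma> t))" and "r \<equiv> \<lambda>t. norm (\<gamma> t)" and "\<theta> \<equiv> \<lambda>t. polar_angle (\<gamma> t)"
  shows "(r has_real_derivative \<sigma> * ((r t)\<^sup>2 * radial (\<sigma> * l) m (\<sigma> * n) (- \<sigma>) (\<theta> t))) (at t)"
    "(\<theta> has_real_derivative \<sigma> * (1 + r t * angular (\<sigma> * l) m (\<sigma> * n) (- \<sigma>) (\<theta> t))) (at t)"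
proof -
  define x y where "x = (\<lambda>t. fst (\<gamma> t))" and "y = (\<lambda>t. snd (\<gamma> t))"
  define x' y' where "x' = - y t + l * (x t)\<^sup>2 + m * x t * y t + n * (y t)\<^sup>2" and "y' = x t * (1 - y t)"
  have F: "quadratic_field l m n (\<gamma> t) = (x', y')"
    by (simp add: quadratic_field_def x'_def y'_def x_def y_def case_prod_beta)
  have dx: "(x has_real_derivative x') (at t)" and dy: "(y has_real_derivative y') (at t)"
    using bounded_linear.has_vector_derivative[OF bounded_linear_fst \<gamma>]
      bounded_linear.has_vector_derivative[OF bounded_linear_snd \<gamma>]
    by (simp_all add: F x_def y_def has_real_derivative_iff_has_vector_derivative)
  have r_eq: "sqrt ((x u)\<^sup>2 + (y u)\<^sup>2) = r u" for u
    by (simp add: r_def x_def y_def norm_prod_def)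
  have nz': "y t \<noteq> 0" using nz by (simp add: y_def)
  note d = arccos_ratio_deriv[OF dx dy nz', unfolded r_eq]
  define c s where "c = cos (\<theta> t)" and "s = sin (\<theta> t)"
  have "\<gamma> t \<noteq> 0" using nz by auto
  note pol = polar_angle[OF this]
  have r: "0 < r t" using \<open>\<gamma> t \<noteq> 0\<close> by (simp add: r_def)
  have \<sigma>: "\<sigma> * \<sigma> = 1" using nz by (simp add: \<sigma>_def sgn_if)
  have xc: "x t = r t * c" using pol(2) unfolding x_def c_def r_def \<theta>_def .
  have "\<bar>y t\<bar> = r t * s" using pol(3) unfolding y_def s_def r_def \<theta>_def .
  moreover have "y t = \<sigma> * \<bar>y t\<bar>" using nz by (simp add: \<sigma>_def y_def mult_sgn_abs)
  ultimately have ys: "y t = \<sigma> * (r t * s)" by simp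
  have cs: "c\<^sup>2 + s\<^sup>2 = 1" by (simp add: c_def s_def)
  \<comment> \<open>With \<open>x = r c\<close>, \<open>y = \<sigma> r s\<close> and
    \<open>\<sigma> * \<sigma> = 1\<close>, the signs move into the coefficients of
    \<open>radial\<close> and \<open>angular\<close>. The factor \<open>\<sigma>\<close> in front of
    the angular speed comes from \<open>sgn\<close> in the derivative of
    \<open>arccos\<close>.\<close>
  have e1: "x t * x' + y t * y' = \<sigma> * (r t) ^ 3 * radial (\<sigma> * l) m (\<sigma> * n) (- \<sigma>) (\<theta> t)"
    unfolding x'_def y'_def xc ys radial_def c_def[symmetric] s_def[symmetric] using \<sigma> by algebra
  have e2: "x t * y' - y t * x' = (r t)\<^sup>2 * (1 + r t * angular (\<sigma> * l) m (\<sigma> * n) (- \<sigma>) (\<theta> t))"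
    unfolding x'_def y'_def xc ys angular_def c_def[symmetric] s_def[symmetric] using \<sigma> cs by algebra
  show "(r has_real_derivative \<sigma> * ((r t)\<^sup>2 * radial (\<sigma> * l) m (\<sigma> * n) (- \<sigma>) (\<theta> t))) (at t)"
    using d(1) r unfolding e1 by (simp add: eval_nat_numeral mult.assoc)
  have \<theta>_eq: "\<theta> = (\<lambda>t. arccos (x t / r t))" unfolding \<theta>_def x_def r_def polar_angle_def ..
  have "sgn (y t) = \<sigma>" by (simp add: \<sigma>_def y_def)
  then show "(\<theta> has_real_derivative \<sigma> * (1 + r t * angular (\<sigma> * l) m (\<sigma> * n) (- \<sigma>) (\<theta> t))) (at t)"
    using d(2) r unfolding e2 \<theta>_eq by simp
qed

section \<open>Truncated Lyapunov functions\<close>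

definition lyapunov :: "(real \<Rightarrow> real) \<Rightarrow> (real \<Rightarrow> real) \<Rightarrow> (real \<Rightarrow> real) \<Rightarrow> real \<Rightarrow> real \<Rightarrow> real" where
  "lyapunov v3 v4 v5 r \<theta> = r^2 + r^3 * v3 \<theta> + r^4 * v4 \<theta> + r^5 * v5 \<theta>"

text \<open>The derivative of \<open>lyapunov\<close> along \<open>r' = r\<^sup>2 A(\<theta>)\<close>, \<open>\<theta>' = 1 + r B(\<theta>)\<close>, sorted by powers of \<open>r\<close>.\<close>

definition lyapunov_rate where
  "lyapunov_rate A B v3 v4 v5 w3 w4 w5 (r :: real) (\<theta> :: real) =
     r^3 * (2 * A \<theta> + w3 \<theta>) + r^4 * (3 * v3 \<theta> * A \<theta> + w3 \<theta> * B \<theta> + w4 \<theta>)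
     + r^5 * (4 * v4 \<theta> * A \<theta> + w4 \<theta> * B \<theta> + w5 \<theta>) + r^6 * (5 * v5 \<theta> * A \<theta> + w5 \<theta> * B \<theta> :: real)"

text \<open>Near the origin the truncated function is strictly monotone along half-turns, increasing
  for \<open>\<kappa> > 0\<close> and decreasing for \<open>\<kappa> < 0\<close>. The sign is
  demanded only on \<open>{0..pi}\<close>, the range of \<open>polar_angle\<close>.\<close>

definition lyapunov_triple ::
  "real \<Rightarrow> real \<Rightarrow> real \<Rightarrow> real \<Rightarrow> (real \<Rightarrow> real) \<Rightarrow> (real \<Rightarrow> real) \<Rightarrow> (real \<Rightarrow> real) \<Rightarrow> real \<Rightarrow> bool" where
  "lyapunov_triple a b f e v3 v4 v5 \<kappa> \<longleftrightarrow>
     (\<exists>w3 w4 w5 \<epsilon>. 0 < \<epsilon> \<and>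
        (\<forall>\<theta>. (v3 has_real_derivative w3 \<theta>) (at \<theta>) \<and> (v4 has_real_derivative w4 \<theta>) (at \<theta>)
           \<and> (v5 has_real_derivative w5 \<theta>) (at \<theta>)) \<and>
        (\<forall>r \<theta>. 0 < r \<longrightarrow> r < \<epsilon> \<longrightarrow> \<theta> \<in> {0..pi} \<longrightarrow>
           0 < \<kappa> * lyapunov_rate (radial a b f e) (angular a b f e) v3 v4 v5 w3 w4 w5 r \<theta>))"

lemma DERIV_everywhere_continuous_on:
  "(\<And>\<theta>. (v has_real_derivative w \<theta>) (at \<theta>)) \<Longrightarrow> continuous_on S v"
  by (rule DERIV_continuous_on[where D = w]) (rule has_field_derivative_at_within)

lemma leading_term_sign:
  fixes T :: "real \<Rightarrow> real"
  assumes T: "continuous_on {0..pi} T" "continuous_on {0..pi} T'" "continuous_on {0..pi} T''" and \<kappa>: "\<kappa> \<noteq> 0"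
  obtains \<epsilon> where "0 < \<epsilon>"
    "\<And>r \<theta>. 0 < r \<Longrightarrow> r < \<epsilon> \<Longrightarrow> \<theta> \<in> {0..pi} \<Longrightarrow> 0 < \<kappa> * (\<kappa> + r * T \<theta> + r^2 * T' \<theta> + r^3 * T'' \<theta>)"
proof -
  have bdd: "\<exists>C. \<forall>\<theta>\<in>{0..pi}. \<bar>g \<theta>\<bar> \<le> C" if "continuous_on {0..pi} g" for g :: "real \<Rightarrow> real"
    using compact_imp_bounded[OF compact_continuous_image[OF that compact_Icc]]
    by (auto simp: bounded_iff)
  obtain C0 where C0: "\<And>\<theta>. \<theta> \<in> {0..pi} \<Longrightarrow> \<bar>T \<theta>\<bar> \<le> C0" using bdd[OF T(1)] by blast
  obtain C1 where C1: "\<And>\<theta>. \<theta> \<in> {0..pi} \<Longrightarrow> \<bar>T' \<theta>\<bar> \<le> C1" using bdd[OF T(2)] by blast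
  obtain C2 where C2: "\<And>\<theta>. \<theta> \<in> {0..pi} \<Longrightarrow> \<bar>T'' \<theta>\<bar> \<le> C2" using bdd[OF T(3)] by blast
  define M where "M = 1 + \<bar>C0\<bar> + \<bar>C1\<bar> + \<bar>C2\<bar>"
  \<comment> \<open>For \<open>r < 1\<close> the bracket \<open>Q\<close> of the remainder
    \<open>r * Q\<close> is bounded by \<open>M\<close>, and
    \<open>r < \<bar>\<kappa>\<bar> / M\<close> makes the remainder smaller than the leading
    term.\<close>
  define \<epsilon> where "\<epsilon> = min 1 (\<bar>\<kappa>\<bar> / M)"
  have M: "1 \<le> M" by (simp add: M_def)
  show ?thesis
  proof (rule that[of \<epsilon>])
    show "0 < \<epsilon>" using M \<kappa> by (simp add: \<epsilon>_def)
    fix r \<theta> :: real assume r: "0 < r" "r < \<epsilon>" and \<theta>: "\<theta> \<in> {0..pi}"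
    define Q where "Q = T \<theta> + r * T' \<theta> + r^2 * T'' \<theta>"
    have "r \<le> 1" using r by (simp add: \<epsilon>_def)
    then have r2: "\<bar>r\<bar> \<le> 1" "\<bar>r^2\<bar> \<le> 1" using r by (auto simp: power_le_one)
    have "\<bar>r * T' \<theta>\<bar> \<le> \<bar>T' \<theta>\<bar>" "\<bar>r^2 * T'' \<theta>\<bar> \<le> \<bar>T'' \<theta>\<bar>"
      by (intro abs_mult_le_right r2)+
    then have "\<bar>Q\<bar> \<le> M"
      unfolding Q_def M_def using C0[OF \<theta>] C1[OF \<theta>] C2[OF \<theta>] by linarith
    then have "\<bar>r * Q\<bar> \<le> r * M" using r by (simp add: abs_mult mult_left_mono)
    also have "\<dots> < \<bar>\<kappa>\<bar>"
    proof -
      have "r < \<bar>\<kappa>\<bar> / M" using r by (simp add: \<epsilon>_def)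
      then show ?thesis using M by (simp add: pos_less_divide_eq)
    qed
    finally have "0 < \<kappa> * (\<kappa> + r * Q)"
      using \<kappa> by (auto simp: zero_less_mult_iff)
    then show "0 < \<kappa> * (\<kappa> + r * T \<theta> + r^2 * T' \<theta> + r^3 * T'' \<theta>)"
      by (simp add: Q_def algebra_simps eval_nat_numeral)
  qed
qed

lemma lyapunov_tripleI:
  fixes N :: nat
  assumes d: "\<And>\<theta>. (v3 has_real_derivative w3 \<theta>) (at \<theta>)" "\<And>\<theta>. (v4 has_real_derivative w4 \<theta>) (at \<theta>)"
      "\<And>\<theta>. (v5 has_real_derivative w5 \<theta>) (at \<theta>)"
    and T: "continuous_on {0..pi} T" "continuous_on {0..pi} T'" "continuous_on {0..pi} T''" and \<kappa>: "\<kappa> \<noteq> 0"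
    and rate: "\<And>r \<theta>. lyapunov_rate (radial a b f e) (angular a b f e) v3 v4 v5 w3 w4 w5 r \<theta>
      = r ^ N * (\<kappa> + r * T \<theta> + r^2 * T' \<theta> + r^3 * T'' \<theta>)"
  shows "lyapunov_triple a b f e v3 v4 v5 \<kappa>"
proof -
  obtain \<epsilon> where \<epsilon>: "0 < \<epsilon>"
    "\<And>r \<theta>. 0 < r \<Longrightarrow> r < \<epsilon> \<Longrightarrow> \<theta> \<in> {0..pi} \<Longrightarrow> 0 < \<kappa> * (\<kappa> + r * T \<theta> + r^2 * T' \<theta> + r^3 * T'' \<theta>)"
    using leading_term_sign[OF T \<kappa>] by metis
  have "0 < \<kappa> * (r ^ N * (\<kappa> + r * T \<theta> + r^2 * T' \<theta> + r^3 * T'' \<theta>))"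
    if "0 < r" "r < \<epsilon>" "\<theta> \<in> {0..pi}" for r \<theta>
    using mult_pos_pos[OF zero_less_power[OF that(1), of N] \<epsilon>(2)[OF that]] by (simp only: ac_simps)
  then show ?thesis
    unfolding lyapunov_triple_def
    by (intro exI[of _ w3] exI[of _ w4] exI[of _ w5] exI[of _ \<epsilon>]) (simp add: rate \<epsilon>(1) d)
qed

lemma lyapunov_bounds:
  assumes "continuous_on {0..pi} v3" "continuous_on {0..pi} v4" "continuous_on {0..pi} v5"
  obtains \<epsilon> where "0 < \<epsilon>"
    "\<And>r \<theta>. 0 < r \<Longrightarrow> r < \<epsilon> \<Longrightarrow> \<theta> \<in> {0..pi} \<Longrightarrow> r\<^sup>2 / 2 \<le> lyapunov v3 v4 v5 r \<theta> \<and> lyapunov v3 v4 v5 r \<theta> \<le> 2 * r\<^sup>2"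
proof -
  \<comment> \<open>The sign lemma with leading terms \<open>1/2\<close> and \<open>- 1\<close>
    gives the lower bound 1/2 and the upper bound 2 for the quotient of \<open>lyapunov\<close> by
    \<open>r^2\<close>.\<close>
  obtain \<epsilon> where \<epsilon>: "0 < \<epsilon>"
    "\<And>r \<theta>. 0 < r \<Longrightarrow> r < \<epsilon> \<Longrightarrow> \<theta> \<in> {0..pi} \<Longrightarrow> 0 < (1/2) * (1/2 + r * v3 \<theta> + r^2 * v4 \<theta> + r^3 * v5 \<theta>)"
    by (rule leading_term_sign[OF assms, of "1/2"]) auto
  obtain \<epsilon>' where \<epsilon>': "0 < \<epsilon>'"
    "\<And>r \<theta>. 0 < r \<Longrightarrow> r < \<epsilon>' \<Longrightarrow> \<theta> \<in> {0..pi} \<Longrightarrow> 0 < (- 1) * (- 1 + r * v3 \<theta> + r^2 * v4 \<theta> + r^3 * v5 \<theta>)"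
    by (rule leading_term_sign[OF assms, of "- 1"]) auto
  show ?thesis
  proof (rule that[of "min \<epsilon> \<epsilon>'"])
    show "0 < min \<epsilon> \<epsilon>'" using \<epsilon>(1) \<epsilon>'(1) by simp
    fix r \<theta> :: real assume r: "0 < r" "r < min \<epsilon> \<epsilon>'" "\<theta> \<in> {0..pi}"
    define q where "q = 1 + r * v3 \<theta> + r^2 * v4 \<theta> + r^3 * v5 \<theta>"
    have q: "1/2 \<le> q" "q \<le> 2" using \<epsilon>(2)[of r \<theta>] \<epsilon>'(2)[of r \<theta>] r by (auto simp: q_def)
    have "lyapunov v3 v4 v5 r \<theta> = r\<^sup>2 * q" by (simp add: lyapunov_def q_def algebra_simps eval_nat_numeral)
    then show "r\<^sup>2 / 2 \<le> lyapunov v3 v4 v5 r \<theta> \<and> lyapunov v3 v4 v5 r \<theta> \<le> 2 * r\<^sup>2"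
      using mult_left_mono[OF q(1), of "r\<^sup>2"] mult_left_mono[OF q(2), of "r\<^sup>2"] by simp
  qed
qed

lemma lyapunov_along_orbit:
  fixes \<gamma> :: "real \<Rightarrow> real \<times> real"
  assumes \<gamma>: "(\<gamma> has_vector_derivative quadratic_field l m n (\<gamma> t)) (at t)" and nz: "snd (\<gamma> t) \<noteq> 0"
    and v: "\<And>\<theta>. (v3 has_real_derivative w3 \<theta>) (at \<theta>)" "\<And>\<theta>. (v4 has_real_derivative w4 \<theta>) (at \<theta>)"
      "\<And>\<theta>. (v5 has_real_derivative w5 \<theta>) (at \<theta>)"
  defines "\<sigma> \<equiv> sgn (snd (\<gamma> t))"
  shows "((\<lambda>t. lyapunov v3 v4 v5 (norm (\<gamma> t)) (polar_angle (\<gamma> t))) has_real_derivative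
      \<sigma> * lyapunov_rate (radial (\<sigma> * l) m (\<sigma> * n) (- \<sigma>)) (angular (\<sigma> * l) m (\<sigma> * n) (- \<sigma>))
        v3 v4 v5 w3 w4 w5 (norm (\<gamma> t)) (polar_angle (\<gamma> t))) (at t)"
proof -
  define r \<theta> where "r = (\<lambda>t. norm (\<gamma> t))" and "\<theta> = (\<lambda>t. polar_angle (\<gamma> t))"
  define A B where "A = radial (\<sigma> * l) m (\<sigma> * n) (- \<sigma>)" and "B = angular (\<sigma> * l) m (\<sigma> * n) (- \<sigma>)"
  have dr: "(r has_real_derivative \<sigma> * ((r t)\<^sup>2 * A (\<theta> t))) (at t)"
    and d\<theta>: "(\<theta> has_real_derivative \<sigma> * (1 + r t * B (\<theta> t))) (at t)"
    using polar_coordinates_along_orbit[OF \<gamma> nz] unfolding r_def \<theta>_def A_def B_def \<sigma>_def by blast+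
  note dv = DERIV_chain2[OF v(1) d\<theta>] DERIV_chain2[OF v(2) d\<theta>] DERIV_chain2[OF v(3) d\<theta>]
  have "((\<lambda>t. lyapunov v3 v4 v5 (r t) (\<theta> t)) has_real_derivative
      \<sigma> * lyapunov_rate A B v3 v4 v5 w3 w4 w5 (r t) (\<theta> t)) (at t)"
    unfolding lyapunov_def lyapunov_rate_def
    by (rule derivative_eq_intros dr dv refl)+ (simp add: algebra_simps eval_nat_numeral)
  then show ?thesis unfolding r_def \<theta>_def A_def B_def .
qed

text \<open>The lower triple belongs to the reflected, time-reversed system, hence the coefficients
  \<open>- l\<close>, \<open>- n\<^sub>2\<close>, \<open>1\<close>. Undoing the time reversal
  changes the sign of its rate, so \<open>- \<kappa>\<close> there means the same direction of
  monotonicity as \<open>\<kappa>\<close> above. Equality at the angles 0 and \<open>pi\<close>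
  makes the glued function continuous across \<open>y = 0\<close>.\<close>

lemma not_center_of_lyapunov_triples:
  assumes up: "lyapunov_triple l m\<^sub>1 n\<^sub>1 (-1) v3 v4 v5 \<kappa>" and lo: "lyapunov_triple (- l) m\<^sub>2 (- n\<^sub>2) 1 u3 u4 u5 (- \<kappa>)"
    and zero: "v3 0 = u3 0" "v4 0 = u4 0" "v5 0 = u5 0" and pi: "v3 pi = u3 pi" "v4 pi = u4 pi" "v5 pi = u5 pi"
  shows "\<not> center_at_origin (quadratic_field l m\<^sub>1 n\<^sub>1) (quadratic_field l m\<^sub>2 n\<^sub>2)"
proof -
  let ?R1 = "lyapunov_rate (radial l m\<^sub>1 n\<^sub>1 (-1)) (angular l m\<^sub>1 n\<^sub>1 (-1)) v3 v4 v5"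
  let ?R2 = "lyapunov_rate (radial (- l) m\<^sub>2 (- n\<^sub>2) 1) (angular (- l) m\<^sub>2 (- n\<^sub>2) 1) u3 u4 u5"
  obtain p3 p4 p5 \<epsilon>1 where P: "0 < \<epsilon>1 \<and>
    (\<forall>\<theta>. (v3 has_real_derivative p3 \<theta>) (at \<theta>) \<and> (v4 has_real_derivative p4 \<theta>) (at \<theta>) \<and> (v5 has_real_derivative p5 \<theta>) (at \<theta>)) \<and>
    (\<forall>r \<theta>. 0 < r \<longrightarrow> r < \<epsilon>1 \<longrightarrow> \<theta> \<in> {0..pi} \<longrightarrow> 0 < \<kappa> * ?R1 p3 p4 p5 r \<theta>)"
    using up unfolding lyapunov_triple_def by blast
  have v: "0 < \<epsilon>1" "\<And>\<theta>. (v3 has_real_derivative p3 \<theta>) (at \<theta>)"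
      "\<And>\<theta>. (v4 has_real_derivative p4 \<theta>) (at \<theta>)" "\<And>\<theta>. (v5 has_real_derivative p5 \<theta>) (at \<theta>)"
    and v_rate: "\<And>r \<theta>. 0 < r \<Longrightarrow> r < \<epsilon>1 \<Longrightarrow> \<theta> \<in> {0..pi} \<Longrightarrow> 0 < \<kappa> * ?R1 p3 p4 p5 r \<theta>"
    using P by simp_all
  obtain q3 q4 q5 \<epsilon>2 where Q: "0 < \<epsilon>2 \<and>
    (\<forall>\<theta>. (u3 has_real_derivative q3 \<theta>) (at \<theta>) \<and> (u4 has_real_derivative q4 \<theta>) (at \<theta>) \<and> (u5 has_real_derivative q5 \<theta>) (at \<theta>)) \<and>
    (\<forall>r \<theta>. 0 < r \<longrightarrow> r < \<epsilon>2 \<longrightarrow> \<theta> \<in> {0..pi} \<longrightarrow> 0 < - \<kappa> * ?R2 q3 q4 q5 r \<theta>)"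
    using lo unfolding lyapunov_triple_def by blast
  have u: "0 < \<epsilon>2" "\<And>\<theta>. (u3 has_real_derivative q3 \<theta>) (at \<theta>)"
      "\<And>\<theta>. (u4 has_real_derivative q4 \<theta>) (at \<theta>)" "\<And>\<theta>. (u5 has_real_derivative q5 \<theta>) (at \<theta>)"
    and u_rate: "\<And>r \<theta>. 0 < r \<Longrightarrow> r < \<epsilon>2 \<Longrightarrow> \<theta> \<in> {0..pi} \<Longrightarrow> 0 < - \<kappa> * ?R2 q3 q4 q5 r \<theta>"
    using Q by simp_all
  have c: "continuous_on S v3" "continuous_on S v4" "continuous_on S v5"
    "continuous_on S u3" "continuous_on S u4" "continuous_on S u5" for S
    using v(2-4)[THEN DERIV_everywhere_continuous_on] u(2-4)[THEN DERIV_everywhere_continuous_on] by auto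
  obtain \<epsilon>3 where \<epsilon>3: "0 < \<epsilon>3" "\<And>r \<theta>. 0 < r \<Longrightarrow> r < \<epsilon>3 \<Longrightarrow> \<theta> \<in> {0..pi} \<Longrightarrow>
      r\<^sup>2 / 2 \<le> lyapunov v3 v4 v5 r \<theta> \<and> lyapunov v3 v4 v5 r \<theta> \<le> 2 * r\<^sup>2"
    using lyapunov_bounds[OF c(1-3)] by metis
  obtain \<epsilon>4 where \<epsilon>4: "0 < \<epsilon>4" "\<And>r \<theta>. 0 < r \<Longrightarrow> r < \<epsilon>4 \<Longrightarrow> \<theta> \<in> {0..pi} \<Longrightarrow>
      r\<^sup>2 / 2 \<le> lyapunov u3 u4 u5 r \<theta> \<and> lyapunov u3 u4 u5 r \<theta> \<le> 2 * r\<^sup>2"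
    using lyapunov_bounds[OF c(4-6)] by metis
  define V where "V p = (if 0 \<le> snd p then lyapunov v3 v4 v5 (norm p) (polar_angle p)
    else lyapunov u3 u4 u5 (norm p) (polar_angle p))" for p :: "real \<times> real"
  define \<epsilon> where "\<epsilon> = min (min \<epsilon>1 \<epsilon>2) (min \<epsilon>3 \<epsilon>4)"
  show ?thesis
  proof (rule not_center_of_monotone_function[of \<epsilon> V _ \<kappa>])
    show "0 < \<epsilon>" using v(1) u(1) \<epsilon>3(1) \<epsilon>4(1) by (simp add: \<epsilon>_def)
    have cont: "continuous_on (UNIV \<times> {0..pi}) (\<lambda>(r, \<theta>). lyapunov a3 a4 a5 r \<theta>)"
      if "continuous_on {0..pi} a3" "continuous_on {0..pi} a4" "continuous_on {0..pi} a5" for a3 a4 a5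
    proof -
      have "continuous_on (UNIV \<times> {0..pi}) (\<lambda>p :: real \<times> real. a (snd p))" if "continuous_on {0..pi} a" for a :: "real \<Rightarrow> real"
        by (rule continuous_on_compose2[OF that]) (auto intro!: continuous_intros)
      note this[OF that(1)] this[OF that(2)] this[OF that(3)]
      then show ?thesis unfolding lyapunov_def case_prod_beta by (intro continuous_intros)
    qed
    show "continuous_on (- {0}) V"
      unfolding V_def
      by (rule continuous_on_polar_glue[OF cont[OF c(1-3)] cont[OF c(4-6)]]) (simp_all add: lyapunov_def zero pi)
    show "(norm p)\<^sup>2 / 2 \<le> V p \<and> V p \<le> 2 * (norm p)\<^sup>2" if p: "0 < norm p" "norm p < \<epsilon>" for p :: "real \<times> real"
    proof -
      have "polar_angle p \<in> {0..pi}" using p by (intro polar_angle) auto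
      then show ?thesis
        using \<epsilon>3(2)[of "norm p" "polar_angle p"] \<epsilon>4(2)[of "norm p" "polar_angle p"] p by (simp add: V_def \<epsilon>_def)
    qed
    fix \<gamma> :: "real \<Rightarrow> real \<times> real" and t
    {
      assume \<gamma>: "(\<gamma> has_vector_derivative quadratic_field l m\<^sub>1 n\<^sub>1 (\<gamma> t)) (at t)" and pos: "0 < snd (\<gamma> t)" and small: "norm (\<gamma> t) < \<epsilon>"
      have nz: "\<gamma> t \<noteq> 0" using pos by auto
      let ?D = "lyapunov_rate (radial l m\<^sub>1 n\<^sub>1 (-1)) (angular l m\<^sub>1 n\<^sub>1 (-1)) v3 v4 v5 p3 p4 p5 (norm (\<gamma> t)) (polar_angle (\<gamma> t))"
      have "((\<lambda>t. lyapunov v3 v4 v5 (norm (\<gamma> t)) (polar_angle (\<gamma> t))) has_real_derivative ?D) (at t)"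
        using lyapunov_along_orbit[OF \<gamma> _ v(2-4)] pos by simp
      moreover have "((\<lambda>t. snd (\<gamma> t)) \<longlongrightarrow> snd (\<gamma> t)) (nhds t)"
        using has_vector_derivative_continuous[OF \<gamma>] by (auto simp: continuous_at tendsto_at_iff_tendsto_nhds intro: tendsto_snd)
      then have "\<forall>\<^sub>F s in nhds t. 0 < snd (\<gamma> s)"
        using pos by (rule order_tendstoD)
      then have "\<forall>\<^sub>F s in nhds t. V (\<gamma> s) = lyapunov v3 v4 v5 (norm (\<gamma> s)) (polar_angle (\<gamma> s))"
        by eventually_elim (simp add: V_def)
      ultimately have "((\<lambda>t. V (\<gamma> t)) has_real_derivative ?D) (at t)"
        by (subst DERIV_cong_ev[OF refl _ refl])
      moreover have "0 < \<kappa> * ?D"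
        using small nz polar_angle(1)[OF nz] by (intro v_rate) (auto simp: \<epsilon>_def)
      ultimately show "\<exists>D. ((\<lambda>t. V (\<gamma> t)) has_real_derivative D) (at t) \<and> 0 < \<kappa> * D" by blast
    next
      assume \<gamma>: "(\<gamma> has_vector_derivative quadratic_field l m\<^sub>2 n\<^sub>2 (\<gamma> t)) (at t)" and neg: "snd (\<gamma> t) < 0" and small: "norm (\<gamma> t) < \<epsilon>"
      have nz: "\<gamma> t \<noteq> 0" using neg by auto
      let ?D = "lyapunov_rate (radial (- l) m\<^sub>2 (- n\<^sub>2) 1) (angular (- l) m\<^sub>2 (- n\<^sub>2) 1) u3 u4 u5 q3 q4 q5 (norm (\<gamma> t)) (polar_angle (\<gamma> t))"
      have "((\<lambda>t. lyapunov u3 u4 u5 (norm (\<gamma> t)) (polar_angle (\<gamma> t))) has_real_derivative - ?D) (at t)"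
        using lyapunov_along_orbit[OF \<gamma> _ u(2-4)] neg by simp
      moreover have "((\<lambda>t. snd (\<gamma> t)) \<longlongrightarrow> snd (\<gamma> t)) (nhds t)"
        using has_vector_derivative_continuous[OF \<gamma>] by (auto simp: continuous_at tendsto_at_iff_tendsto_nhds intro: tendsto_snd)
      then have "\<forall>\<^sub>F s in nhds t. snd (\<gamma> s) < 0"
        using neg by (rule order_tendstoD)
      then have "\<forall>\<^sub>F s in nhds t. V (\<gamma> s) = lyapunov u3 u4 u5 (norm (\<gamma> s)) (polar_angle (\<gamma> s))"
        by eventually_elim (simp add: V_def)
      ultimately have "((\<lambda>t. V (\<gamma> t)) has_real_derivative - ?D) (at t)"
        by (subst DERIV_cong_ev[OF refl _ refl])
      moreover have "0 < - \<kappa> * ?D"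
        using small nz polar_angle(1)[OF nz] by (intro u_rate) (auto simp: \<epsilon>_def)
      ultimately show "\<exists>D. ((\<lambda>t. V (\<gamma> t)) has_real_derivative D) (at t) \<and> 0 < \<kappa> * D" by auto
    }
  qed
qed

section \<open>Lyapunov triples with leading order 3, 4 and 5\<close>

text \<open>A linear term in \<open>\<theta>\<close> puts the prescribed \<open>\<kappa>\<close> in
  front of \<open>r^3\<close>. Centering it at \<open>pi / 2\<close> keeps the two end values
  opposite, so matching two such functions at 0 matches them at \<open>pi\<close> too.\<close>

lemma lyapunov_triple_order3:
  assumes "\<kappa> \<noteq> 0"
  obtains v3 where "lyapunov_triple a b f e v3 (\<lambda>_. 0) (\<lambda>_. 0) \<kappa>"
    "v3 0 = 2 * b / 3 - \<kappa> * pi / 2" "v3 pi = - (2 * b / 3 - \<kappa> * pi / 2)"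
proof -
  let ?A = "radial a b f e" and ?B = "angular a b f e"
  obtain v3 where v: "\<And>\<theta>. (v3 has_real_derivative - 2 * ?A \<theta>) (at \<theta>)" "v3 0 = 2 * b / 3" "v3 pi = - 2 * b / 3"
    using lyapunov_expansion[of a b f e] by metis
  let ?v = "\<lambda>\<theta>. v3 \<theta> + \<kappa> * (\<theta> - pi / 2)"
  have c: "continuous_on S v3" for S
    by (rule DERIV_everywhere_continuous_on, rule v)+
  have "lyapunov_triple a b f e ?v (\<lambda>_. 0) (\<lambda>_. 0) \<kappa>"
  proof (rule lyapunov_tripleI[where N = 3 and T' = "\<lambda>_. 0" and T'' = "\<lambda>_. 0" and ?w4.0 = "\<lambda>_. 0" and ?w5.0 = "\<lambda>_. 0"])
    show "(?v has_real_derivative (- 2 * ?A \<theta> + \<kappa>)) (at \<theta>)" for \<theta>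
      by (rule derivative_eq_intros v(1) refl)+ simp
    show "lyapunov_rate ?A ?B ?v (\<lambda>_. 0) (\<lambda>_. 0) (\<lambda>\<theta>. - 2 * ?A \<theta> + \<kappa>) (\<lambda>_. 0) (\<lambda>_. 0) r \<theta>
        = r ^ 3 * (\<kappa> + r * (3 * ?v \<theta> * ?A \<theta> + (- 2 * ?A \<theta> + \<kappa>) * ?B \<theta>) + r^2 * 0 + r^3 * 0)" for r \<theta>
      by (simp add: lyapunov_rate_def algebra_simps eval_nat_numeral)
  qed (auto intro!: continuous_intros c assms)
  then show ?thesis by (rule that) (simp_all add: v)
qed

text \<open>The periodic solution leaves \<open>- K\<close> in front of \<open>r^4\<close>, and a
  term \<open>k * \<theta>\<close> adds \<open>k\<close>. The end values depend on \<open>k\<close>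
  but not on \<open>K\<close>, so two half-planes can share \<open>k\<close> while their leading
  coefficients differ.\<close>

lemma lyapunov_triple_order4:
  assumes "\<kappa> = k + b * (a + f) / 4" "\<kappa> \<noteq> 0"
  obtains v3 v4 where "lyapunov_triple a b f e v3 v4 (\<lambda>_. 0) \<kappa>"
    "v3 0 = 2 * b / 3" "v3 pi = - 2 * b / 3" "v4 0 = 0" "v4 pi = k * pi"
proof -
  let ?A = "radial a b f e" and ?B = "angular a b f e"
  define K where "K = - b * (a + f) / 4"
  obtain v3 v4 where v: "\<And>\<theta>. (v3 has_real_derivative - 2 * ?A \<theta>) (at \<theta>)"
    "\<And>\<theta>. (v4 has_real_derivative - (3 * v3 \<theta> * ?A \<theta> - 2 * ?A \<theta> * ?B \<theta>) - K) (at \<theta>)"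
    "v3 0 = 2 * b / 3" "v3 pi = - 2 * b / 3" "v4 0 = 0" "v4 pi = 0"
    using lyapunov_expansion[of a b f e] unfolding K_def by metis
  let ?v = "\<lambda>\<theta>. v4 \<theta> + k * \<theta>" and ?w = "\<lambda>\<theta>. - (3 * v3 \<theta> * ?A \<theta> - 2 * ?A \<theta> * ?B \<theta>) - K + k"
  have \<kappa>: "\<kappa> = k - K" using assms(1) by (simp add: K_def)
  have c: "continuous_on S v3" "continuous_on S v4" for S
    by (rule DERIV_everywhere_continuous_on, rule v)+
  have "lyapunov_triple a b f e v3 ?v (\<lambda>_. 0) \<kappa>"
  proof (rule lyapunov_tripleI[where N = 4 and T' = "\<lambda>_. 0" and T'' = "\<lambda>_. 0" and ?w5.0 = "\<lambda>_. 0", OF v(1)])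
    show "(?v has_real_derivative ?w \<theta>) (at \<theta>)" for \<theta>
      by (rule derivative_eq_intros v(2) refl)+ simp
    show "lyapunov_rate ?A ?B v3 ?v (\<lambda>_. 0) (\<lambda>\<theta>. - 2 * ?A \<theta>) ?w (\<lambda>_. 0) r \<theta>
        = r ^ 4 * (\<kappa> + r * (4 * ?v \<theta> * ?A \<theta> + ?w \<theta> * ?B \<theta>) + r^2 * 0 + r^3 * 0)" for r \<theta>
      by (simp add: lyapunov_rate_def \<kappa> algebra_simps eval_nat_numeral)
  qed (auto intro!: continuous_intros c assms)
  then show ?thesis by (rule that) (simp_all add: v)
qed

lemma lyapunov_triple_order5:
  fixes a b f e \<kappa> :: real
  assumes "\<kappa> \<noteq> 0"
  defines "K \<equiv> - b * (a + f) / 4"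
    and "j \<equiv> 14/45 * a^2 * b + 8/15 * a * b * f - 2/45 * a * b * e - 4/15 * b^3 + 16/45 * b * f^2 + 4/45 * b * f * e"
  obtains v3 v4 v5 where "lyapunov_triple a b f e v3 v4 v5 \<kappa>"
    "v3 0 = 2 * b / 3" "v3 pi = - 2 * b / 3" "v4 0 = 0" "v4 pi = K * pi"
    "v5 0 = j - \<kappa> * pi / 2" "v5 pi = - (j - \<kappa> * pi / 2) - 4 * K * b * pi / 3"
proof -
  let ?A = "radial a b f e" and ?B = "angular a b f e"
  obtain v3 v4 v5 where v: "\<And>\<theta>. (v3 has_real_derivative - 2 * ?A \<theta>) (at \<theta>)"
    "\<And>\<theta>. (v4 has_real_derivative - (3 * v3 \<theta> * ?A \<theta> - 2 * ?A \<theta> * ?B \<theta>) - K) (at \<theta>)"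
    "\<And>\<theta>. (v5 has_real_derivative - (4 * v4 \<theta> * ?A \<theta> + (- (3 * v3 \<theta> * ?A \<theta> - 2 * ?A \<theta> * ?B \<theta>) - K) * ?B \<theta>)
        - K * (2 * v3 \<theta> + ?B \<theta>)) (at \<theta>)"
    "v3 0 = 2 * b / 3" "v3 pi = - 2 * b / 3" "v4 0 = 0" "v4 pi = 0" "v5 0 = j" "v5 pi = - j"
    using lyapunov_expansion[of a b f e] unfolding K_def j_def by metis
  let ?v = "\<lambda>\<theta>. v4 \<theta> + K * \<theta>" and ?w = "\<lambda>\<theta>. - (3 * v3 \<theta> * ?A \<theta> - 2 * ?A \<theta> * ?B \<theta>)"
  \<comment> \<open>\<open>K * \<theta>\<close> in \<open>?v\<close> removes degree 4 but creates
    \<open>4 * K * \<theta> * A\<close> in degree 5, which the derivative of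
    \<open>2 * K * \<theta> * v3\<close> cancels. The last term prescribes the coefficient of
    \<open>r^5\<close>, centered at \<open>pi / 2\<close> as in order 3.\<close>
  let ?u = "\<lambda>\<theta>. v5 \<theta> + 2 * K * \<theta> * v3 \<theta> + \<kappa> * (\<theta> - pi / 2)"
  let ?z = "\<lambda>\<theta>. - (4 * v4 \<theta> * ?A \<theta> + (?w \<theta> - K) * ?B \<theta>) - K * (2 * v3 \<theta> + ?B \<theta>)
    + 2 * K * (v3 \<theta> + \<theta> * (- 2 * ?A \<theta>)) + \<kappa>"
  have c: "continuous_on S v3" "continuous_on S v4" "continuous_on S v5" for S
    by (rule DERIV_everywhere_continuous_on, rule v)+
  have "lyapunov_triple a b f e v3 ?v ?u \<kappa>"
  proof (rule lyapunov_tripleI[where N = 5 and T' = "\<lambda>_. 0" and T'' = "\<lambda>_. 0", OF v(1)])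
    show "(?v has_real_derivative ?w \<theta>) (at \<theta>)" for \<theta>
      by (rule derivative_eq_intros v(2) refl)+ simp
    show "(?u has_real_derivative ?z \<theta>) (at \<theta>)" for \<theta>
      by (rule derivative_eq_intros v(1) v(3) refl)+ (simp add: algebra_simps)
    show "lyapunov_rate ?A ?B v3 ?v ?u (\<lambda>\<theta>. - 2 * ?A \<theta>) ?w ?z r \<theta>
        = r ^ 5 * (\<kappa> + r * (5 * ?u \<theta> * ?A \<theta> + ?z \<theta> * ?B \<theta>) + r^2 * 0 + r^3 * 0)" for r \<theta>
      by (simp add: lyapunov_rate_def algebra_simps eval_nat_numeral)
  qed (auto intro!: continuous_intros c assms)
  then show ?thesis by (rule that) (simp_all add: v)
qed

section \<open>The three necessary conditions\<close>

lemma center_implies_equal_m: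
  assumes "center_at_origin (quadratic_field l m\<^sub>1 n\<^sub>1) (quadratic_field l m\<^sub>2 n\<^sub>2)"
  shows "m\<^sub>1 = m\<^sub>2"
proof (rule ccontr)
  assume ne: "m\<^sub>1 \<noteq> m\<^sub>2"
  \<comment> \<open>The solution of the matching condition \<open>eq\<close> at angle 0; it vanishes
    only for \<open>m\<^sub>1 = m\<^sub>2\<close>.\<close>
  define \<kappa> where "\<kappa> = 2 * (m\<^sub>1 - m\<^sub>2) / (3 * pi)"
  have \<kappa>: "\<kappa> \<noteq> 0" "- \<kappa> \<noteq> 0" using ne by (auto simp: \<kappa>_def)
  have eq: "2 * m\<^sub>1 / 3 - \<kappa> * pi / 2 = 2 * m\<^sub>2 / 3 - (- \<kappa>) * pi / 2"
    by (simp add: \<kappa>_def field_simps)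
  obtain v3 where v: "lyapunov_triple l m\<^sub>1 n\<^sub>1 (-1) v3 (\<lambda>_. 0) (\<lambda>_. 0) \<kappa>"
    "v3 0 = 2 * m\<^sub>1 / 3 - \<kappa> * pi / 2" "v3 pi = - (2 * m\<^sub>1 / 3 - \<kappa> * pi / 2)"
    by (rule lyapunov_triple_order3[OF \<kappa>(1)])
  obtain u3 where u: "lyapunov_triple (- l) m\<^sub>2 (- n\<^sub>2) 1 u3 (\<lambda>_. 0) (\<lambda>_. 0) (- \<kappa>)"
    "u3 0 = 2 * m\<^sub>2 / 3 - (- \<kappa>) * pi / 2" "u3 pi = - (2 * m\<^sub>2 / 3 - (- \<kappa>) * pi / 2)"
    by (rule lyapunov_triple_order3[OF \<kappa>(2)])
  show False
    using not_center_of_lyapunov_triples[OF v(1) u(1)] assms v(2,3) u(2,3) eq by simp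
qed

lemma center_implies_sum_zero:
  assumes "center_at_origin (quadratic_field l m n\<^sub>1) (quadratic_field l m n\<^sub>2)" "m \<noteq> 0"
  shows "2 * l + n\<^sub>1 + n\<^sub>2 = 0"
proof (rule ccontr)
  assume ne: "2 * l + n\<^sub>1 + n\<^sub>2 \<noteq> 0"
  \<comment> \<open>The solution of the two equations \<open>k\<close> below: a common linear term
    on both half-planes and opposite leading coefficients.\<close>
  define \<kappa> k where "\<kappa> = m * (2 * l + n\<^sub>1 + n\<^sub>2) / 8" and "k = m * (n\<^sub>2 - n\<^sub>1) / 8"
  have \<kappa>: "\<kappa> \<noteq> 0" "- \<kappa> \<noteq> 0" using ne assms(2) by (auto simp: \<kappa>_def)
  have k: "\<kappa> = k + m * (l + n\<^sub>1) / 4" "- \<kappa> = k + m * (- l + - n\<^sub>2) / 4"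
    by (simp_all add: \<kappa>_def k_def field_simps)
  obtain v3 v4 where v: "lyapunov_triple l m n\<^sub>1 (-1) v3 v4 (\<lambda>_. 0) \<kappa>"
    "v3 0 = 2 * m / 3" "v3 pi = - 2 * m / 3" "v4 0 = 0" "v4 pi = k * pi"
    by (rule lyapunov_triple_order4[OF k(1) \<kappa>(1)])
  obtain u3 u4 where u: "lyapunov_triple (- l) m (- n\<^sub>2) 1 u3 u4 (\<lambda>_. 0) (- \<kappa>)"
    "u3 0 = 2 * m / 3" "u3 pi = - 2 * m / 3" "u4 0 = 0" "u4 pi = k * pi"
    by (rule lyapunov_triple_order4[OF k(2) \<kappa>(2)])
  show False
    using not_center_of_lyapunov_triples[OF v(1) u(1)] assms(1) v(2-) u(2-) by simp
qed

text \<open>By \<open>sum\<close>, the quantity \<open>a + f\<close> equals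
  \<open>l + n\<^sub>1\<close> in the upper system and also in the reflected lower one. Hence both
  have the same \<open>K\<close>, and all end values agree except those of \<open>v5\<close>, where
  the constants \<open>j\<close> differ. This difference is a multiple of
  \<open>m * (l + n\<^sub>1) * (2 * l + 1)\<close> and is balanced by
  \<open>\<kappa>\<close>.\<close>

lemma center_implies_last_condition:
  assumes center: "center_at_origin (quadratic_field l m n\<^sub>1) (quadratic_field l m n\<^sub>2)" and m: "m \<noteq> 0"
    and sum: "2 * l + n\<^sub>1 + n\<^sub>2 = 0"
  shows "l + n\<^sub>1 = 0 \<or> 2 * l + 1 = 0"
proof (rule ccontr)
  assume ne: "\<not> ?thesis"
  define \<delta> where "\<delta> = l + n\<^sub>1"
  have n: "n\<^sub>1 = \<delta> - l" "- n\<^sub>2 = \<delta> - - l" using sum by (auto simp: \<delta>_def)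
  define \<kappa> where "\<kappa> = - 8 * m * \<delta> * (2 * l + 1) / (45 * pi)"
  have \<kappa>: "\<kappa> \<noteq> 0" "- \<kappa> \<noteq> 0" using ne m by (auto simp: \<kappa>_def \<delta>_def)
  define j where "j a f e = 14/45 * a^2 * m + 8/15 * a * m * f - 2/45 * a * m * e - 4/15 * m^3
    + 16/45 * m * f^2 + 4/45 * m * f * e" for a f e :: real
  have K: "- m * (l + n\<^sub>1) / 4 = - m * (- l + - n\<^sub>2) / 4"
    unfolding n by simp
  have "j l n\<^sub>1 (-1) - j (- l) (- n\<^sub>2) 1 = \<kappa> * pi"
    unfolding n j_def by (simp add: \<kappa>_def field_simps eval_nat_numeral)
  then have j_eq: "j l n\<^sub>1 (-1) - \<kappa> * pi / 2 = j (- l) (- n\<^sub>2) 1 - (- \<kappa>) * pi / 2"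
    by simp
  obtain v3 v4 v5 where v: "lyapunov_triple l m n\<^sub>1 (-1) v3 v4 v5 \<kappa>"
    "v3 0 = 2 * m / 3" "v3 pi = - 2 * m / 3" "v4 0 = 0" "v4 pi = (- m * (l + n\<^sub>1) / 4) * pi"
    "v5 0 = j l n\<^sub>1 (-1) - \<kappa> * pi / 2"
    "v5 pi = - (j l n\<^sub>1 (-1) - \<kappa> * pi / 2) - 4 * (- m * (l + n\<^sub>1) / 4) * m * pi / 3"
    unfolding j_def by (rule lyapunov_triple_order5[OF \<kappa>(1)])
  obtain u3 u4 u5 where u: "lyapunov_triple (- l) m (- n\<^sub>2) 1 u3 u4 u5 (- \<kappa>)"
    "u3 0 = 2 * m / 3" "u3 pi = - 2 * m / 3" "u4 0 = 0" "u4 pi = (- m * (- l + - n\<^sub>2) / 4) * pi"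
    "u5 0 = j (- l) (- n\<^sub>2) 1 - (- \<kappa>) * pi / 2"
    "u5 pi = - (j (- l) (- n\<^sub>2) 1 - (- \<kappa>) * pi / 2) - 4 * (- m * (- l + - n\<^sub>2) / 4) * m * pi / 3"
    unfolding j_def by (rule lyapunov_triple_order5[OF \<kappa>(2)])
  have "v3 0 = u3 0" "v4 0 = u4 0" "v5 0 = u5 0" "v3 pi = u3 pi" "v4 pi = u4 pi" "v5 pi = u5 pi"
    unfolding v(2-) u(2-) K j_eq by (rule refl)+
  from not_center_of_lyapunov_triples[OF v(1) u(1) this] center show False by contradiction
qed

theorem corollary1p6:
  fixes l m\<^sub>1 m\<^sub>2 n\<^sub>1 n\<^sub>2 :: real
  shows "center_at_origin (quadratic_field l m\<^sub>1 n\<^sub>1) (quadratic_field l m\<^sub>2 n\<^sub>2) \<longleftrightarrow>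
           (m\<^sub>1 = 0 \<and> m\<^sub>2 = 0) \<or>
           (m\<^sub>1 - m\<^sub>2 = 0 \<and> l + n\<^sub>2 = 0 \<and> l + n\<^sub>1 = 0) \<or>
           (2 * l + 1 = 0 \<and> m\<^sub>1 - m\<^sub>2 = 0 \<and> n\<^sub>1 + n\<^sub>2 - 1 = 0)"
    (is "?center \<longleftrightarrow> ?H1 \<or> ?H2 \<or> ?H3")
proof
  assume center: ?center
  then have m: "m\<^sub>1 = m\<^sub>2" by (rule center_implies_equal_m)
  show "?H1 \<or> ?H2 \<or> ?H3"
  proof (cases "m\<^sub>1 = 0")
    case False
    \<comment> \<open>If \<open>l + n\<^sub>1 = 0\<close>, the first equation gives
      \<open>l + n\<^sub>2 = 0\<close>; if \<open>2 * l + 1 = 0\<close>, it gives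
      \<open>n\<^sub>1 + n\<^sub>2 = 1\<close>.\<close>
    have "2 * l + n\<^sub>1 + n\<^sub>2 = 0" "l + n\<^sub>1 = 0 \<or> 2 * l + 1 = 0"
      using center_implies_sum_zero center_implies_last_condition center False m by blast+
    then show ?thesis using m by auto
  qed (use m in simp)
next
  assume "?H1 \<or> ?H2 \<or> ?H3"
  then consider ?H1 | ?H2 | ?H3 by blast
  then show ?center
  proof cases
    case 1
    then show ?thesis using center_no_xy_term by simp
  next
    case 2
    then have "m\<^sub>2 = m\<^sub>1" "n\<^sub>1 = - l" "n\<^sub>2 = - l" by auto
    then show ?thesis using center_darboux by simp
  next
    case 3
    then have "l = - 1 / 2" "m\<^sub>2 = m\<^sub>1" "n\<^sub>2 = 1 - n\<^sub>1" by auto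
    then show ?thesis using center_projective_reflection[of m\<^sub>1 n\<^sub>1] by simp
  qed
qed

end
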